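(* Let $n\ge0$, let $\mathcal C$ be an $n$-Frobenius category and let $f:M\to N$ be a morphism in $\mathcal C$. Then $(\operatorname{Ext}^n/\mathcal P)f=0$ if and only if $f(\operatorname{Ext}^n/\mathcal P)=0$.
   Context: Let $\mathcal A$ be an abelian category and $\mathcal C$ a full additive extension-closed subcategory with the inherited exact structure: conflations are short exact sequences of $\mathcal A$ with all terms in $\mathcal C$ (first map an inflation, second a deflation). $\operatorname{Ext}^t(A,B)=\operatorname{Ext}^t_{\mathcal C}(A,B)$ ($t\ge1$) is the abelian group (Baer sum) of equivalence classes of exact sequences $B\to X_{t-1}\to\cdots\to X_0\to A$ spliced from $t$ conflations; $\operatorname{Ext}^0=\operatorname{Hom}_{\mathcal C}$. $g\gamma$ and $\gamma h$ denote push-out along $g$ and pull-back along $h$ (compositions if $t=0$). $P\in\mathcal C$ is $n$-projective (resp. $n$-injective) if $\operatorname{Ext}^i(P,X)=0$ (resp. $\operatorname{Ext}^i(X,P)=0$) for all $i>n$ and $X\in\mathcal C$. $\mathcal C$ is $n$-Frobenius if every object has a deflation from an $n$-projective and an inflation into an $n$-injective, and the $n$-projectives coincide with the $n$-injectives. $\mathcal P(X,Y)\subseteq\operatorname{Ext}^n(X,Y)$ is the subgroup of all elements $\eta f$ with $f:X\to P$, $P$ $n$-projective, $\eta\in\operatorname{Ext}^n(P,Y)$. For $f:M\to N$, $(\operatorname{Ext}^n/\mathcal P)f=0$ means that $\gamma f\in\mathcal P(M,Y)$ for all $Y\in\mathcal C$ and $\gamma\in\operatorname{Ext}^n(N,Y)$;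 $f(\operatorname{Ext}^n/\mathcal P)=0$ means that $f\gamma\in\mathcal P(Y,N)$ for all $Y\in\mathcal C$ and $\gamma\in\operatorname{Ext}^n(Y,M)$. *)

theory Defs
  imports "HOL-Algebra.Group"
begin

section \<open>Abelian categories\<close>

record ('o, 'm) cat_data =
  Obj :: "'o set"
  Mor :: "'m set"
  src :: "'m \<Rightarrow> 'o"
  tgt :: "'m \<Rightarrow> 'o"
  idm :: "'o \<Rightarrow> 'm"
  cmp :: "'m \<Rightarrow> 'm \<Rightarrow> 'm" (infixl "\<cdot>\<index>" 70)
  add :: "'m \<Rightarrow> 'm \<Rightarrow> 'm" (infixl "\<boxplus>\<index>" 65)
  zer :: "'o \<Rightarrow> 'o \<Rightarrow> 'm"

definition Hom :: "('o, 'm) cat_data \<Rightarrow> 'o \<Rightarrow> 'o \<Rightarrow> 'm set" where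
  "Hom \<A> X Y = {f \<in> Mor \<A>. src \<A> f = X \<and> tgt \<A> f = Y}"

text \<open>Composition is written in the usual order: \<open>g \<cdot> f\<close> is \<open>f\<close> followed by \<open>g\<close>.\<close>

locale category =
  fixes \<A> :: "('o, 'm) cat_data" (structure)
  assumes src_Obj: "f \<in> Mor \<A> \<Longrightarrow> src \<A> f \<in> Obj \<A>"
    and tgt_Obj: "f \<in> Mor \<A> \<Longrightarrow> tgt \<A> f \<in> Obj \<A>"
    and idm_Hom: "X \<in> Obj \<A> \<Longrightarrow> idm \<A> X \<in> Hom \<A> X X"
    and cmp_Hom: "f \<in> Hom \<A> X Y \<Longrightarrow> g \<in> Hom \<A> Y Z \<Longrightarrow> g \<cdot> f \<in> Hom \<A> X Z"
    and cmp_idm: "f \<in> Hom \<A> X Y \<Longrightarrow> f \<cdot> idm \<A> X = f"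
    and idm_cmp: "f \<in> Hom \<A> X Y \<Longrightarrow> idm \<A> Y \<cdot> f = f"
    and cmp_assoc: "f \<in> Hom \<A> W X \<Longrightarrow> g \<in> Hom \<A> X Y \<Longrightarrow> h \<in> Hom \<A> Y Z
      \<Longrightarrow> h \<cdot> g \<cdot> f = h \<cdot> (g \<cdot> f)"

locale preadditive_category = category +
  assumes Hom_comm_group: "X \<in> Obj \<A> \<Longrightarrow> Y \<in> Obj \<A> \<Longrightarrow>
      comm_group \<lparr>carrier = Hom \<A> X Y, mult = add \<A>, one = zer \<A> X Y\<rparr>"
    and cmp_add: "f \<in> Hom \<A> X Y \<Longrightarrow> g \<in> Hom \<A> Y Z \<Longrightarrow> h \<in> Hom \<A> Y Z
      \<Longrightarrow> (g \<boxplus> h) \<cdot> f = g \<cdot> f \<boxplus> h \<cdot> f"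
    and add_cmp: "f \<in> Hom \<A> X Y \<Longrightarrow> g \<in> Hom \<A> X Y \<Longrightarrow> h \<in> Hom \<A> Y Z
      \<Longrightarrow> h \<cdot> (f \<boxplus> g) = h \<cdot> f \<boxplus> h \<cdot> g"

definition is_zero_object :: "('o, 'm) cat_data \<Rightarrow> 'o \<Rightarrow> bool" where
  "is_zero_object \<A> Z \<longleftrightarrow> Z \<in> Obj \<A> \<and>
     (\<forall>X \<in> Obj \<A>. (\<exists>!f. f \<in> Hom \<A> X Z) \<and> (\<exists>!f. f \<in> Hom \<A> Z X))"

text \<open>A biproduct is given by its two injections followed by its two projections.\<close>

definition is_biproduct ::
  "('o, 'm) cat_data \<Rightarrow> 'o \<Rightarrow> 'o \<Rightarrow> 'o \<Rightarrow> 'm \<times> 'm \<times> 'm \<times> 'm \<Rightarrow> bool" where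
  "is_biproduct \<A> X Y S = (\<lambda>(i1, i2, p1, p2).
     i1 \<in> Hom \<A> X S \<and> i2 \<in> Hom \<A> Y S \<and> p1 \<in> Hom \<A> S X \<and> p2 \<in> Hom \<A> S Y \<and>
     p1 \<cdot>\<^bsub>\<A>\<^esub> i1 = idm \<A> X \<and> p2 \<cdot>\<^bsub>\<A>\<^esub> i2 = idm \<A> Y \<and>
     p1 \<cdot>\<^bsub>\<A>\<^esub> i2 = zer \<A> Y X \<and> p2 \<cdot>\<^bsub>\<A>\<^esub> i1 = zer \<A> X Y \<and>
     i1 \<cdot>\<^bsub>\<A>\<^esub> p1 \<boxplus>\<^bsub>\<A>\<^esub> i2 \<cdot>\<^bsub>\<A>\<^esub> p2 = idm \<A> S)"

definition is_kernel :: "('o, 'm) cat_data \<Rightarrow> 'm \<Rightarrow> 'm \<Rightarrow> bool" where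
  "is_kernel \<A> k f \<longleftrightarrow> k \<in> Mor \<A> \<and> f \<in> Mor \<A> \<and> tgt \<A> k = src \<A> f \<and>
     f \<cdot>\<^bsub>\<A>\<^esub> k = zer \<A> (src \<A> k) (tgt \<A> f) \<and>
     (\<forall>W. \<forall>g \<in> Hom \<A> W (src \<A> f). f \<cdot>\<^bsub>\<A>\<^esub> g = zer \<A> W (tgt \<A> f) \<longrightarrow>
        (\<exists>!u. u \<in> Hom \<A> W (src \<A> k) \<and> k \<cdot>\<^bsub>\<A>\<^esub> u = g))"

definition is_cokernel :: "('o, 'm) cat_data \<Rightarrow> 'm \<Rightarrow> 'm \<Rightarrow> bool" where
  "is_cokernel \<A> q f \<longleftrightarrow> q \<in> Mor \<A> \<and> f \<in> Mor \<A> \<and> src \<A> q = tgt \<A> f \<and>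
     q \<cdot>\<^bsub>\<A>\<^esub> f = zer \<A> (src \<A> f) (tgt \<A> q) \<and>
     (\<forall>W. \<forall>g \<in> Hom \<A> (tgt \<A> f) W. g \<cdot>\<^bsub>\<A>\<^esub> f = zer \<A> (src \<A> f) W \<longrightarrow>
        (\<exists>!u. u \<in> Hom \<A> (tgt \<A> q) W \<and> u \<cdot>\<^bsub>\<A>\<^esub> q = g))"

definition is_mono :: "('o, 'm) cat_data \<Rightarrow> 'm \<Rightarrow> bool" where
  "is_mono \<A> f \<longleftrightarrow> f \<in> Mor \<A> \<and>
     (\<forall>W. \<forall>g \<in> Hom \<A> W (src \<A> f). \<forall>h \<in> Hom \<A> W (src \<A> f). f \<cdot>\<^bsub>\<A>\<^esub> g = f \<cdot>\<^bsub>\<A>\<^esub> h \<longrightarrow> g = h)"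

definition is_epi :: "('o, 'm) cat_data \<Rightarrow> 'm \<Rightarrow> bool" where
  "is_epi \<A> f \<longleftrightarrow> f \<in> Mor \<A> \<and>
     (\<forall>W. \<forall>g \<in> Hom \<A> (tgt \<A> f) W. \<forall>h \<in> Hom \<A> (tgt \<A> f) W. g \<cdot>\<^bsub>\<A>\<^esub> f = h \<cdot>\<^bsub>\<A>\<^esub> f \<longrightarrow> g = h)"

locale abelian_category = preadditive_category +
  assumes ex_zero_object: "\<exists>Z. is_zero_object \<A> Z"
    and ex_biproduct: "X \<in> Obj \<A> \<Longrightarrow> Y \<in> Obj \<A> \<Longrightarrow> \<exists>S \<in> Obj \<A>. \<exists>b. is_biproduct \<A> X Y S b"
    and ex_kernel: "f \<in> Mor \<A> \<Longrightarrow> \<exists>k. is_kernel \<A> k f"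
    and ex_cokernel: "f \<in> Mor \<A> \<Longrightarrow> \<exists>q. is_cokernel \<A> q f"
    and mono_normal: "is_mono \<A> k \<Longrightarrow> \<exists>f. is_kernel \<A> k f"
    and epi_normal: "is_epi \<A> q \<Longrightarrow> \<exists>f. is_cokernel \<A> q f"

definition is_pushout :: "('o, 'm) cat_data \<Rightarrow> 'm \<Rightarrow> 'm \<Rightarrow> 'm \<Rightarrow> 'm \<Rightarrow> bool" where
  \<comment> \<open>the square \<open>x \<cdot> i = i' \<cdot> g\<close>\<close>
  "is_pushout \<A> i g x i' \<longleftrightarrow> i \<in> Mor \<A> \<and> g \<in> Mor \<A> \<and> src \<A> i = src \<A> g \<and>
     x \<in> Hom \<A> (tgt \<A> i) (tgt \<A> x) \<and> i' \<in> Hom \<A> (tgt \<A> g) (tgt \<A> x) \<and>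
     x \<cdot>\<^bsub>\<A>\<^esub> i = i' \<cdot>\<^bsub>\<A>\<^esub> g \<and>
     (\<forall>W. \<forall>u \<in> Hom \<A> (tgt \<A> i) W. \<forall>v \<in> Hom \<A> (tgt \<A> g) W. u \<cdot>\<^bsub>\<A>\<^esub> i = v \<cdot>\<^bsub>\<A>\<^esub> g \<longrightarrow>
        (\<exists>!w. w \<in> Hom \<A> (tgt \<A> x) W \<and> w \<cdot>\<^bsub>\<A>\<^esub> x = u \<and> w \<cdot>\<^bsub>\<A>\<^esub> i' = v))"

definition is_pullback :: "('o, 'm) cat_data \<Rightarrow> 'm \<Rightarrow> 'm \<Rightarrow> 'm \<Rightarrow> 'm \<Rightarrow> bool" where
  \<comment> \<open>the square \<open>p \<cdot> y = h \<cdot> p'\<close>\<close>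
  "is_pullback \<A> p h y p' \<longleftrightarrow> p \<in> Mor \<A> \<and> h \<in> Mor \<A> \<and> tgt \<A> p = tgt \<A> h \<and>
     y \<in> Hom \<A> (src \<A> y) (src \<A> p) \<and> p' \<in> Hom \<A> (src \<A> y) (src \<A> h) \<and>
     p \<cdot>\<^bsub>\<A>\<^esub> y = h \<cdot>\<^bsub>\<A>\<^esub> p' \<and>
     (\<forall>W. \<forall>u \<in> Hom \<A> W (src \<A> p). \<forall>v \<in> Hom \<A> W (src \<A> h). p \<cdot>\<^bsub>\<A>\<^esub> u = h \<cdot>\<^bsub>\<A>\<^esub> v \<longrightarrow>
        (\<exists>!w. w \<in> Hom \<A> W (src \<A> y) \<and> y \<cdot>\<^bsub>\<A>\<^esub> w = u \<and> p' \<cdot>\<^bsub>\<A>\<^esub> w = v))"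


section \<open>Extension-closed subcategories and their exact structure\<close>

definition is_short_exact :: "('o, 'm) cat_data \<Rightarrow> 'm \<Rightarrow> 'm \<Rightarrow> bool" where
  "is_short_exact \<A> i p \<longleftrightarrow> is_kernel \<A> i p \<and> is_cokernel \<A> p i"

text \<open>A full subcategory is given by its set \<open>C\<close> of objects.\<close>

locale extension_closed_subcategory = abelian_category +
  fixes C :: "'a set"
  assumes C_Obj: "C \<subseteq> Obj \<A>"
    and C_zero: "\<exists>Z \<in> C. is_zero_object \<A> Z"
    and C_biproduct: "X \<in> C \<Longrightarrow> Y \<in> C \<Longrightarrow> \<exists>S \<in> C. \<exists>b. is_biproduct \<A> X Y S b"
    and C_extension: "is_short_exact \<A> i p \<Longrightarrow> src \<A> i \<in> C \<Longrightarrow> tgt \<A> p \<in> C \<Longrightarrow> tgt \<A> i \<in> C"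

definition conflation :: "('o, 'm) cat_data \<Rightarrow> 'o set \<Rightarrow> 'm \<Rightarrow> 'm \<Rightarrow> bool" where
  "conflation \<A> C i p \<longleftrightarrow> is_short_exact \<A> i p \<and> src \<A> i \<in> C \<and> tgt \<A> i \<in> C \<and> tgt \<A> p \<in> C"

definition inflation :: "('o, 'm) cat_data \<Rightarrow> 'o set \<Rightarrow> 'm \<Rightarrow> bool" where
  "inflation \<A> C i \<longleftrightarrow> (\<exists>p. conflation \<A> C i p)"

definition deflation :: "('o, 'm) cat_data \<Rightarrow> 'o set \<Rightarrow> 'm \<Rightarrow> bool" where
  "deflation \<A> C p \<longleftrightarrow> (\<exists>i. conflation \<A> C i p)"


section \<open>Yoneda extensions\<close>

text \<open>
  An exact sequence \<open>B \<rightarrow> X\<^sub>t\<^sub>-\<^sub>1 \<rightarrow> \<dots> \<rightarrow> X\<^sub>0 \<rightarrow> A\<close> spliced from \<open>t \<ge> 1\<close> conflations is represented by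
  the list of these conflations, read from left to right, so that the first one starts at \<open>B\<close>
  and the last one ends at \<open>A\<close>.
  A morphism of exact sequences induces unique morphisms between the objects at which the
  sequences are spliced; they are made part of the data in \<open>seq_map\<close>. In particular
  the choice of the splicing does not affect the equivalence class.
\<close>

type_synonym 'm seq = "('m \<times> 'm) list"

fun spliced :: "('o, 'm) cat_data \<Rightarrow> 'o set \<Rightarrow> 'o \<Rightarrow> 'm seq \<Rightarrow> 'o \<Rightarrow> bool" where
  "spliced \<A> C B [] A \<longleftrightarrow> B = A"
| "spliced \<A> C B ((i, p) # \<xi>) A \<longleftrightarrow>
     conflation \<A> C i p \<and> src \<A> i = B \<and> spliced \<A> C (tgt \<A> p) \<xi> A"

definition exact_seqs :: "('o, 'm) cat_data \<Rightarrow> 'o set \<Rightarrow> nat \<Rightarrow> 'o \<Rightarrow> 'o \<Rightarrow> 'm seq set" where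
  "exact_seqs \<A> C t A B = {\<xi>. length \<xi> = t \<and> spliced \<A> C B \<xi> A}"

text \<open>\<open>seq_map \<A> b \<xi> \<zeta> a\<close>: there is a morphism of sequences from \<open>\<xi>\<close> to \<open>\<zeta>\<close> that is \<open>b\<close> at the
  left end and \<open>a\<close> at the right end.\<close>

fun seq_map :: "('o, 'm) cat_data \<Rightarrow> 'm \<Rightarrow> 'm seq \<Rightarrow> 'm seq \<Rightarrow> 'm \<Rightarrow> bool" where
  "seq_map \<A> b [] [] a \<longleftrightarrow> b = a"
| "seq_map \<A> b ((i, p) # \<xi>) ((j, q) # \<zeta>) a \<longleftrightarrow>
     (\<exists>x \<in> Hom \<A> (tgt \<A> i) (tgt \<A> j). \<exists>c \<in> Hom \<A> (tgt \<A> p) (tgt \<A> q).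
        x \<cdot>\<^bsub>\<A>\<^esub> i = j \<cdot>\<^bsub>\<A>\<^esub> b \<and> c \<cdot>\<^bsub>\<A>\<^esub> p = q \<cdot>\<^bsub>\<A>\<^esub> x \<and> seq_map \<A> c \<xi> \<zeta> a)"
| "seq_map \<A> b _ _ a \<longleftrightarrow> False"

definition seq_step :: "('o, 'm) cat_data \<Rightarrow> 'o set \<Rightarrow> 'm seq rel" where
  "seq_step \<A> C = {(\<xi>, \<zeta>). \<exists>A B. spliced \<A> C B \<xi> A \<and> spliced \<A> C B \<zeta> A \<and>
     seq_map \<A> (idm \<A> B) \<xi> \<zeta> (idm \<A> A)}"

definition seq_equiv :: "('o, 'm) cat_data \<Rightarrow> 'o set \<Rightarrow> 'm seq rel" where
  "seq_equiv \<A> C = (seq_step \<A> C \<union> (seq_step \<A> C)\<inverse>)\<^sup>*"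

text \<open>Elements of \<open>Ext\<^sup>0\<close> are morphisms, elements of \<open>Ext\<^sup>t\<close> for \<open>t \<ge> 1\<close> are classes of sequences.\<close>

datatype 'm ext = HomE 'm | ClsE "'m seq set"

definition Ext :: "('o, 'm) cat_data \<Rightarrow> 'o set \<Rightarrow> nat \<Rightarrow> 'o \<Rightarrow> 'o \<Rightarrow> 'm ext set" where
  "Ext \<A> C t A B =
     (if t = 0 then HomE ` Hom \<A> A B else ClsE ` (exact_seqs \<A> C t A B // seq_equiv \<A> C))"

text \<open>The push-out replaces the first conflation of a sequence, the pull-back the last one.\<close>

definition seq_pushout :: "('o, 'm) cat_data \<Rightarrow> 'm \<Rightarrow> 'm seq \<Rightarrow> 'm seq \<Rightarrow> bool" where
  "seq_pushout \<A> g \<xi> \<zeta> \<longleftrightarrow> (\<exists>i p x i' p' \<rho>. \<xi> = (i, p) # \<rho> \<and> \<zeta> = (i', p') # \<rho> \<and>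
     is_pushout \<A> i g x i' \<and> p' \<in> Hom \<A> (tgt \<A> i') (tgt \<A> p) \<and>
     p' \<cdot>\<^bsub>\<A>\<^esub> x = p \<and> p' \<cdot>\<^bsub>\<A>\<^esub> i' = zer \<A> (src \<A> i') (tgt \<A> p))"

definition seq_pullback :: "('o, 'm) cat_data \<Rightarrow> 'm \<Rightarrow> 'm seq \<Rightarrow> 'm seq \<Rightarrow> bool" where
  "seq_pullback \<A> h \<xi> \<zeta> \<longleftrightarrow> (\<exists>i p y i' p' \<rho>. \<xi> = \<rho> @ [(i, p)] \<and> \<zeta> = \<rho> @ [(i', p')] \<and>
     is_pullback \<A> p h y p' \<and> i' \<in> Hom \<A> (src \<A> i) (src \<A> p') \<and>
     y \<cdot>\<^bsub>\<A>\<^esub> i' = i \<and> p' \<cdot>\<^bsub>\<A>\<^esub> i' = zer \<A> (src \<A> i) (tgt \<A> p'))"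

text \<open>Below, an operation on classes is the image under \<open>seq_equiv\<close> of all results obtained
  from representatives. These results are all equivalent, so the image is one single class.\<close>

fun push :: "('o, 'm) cat_data \<Rightarrow> 'o set \<Rightarrow> 'm \<Rightarrow> 'm ext \<Rightarrow> 'm ext" where
  "push \<A> C g (HomE f) = HomE (g \<cdot>\<^bsub>\<A>\<^esub> f)"
| "push \<A> C g (ClsE c) = ClsE (seq_equiv \<A> C `` {\<zeta>. \<exists>\<xi> \<in> c. seq_pushout \<A> g \<xi> \<zeta>})"

fun pull :: "('o, 'm) cat_data \<Rightarrow> 'o set \<Rightarrow> 'm ext \<Rightarrow> 'm \<Rightarrow> 'm ext" where
  "pull \<A> C (HomE f) h = HomE (f \<cdot>\<^bsub>\<A>\<^esub> h)"
| "pull \<A> C (ClsE c) h = ClsE (seq_equiv \<A> C `` {\<zeta>. \<exists>\<xi> \<in> c. seq_pullback \<A> h \<xi> \<zeta>})"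


section \<open>The group structure on Ext\<close>

text \<open>\<open>seq_sum \<A> b \<xi> \<zeta> \<sigma> a\<close>: \<open>\<sigma>\<close> is a termwise direct sum of \<open>\<xi>\<close> and \<open>\<zeta>\<close>, formed with
  the biproducts \<open>b\<close> and \<open>a\<close> at the left and right ends.\<close>

definition sum_mor ::
  "('o, 'm) cat_data \<Rightarrow> 'm \<times> 'm \<times> 'm \<times> 'm \<Rightarrow> 'm \<Rightarrow> 'm \<Rightarrow> 'm \<times> 'm \<times> 'm \<times> 'm \<Rightarrow> 'm" where
  "sum_mor \<A> = (\<lambda>(i1, i2, p1, p2) f g (j1, j2, q1, q2).
     j1 \<cdot>\<^bsub>\<A>\<^esub> f \<cdot>\<^bsub>\<A>\<^esub> p1 \<boxplus>\<^bsub>\<A>\<^esub> j2 \<cdot>\<^bsub>\<A>\<^esub> g \<cdot>\<^bsub>\<A>\<^esub> p2)"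

fun seq_sum :: "('o, 'm) cat_data \<Rightarrow> 'm \<times> 'm \<times> 'm \<times> 'm \<Rightarrow> 'm seq \<Rightarrow> 'm seq \<Rightarrow> 'm seq \<Rightarrow>
    'm \<times> 'm \<times> 'm \<times> 'm \<Rightarrow> bool" where
  "seq_sum \<A> b [] [] [] a \<longleftrightarrow> b = a"
| "seq_sum \<A> b ((i, p) # \<xi>) ((j, q) # \<zeta>) ((k, r) # \<sigma>) a \<longleftrightarrow>
     (\<exists>x c. is_biproduct \<A> (tgt \<A> i) (tgt \<A> j) (tgt \<A> k) x \<and>
        is_biproduct \<A> (tgt \<A> p) (tgt \<A> q) (tgt \<A> r) c \<and>
        k = sum_mor \<A> b i j x \<and> r = sum_mor \<A> x p q c \<and> seq_sum \<A> c \<xi> \<zeta> \<sigma> a)"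
| "seq_sum \<A> b _ _ _ a \<longleftrightarrow> False"

definition codiagonal :: "('o, 'm) cat_data \<Rightarrow> 'm \<times> 'm \<times> 'm \<times> 'm \<Rightarrow> 'm" where
  "codiagonal \<A> = (\<lambda>(i1, i2, p1, p2). p1 \<boxplus>\<^bsub>\<A>\<^esub> p2)"

definition diagonal :: "('o, 'm) cat_data \<Rightarrow> 'm \<times> 'm \<times> 'm \<times> 'm \<Rightarrow> 'm" where
  "diagonal \<A> = (\<lambda>(i1, i2, p1, p2). i1 \<boxplus>\<^bsub>\<A>\<^esub> i2)"

definition baer_sum ::
  "('o, 'm) cat_data \<Rightarrow> 'o set \<Rightarrow> 'o \<Rightarrow> 'o \<Rightarrow> 'm ext \<Rightarrow> 'm ext \<Rightarrow> 'm ext" where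
  "baer_sum \<A> C A B \<gamma> \<delta> = (case (\<gamma>, \<delta>) of
       (HomE f, HomE g) \<Rightarrow> HomE (f \<boxplus>\<^bsub>\<A>\<^esub> g)
     | (ClsE c, ClsE d) \<Rightarrow> ClsE (seq_equiv \<A> C `` {\<tau>. \<exists>\<xi> \<in> c. \<exists>\<zeta> \<in> d. \<exists>S T b a \<sigma> \<rho>.
         is_biproduct \<A> B B S b \<and> is_biproduct \<A> A A T a \<and> seq_sum \<A> b \<xi> \<zeta> \<sigma> a \<and>
         seq_pushout \<A> (codiagonal \<A> b) \<sigma> \<rho> \<and> seq_pullback \<A> (diagonal \<A> a) \<rho> \<tau>})
     | _ \<Rightarrow> undefined)"

text \<open>The neutral element: the zero morphism for \<open>t = 0\<close>, the class of the split conflations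
  \<open>B \<rightarrow> B \<oplus> A \<rightarrow> A\<close> for \<open>t = 1\<close>, and the class of the sequences
  \<open>B = B \<rightarrow> 0 \<rightarrow> \<dots> \<rightarrow> 0 \<rightarrow> A = A\<close> for \<open>t \<ge> 2\<close>.\<close>

fun zero_seqs :: "('o, 'm) cat_data \<Rightarrow> 'o set \<Rightarrow> nat \<Rightarrow> 'o \<Rightarrow> 'o \<Rightarrow> 'm seq set" where
  "zero_seqs \<A> C 0 A B = {}"
| "zero_seqs \<A> C (Suc 0) A B = {[(i1, p2)] | i1 i2 p1 p2 S. is_biproduct \<A> B A S (i1, i2, p1, p2)}"
| "zero_seqs \<A> C (Suc (Suc k)) A B =
     {[(idm \<A> B, zer \<A> B Z)] @ replicate k (zer \<A> Z Z, zer \<A> Z Z) @ [(zer \<A> Z A, idm \<A> A)]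
       | Z. Z \<in> C \<and> is_zero_object \<A> Z}"

definition Ext_zero :: "('o, 'm) cat_data \<Rightarrow> 'o set \<Rightarrow> nat \<Rightarrow> 'o \<Rightarrow> 'o \<Rightarrow> 'm ext" where
  "Ext_zero \<A> C t A B =
     (if t = 0 then HomE (zer \<A> A B) else ClsE (seq_equiv \<A> C `` zero_seqs \<A> C t A B))"

definition Ext_group :: "('o, 'm) cat_data \<Rightarrow> 'o set \<Rightarrow> nat \<Rightarrow> 'o \<Rightarrow> 'o \<Rightarrow> 'm ext monoid" where
  "Ext_group \<A> C t A B =
     \<lparr>carrier = Ext \<A> C t A B, mult = baer_sum \<A> C A B, one = Ext_zero \<A> C t A B\<rparr>"

definition Ext_vanishes :: "('o, 'm) cat_data \<Rightarrow> 'o set \<Rightarrow> nat \<Rightarrow> 'o \<Rightarrow> 'o \<Rightarrow> bool" where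
  "Ext_vanishes \<A> C t A B \<longleftrightarrow> carrier (Ext_group \<A> C t A B) = {\<one>\<^bsub>Ext_group \<A> C t A B\<^esub>}"


section \<open>n-Frobenius categories\<close>

definition n_projective :: "('o, 'm) cat_data \<Rightarrow> 'o set \<Rightarrow> nat \<Rightarrow> 'o \<Rightarrow> bool" where
  "n_projective \<A> C n P \<longleftrightarrow> P \<in> C \<and> (\<forall>i > n. \<forall>X \<in> C. Ext_vanishes \<A> C i P X)"

definition n_injective :: "('o, 'm) cat_data \<Rightarrow> 'o set \<Rightarrow> nat \<Rightarrow> 'o \<Rightarrow> bool" where
  "n_injective \<A> C n P \<longleftrightarrow> P \<in> C \<and> (\<forall>i > n. \<forall>X \<in> C. Ext_vanishes \<A> C i X P)"

locale n_Frobenius_category = extension_closed_subcategory +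
  fixes n :: nat
  assumes enough_n_projectives:
      "X \<in> C \<Longrightarrow> \<exists>P p. n_projective \<A> C n P \<and> p \<in> Hom \<A> P X \<and> deflation \<A> C p"
    and enough_n_injectives:
      "X \<in> C \<Longrightarrow> \<exists>I i. n_injective \<A> C n I \<and> i \<in> Hom \<A> X I \<and> inflation \<A> C i"
    and n_projective_iff_n_injective:
      "n_projective \<A> C n P \<longleftrightarrow> n_injective \<A> C n P"

definition PExt :: "('o, 'm) cat_data \<Rightarrow> 'o set \<Rightarrow> nat \<Rightarrow> 'o \<Rightarrow> 'o \<Rightarrow> 'm ext set" where
  "PExt \<A> C n X Y =
     {pull \<A> C \<eta> f | \<eta> f P. n_projective \<A> C n P \<and> f \<in> Hom \<A> X P \<and> \<eta> \<in> Ext \<A> C n P Y}"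

end

theory Submission
  imports Defs
begin

text \<open>
  Suppose \<open>n \<ge> 1\<close> and that pulling back along \<open>f\<close> lands in \<open>\<P>\<close>. Take \<open>\<gamma> \<in> Ext\<^sup>n(Y, M)\<close> and a sequence
  \<open>\<delta> \<in> Ext\<^sup>n(N, K)\<close> all of whose middle terms are \<open>n\<close>-projective. By hypothesis \<open>\<delta>f = \<eta>a\<close> factors through
  an \<open>n\<close>-projective \<open>P\<close>, so \<open>\<delta>(f\<gamma>) = \<eta>(a\<gamma>)\<close>. Since \<open>P\<close> is \<open>n\<close>-injective, \<open>a\<gamma> = \<tau>b\<close> for some \<open>\<tau>\<close> ending
  in an \<open>n\<close>-projective \<open>P'\<close>, and \<open>\<eta>\<tau> \<in> Ext\<^sup>2\<^sup>n(P', K) = 0\<close>. Hence \<open>\<delta>(f\<gamma>) = 0\<close>. The middle terms of \<open>\<delta>\<close> are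
  \<open>n\<close>-injective, so the conflations of \<open>\<delta>\<close> can be cancelled one after the other by the exactness of
  \<open>Ext\<^sup>t(Y, X) \<rightarrow> Ext\<^sup>t(Y, L) \<rightarrow> Ext\<^sup>t\<^sup>+\<^sup>1(Y, B)\<close>, until \<open>f\<gamma>\<close> itself comes from \<open>Ext\<^sup>n(Y, P\<^sub>1)\<close> with \<open>P\<^sub>1\<close>
  \<open>n\<close>-projective; as before, such a class factors through an \<open>n\<close>-projective on the right.
  Conversely, for \<open>\<gamma> \<in> Ext\<^sup>n(N, Y)\<close> compose with an \<open>n\<close>-injective coresolution \<open>\<theta>\<close> of \<open>M\<close>: \<open>f\<theta> = \<eta>a\<close> gives
  \<open>\<gamma>f\<theta> = (\<gamma>\<eta>)a = 0\<close>, and \<open>\<theta>\<close> is cancelled by the dual exactness, which is obtained in the opposite category.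
\<close>

section \<open>Preadditive categories\<close>

text \<open>Equality in Ext is a zigzag of sequence morphisms, so exactness at the connecting map
  cannot be read off one diagram: it is proved by induction along the zigzag. A forward step pushes
  a lift along. For a backward step the first right-hand square is a pull-back, and the lift is
  extracted from a direct sum by exactness at the middle term; so the two exactness statements
  support each other, with the degree dropping by one. A class in Ext^n(Y, P) with P n-projective
  factors on the right because P embeds into an n-injective I and the cokernel of an inflation
  between n-projectives is again n-projective: for t > n its Ext^t(X, -) lies between Ext^t(X, I)
  and Ext^(t+1)(X, P), both zero. Iterating over the conflations keeps every splicing object
  n-projective. The composites that must vanish have length 2n, which exceeds n only for n >= 1. In
  degree 0 both conditions say that f itself factors through an n-projective.\<close>

lemma Hom_iff: "f \<in> Hom \<A> X Y \<longleftrightarrow> f \<in> Mor \<A> \<and> src \<A> f = X \<and> tgt \<A> f = Y"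
  by (simp add: Hom_def)

context category
begin

lemma src_in_Obj [simp]: "f \<in> Mor \<A> \<Longrightarrow> src \<A> f \<in> Obj \<A>"
  and tgt_in_Obj [simp]: "f \<in> Mor \<A> \<Longrightarrow> tgt \<A> f \<in> Obj \<A>"
  by (rule src_Obj tgt_Obj, assumption)+

lemma idm_simps [simp]:
  assumes "X \<in> Obj \<A>"
  shows "idm \<A> X \<in> Mor \<A>" "src \<A> (idm \<A> X) = X" "tgt \<A> (idm \<A> X) = X"
  using idm_Hom[OF assms] by (simp_all add: Hom_iff)

lemma cmp_simps [simp]:
  assumes "f \<in> Mor \<A>" "g \<in> Mor \<A>" "tgt \<A> f = src \<A> g"
  shows "g \<cdot> f \<in> Mor \<A>" "src \<A> (g \<cdot> f) = src \<A> f" "tgt \<A> (g \<cdot> f) = tgt \<A> g"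
  using cmp_Hom[of f "src \<A> f" "tgt \<A> f" g "tgt \<A> g"] assms by (simp_all add: Hom_iff)

lemma cmp_idm' [simp]: "f \<in> Mor \<A> \<Longrightarrow> src \<A> f = X \<Longrightarrow> f \<cdot> idm \<A> X = f"
  and idm_cmp' [simp]: "f \<in> Mor \<A> \<Longrightarrow> tgt \<A> f = X \<Longrightarrow> idm \<A> X \<cdot> f = f"
  by (auto intro: cmp_idm idm_cmp simp: Hom_iff)

lemma assoc [simp]:
  "\<lbrakk>f \<in> Mor \<A>; g \<in> Mor \<A>; h \<in> Mor \<A>; tgt \<A> f = src \<A> g; tgt \<A> g = src \<A> h\<rbrakk>
    \<Longrightarrow> h \<cdot> g \<cdot> f = h \<cdot> (g \<cdot> f)"
  by (rule cmp_assoc) (auto simp: Hom_iff)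

text \<open>\<open>assoc\<close> rewrites every composite to right-nested form, where
  \<open>g \<cdot> f\<close> no longer occurs as a subterm of
  \<open>g \<cdot> (f \<cdot> r)\<close>. This makes an equation between composites usable after
  that normalization.\<close>

lemma cmp_eq:
  assumes "g \<cdot> f = h" "f \<in> Mor \<A>" "g \<in> Mor \<A>" "tgt \<A> f = src \<A> g" "r \<in> Mor \<A>" "tgt \<A> r = src \<A> f"
  shows "g \<cdot> (f \<cdot> r) = h \<cdot> r"
  using assms by auto

end

context preadditive_category
begin

text \<open>Each Hom-group is a separate monoid record; the inverse is taken in the one fixed by the
  source and target of the morphism itself, so the operation needs no object arguments.\<close>

definition neg :: "'b \<Rightarrow> 'b" where
  "neg f = m_inv \<lparr>carrier = Hom \<A> (src \<A> f) (tgt \<A> f), mult = add \<A>,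
    one = zer \<A> (src \<A> f) (tgt \<A> f)\<rparr> f"

lemma zer_simps [simp]:
  assumes "X \<in> Obj \<A>" "Y \<in> Obj \<A>"
  shows "zer \<A> X Y \<in> Mor \<A>" "src \<A> (zer \<A> X Y) = X" "tgt \<A> (zer \<A> X Y) = Y"
proof -
  interpret comm_group "\<lparr>carrier = Hom \<A> X Y, mult = add \<A>, one = zer \<A> X Y\<rparr>"
    by (rule Hom_comm_group[OF assms])
  show "zer \<A> X Y \<in> Mor \<A>" "src \<A> (zer \<A> X Y) = X" "tgt \<A> (zer \<A> X Y) = Y"
    using one_closed by (simp_all add: Hom_iff)
qed

lemma
  assumes "f \<in> Mor \<A>" "g \<in> Mor \<A>" "src \<A> f = src \<A> g" "tgt \<A> f = tgt \<A> g"
  shows add_simps [simp]: "f \<boxplus> g \<in> Mor \<A>" "src \<A> (f \<boxplus> g) = src \<A> g" "tgt \<A> (f \<boxplus> g) = tgt \<A> g"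
    and add_commute: "f \<boxplus> g = g \<boxplus> f"
proof -
  interpret comm_group "\<lparr>carrier = Hom \<A> (src \<A> g) (tgt \<A> g), mult = add \<A>, one = zer \<A> (src \<A> g) (tgt \<A> g)\<rparr>"
    using assms by (intro Hom_comm_group) auto
  show "f \<boxplus> g = g \<boxplus> f" using m_comm[of f g] assms by (simp add: Hom_iff)
  have "f \<boxplus> g \<in> Hom \<A> (src \<A> g) (tgt \<A> g)"
    using m_closed[of f g] assms by (simp add: Hom_iff)
  then show "f \<boxplus> g \<in> Mor \<A>" "src \<A> (f \<boxplus> g) = src \<A> g" "tgt \<A> (f \<boxplus> g) = tgt \<A> g"
    by (simp_all add: Hom_iff)
qed

lemma add_zer [simp]:
  assumes "f \<in> Mor \<A>" "src \<A> f = X" "tgt \<A> f = Y"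
  shows "f \<boxplus> zer \<A> X Y = f" "zer \<A> X Y \<boxplus> f = f"
proof -
  interpret comm_group "\<lparr>carrier = Hom \<A> X Y, mult = add \<A>, one = zer \<A> X Y\<rparr>"
    using assms by (intro Hom_comm_group) auto
  show "f \<boxplus> zer \<A> X Y = f" "zer \<A> X Y \<boxplus> f = f"
    using r_one[of f] l_one[of f] assms by (simp_all add: Hom_iff)
qed

lemma add_assoc:
  assumes "f \<in> Mor \<A>" "g \<in> Mor \<A>" "h \<in> Mor \<A>" "src \<A> f = src \<A> g" "tgt \<A> f = tgt \<A> g"
    "src \<A> h = src \<A> g" "tgt \<A> h = tgt \<A> g"
  shows "f \<boxplus> g \<boxplus> h = f \<boxplus> (g \<boxplus> h)"
proof -
  interpret comm_group "\<lparr>carrier = Hom \<A> (src \<A> g) (tgt \<A> g), mult = add \<A>, one = zer \<A> (src \<A> g) (tgt \<A> g)\<rparr>"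
    using assms by (intro Hom_comm_group) auto
  show ?thesis using m_assoc[of f g h] assms by (simp add: Hom_iff)
qed

lemma neg_simps [simp]:
  assumes "f \<in> Mor \<A>"
  shows "neg f \<in> Mor \<A>" "src \<A> (neg f) = src \<A> f" "tgt \<A> (neg f) = tgt \<A> f"
    "f \<boxplus> neg f = zer \<A> (src \<A> f) (tgt \<A> f)"  "neg f \<boxplus> f = zer \<A> (src \<A> f) (tgt \<A> f)"
proof -
  interpret comm_group "\<lparr>carrier = Hom \<A> (src \<A> f) (tgt \<A> f), mult = add \<A>, one = zer \<A> (src \<A> f) (tgt \<A> f)\<rparr>"
    using assms by (intro Hom_comm_group) auto
  show "neg f \<in> Mor \<A>" "src \<A> (neg f) = src \<A> f" "tgt \<A> (neg f) = tgt \<A> f"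
    "f \<boxplus> neg f = zer \<A> (src \<A> f) (tgt \<A> f)" "neg f \<boxplus> f = zer \<A> (src \<A> f) (tgt \<A> f)"
    using inv_closed[of f] r_inv[of f] l_inv[of f] assms by (simp_all add: Hom_iff neg_def)
qed

lemma add_cancel:
  assumes "f \<boxplus> g = f \<boxplus> h" "f \<in> Mor \<A>" "g \<in> Mor \<A>" "h \<in> Mor \<A>" "src \<A> f = src \<A> g" "tgt \<A> f = tgt \<A> g"
    "src \<A> f = src \<A> h" "tgt \<A> f = tgt \<A> h"
  shows "g = h"
proof -
  have "neg f \<boxplus> f \<boxplus> g = neg f \<boxplus> f \<boxplus> h"
    using assms by (simp add: add_assoc del: neg_simps(4,5))
  then show ?thesis using assms by simp
qed

lemma distrib_right [simp]:
  assumes "f \<in> Mor \<A>" "g \<in> Mor \<A>" "h \<in> Mor \<A>" "src \<A> g = src \<A> h" "tgt \<A> g = tgt \<A> h" "tgt \<A> f = src \<A> h"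
  shows "(g \<boxplus> h) \<cdot> f = g \<cdot> f \<boxplus> h \<cdot> f"
  using assms by (intro cmp_add[of _ "src \<A> f" "src \<A> g" _ "tgt \<A> g"]) (auto simp: Hom_iff)

lemma distrib_left [simp]:
  assumes "f \<in> Mor \<A>" "g \<in> Mor \<A>" "h \<in> Mor \<A>" "src \<A> f = src \<A> g" "tgt \<A> f = tgt \<A> g" "tgt \<A> g = src \<A> h"
  shows "h \<cdot> (f \<boxplus> g) = h \<cdot> f \<boxplus> h \<cdot> g"
  using assms by (intro add_cmp[of _ "src \<A> f" "src \<A> h" _ _ "tgt \<A> h"]) (auto simp: Hom_iff)

lemma cmp_zer [simp]:
  assumes "g \<in> Mor \<A>" "src \<A> g = Y" "X \<in> Obj \<A>"
  shows "g \<cdot> zer \<A> X Y = zer \<A> X (tgt \<A> g)"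
proof -
  have Y: "Y \<in> Obj \<A>" using assms by auto
  \<comment> \<open>For x = g0 this gives x + x = x + 0, and cancellation yields x = 0.\<close>
  have "g \<cdot> zer \<A> X Y \<boxplus> g \<cdot> zer \<A> X Y = g \<cdot> (zer \<A> X Y \<boxplus> zer \<A> X Y)"
    using assms Y distrib_left[of "zer \<A> X Y" "zer \<A> X Y" g] by (simp del: add_zer distrib_left)
  also have "\<dots> = g \<cdot> zer \<A> X Y \<boxplus> zer \<A> X (tgt \<A> g)" using assms Y by simp
  finally show ?thesis by (rule add_cancel) (use assms Y in simp_all)
qed

lemma zer_cmp [simp]:
  assumes "g \<in> Mor \<A>" "tgt \<A> g = X" "Y \<in> Obj \<A>"
  shows "zer \<A> X Y \<cdot> g = zer \<A> (src \<A> g) Y"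
proof -
  have X: "X \<in> Obj \<A>" using assms by auto
  have "zer \<A> X Y \<cdot> g \<boxplus> zer \<A> X Y \<cdot> g = (zer \<A> X Y \<boxplus> zer \<A> X Y) \<cdot> g"
    using assms X distrib_right[of g "zer \<A> X Y" "zer \<A> X Y"] by (simp del: add_zer distrib_right)
  also have "\<dots> = zer \<A> X Y \<cdot> g \<boxplus> zer \<A> (src \<A> g) Y" using assms X by simp
  finally show ?thesis by (rule add_cancel) (use assms X in simp_all)
qed

lemma neg_unique:
  assumes "f \<boxplus> g = zer \<A> (src \<A> f) (tgt \<A> f)" "f \<in> Mor \<A>" "g \<in> Mor \<A>" "src \<A> f = src \<A> g" "tgt \<A> f = tgt \<A> g"
  shows "g = neg f"
  using assms by (intro add_cancel[of f g "neg f"]) auto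

lemma neg_neg [simp]: "f \<in> Mor \<A> \<Longrightarrow> neg (neg f) = f"
  by (rule neg_unique[symmetric]) auto

lemma neg_zer [simp]: "X \<in> Obj \<A> \<Longrightarrow> Y \<in> Obj \<A> \<Longrightarrow> neg (zer \<A> X Y) = zer \<A> X Y"
  by (rule neg_unique[symmetric]) auto

lemma neg_cmp [simp]:
  assumes "f \<in> Mor \<A>" "g \<in> Mor \<A>" "tgt \<A> f = src \<A> g"
  shows "neg g \<cdot> f = neg (g \<cdot> f)"
proof (rule neg_unique)
  show "g \<cdot> f \<boxplus> neg g \<cdot> f = zer \<A> (src \<A> (g \<cdot> f)) (tgt \<A> (g \<cdot> f))"
    using assms distrib_right[of f g "neg g"] by (simp del: distrib_right)
qed (use assms in auto)

lemma cmp_neg [simp]: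
  assumes "f \<in> Mor \<A>" "g \<in> Mor \<A>" "tgt \<A> f = src \<A> g"
  shows "g \<cdot> neg f = neg (g \<cdot> f)"
proof (rule neg_unique)
  show "g \<cdot> f \<boxplus> g \<cdot> neg f = zer \<A> (src \<A> (g \<cdot> f)) (tgt \<A> (g \<cdot> f))"
    using assms distrib_left[of f "neg f" g] by (simp del: distrib_left)
qed (use assms in auto)

lemma diff_eq_zer_iff:
  assumes "f \<in> Mor \<A>" "g \<in> Mor \<A>" "src \<A> f = src \<A> g" "tgt \<A> f = tgt \<A> g"
  shows "f \<boxplus> neg g = zer \<A> (src \<A> g) (tgt \<A> g) \<longleftrightarrow> f = g"
proof
  assume "f \<boxplus> neg g = zer \<A> (src \<A> g) (tgt \<A> g)"
  then have "neg g = neg f" using assms by (intro neg_unique) auto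
  then show "f = g" using assms neg_neg by metis
qed (use assms in auto)

end

section \<open>Universal properties of kernels and cokernels\<close>

lemma kernelD:
  assumes "is_kernel \<A> k f"
  shows "k \<in> Mor \<A>" "f \<in> Mor \<A>" "tgt \<A> k = src \<A> f" "f \<cdot>\<^bsub>\<A>\<^esub> k = zer \<A> (src \<A> k) (tgt \<A> f)"
  using assms by (simp_all add: is_kernel_def)

lemma kernel_lift:
  assumes "is_kernel \<A> k f" "g \<in> Mor \<A>" "tgt \<A> g = src \<A> f" "f \<cdot>\<^bsub>\<A>\<^esub> g = zer \<A> (src \<A> g) (tgt \<A> f)"
  obtains u where "u \<in> Mor \<A>" "src \<A> u = src \<A> g" "tgt \<A> u = src \<A> k" "k \<cdot>\<^bsub>\<A>\<^esub> u = g"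
proof -
  have "g \<in> Hom \<A> (src \<A> g) (src \<A> f)" using assms by (simp add: Hom_iff)
  with assms have "\<exists>!u. u \<in> Hom \<A> (src \<A> g) (src \<A> k) \<and> k \<cdot>\<^bsub>\<A>\<^esub> u = g"
    unfolding is_kernel_def by simp
  then show ?thesis using that by (auto simp: Hom_iff)
qed

lemma cokernelD:
  assumes "is_cokernel \<A> q f"
  shows "q \<in> Mor \<A>" "f \<in> Mor \<A>" "src \<A> q = tgt \<A> f" "q \<cdot>\<^bsub>\<A>\<^esub> f = zer \<A> (src \<A> f) (tgt \<A> q)"
  using assms by (simp_all add: is_cokernel_def)

lemma cokernel_factor:
  assumes "is_cokernel \<A> q f" "g \<in> Mor \<A>" "src \<A> g = tgt \<A> f" "g \<cdot>\<^bsub>\<A>\<^esub> f = zer \<A> (src \<A> f) (tgt \<A> g)"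
  obtains u where "u \<in> Mor \<A>" "src \<A> u = tgt \<A> q" "tgt \<A> u = tgt \<A> g" "u \<cdot>\<^bsub>\<A>\<^esub> q = g"
proof -
  have "g \<in> Hom \<A> (tgt \<A> f) (tgt \<A> g)" using assms by (simp add: Hom_iff)
  with assms have "\<exists>!u. u \<in> Hom \<A> (tgt \<A> q) (tgt \<A> g) \<and> u \<cdot>\<^bsub>\<A>\<^esub> q = g"
    unfolding is_cokernel_def by simp
  then show ?thesis using that by (auto simp: Hom_iff)
qed

section \<open>Duality\<close>

definition opc :: "('o, 'm) cat_data \<Rightarrow> ('o, 'm) cat_data" where
  "opc \<A> = \<lparr>Obj = Obj \<A>, Mor = Mor \<A>, src = tgt \<A>, tgt = src \<A>, idm = idm \<A>,
     cmp = (\<lambda>g f. f \<cdot>\<^bsub>\<A>\<^esub> g), add = add \<A>, zer = (\<lambda>X Y. zer \<A> Y X)\<rparr>"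

lemma opc_simps [simp]:
  "Obj (opc \<A>) = Obj \<A>" "Mor (opc \<A>) = Mor \<A>" "src (opc \<A>) = tgt \<A>" "tgt (opc \<A>) = src \<A>"
  "idm (opc \<A>) = idm \<A>" "cmp (opc \<A>) g f = f \<cdot>\<^bsub>\<A>\<^esub> g" "add (opc \<A>) = add \<A>" "zer (opc \<A>) X Y = zer \<A> Y X"
  by (simp_all add: opc_def)

text \<open>An equality of records, not just an isomorphism, so a statement dualized twice returns
  to its literal original form.\<close>

lemma opc_opc [simp]: "opc (opc \<A>) = \<A>"
  by (cases \<A>) (simp add: opc_def)

lemma Hom_opc [simp]: "Hom (opc \<A>) X Y = Hom \<A> Y X"
  by (auto simp: Hom_def)

lemma is_kernel_opc [simp]: "is_kernel (opc \<A>) k f \<longleftrightarrow> is_cokernel \<A> k f"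
  by (auto simp: is_kernel_def is_cokernel_def)

lemma is_cokernel_opc [simp]: "is_cokernel (opc \<A>) k f \<longleftrightarrow> is_kernel \<A> k f"
  by (auto simp: is_kernel_def is_cokernel_def)

lemma is_mono_opc [simp]: "is_mono (opc \<A>) f \<longleftrightarrow> is_epi \<A> f"
  by (auto simp: is_mono_def is_epi_def)

lemma is_epi_opc [simp]: "is_epi (opc \<A>) f \<longleftrightarrow> is_mono \<A> f"
  by (auto simp: is_mono_def is_epi_def)

text \<open>The arguments of both predicates are ordered so that dualizing a square permutes
  nothing.\<close>

lemma is_pushout_opc [simp]: "is_pushout (opc \<A>) p h y p' \<longleftrightarrow> is_pullback \<A> p h y p'"
  unfolding is_pushout_def is_pullback_def by (simp only: opc_simps Hom_opc)

lemma is_pullback_opc [simp]: "is_pullback (opc \<A>) p h y p' \<longleftrightarrow> is_pushout \<A> p h y p'"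
  using is_pushout_opc[of "opc \<A>"] by (simp only: opc_opc)

lemma is_zero_object_opc [simp]: "is_zero_object (opc \<A>) Z \<longleftrightarrow> is_zero_object \<A> Z"
  unfolding is_zero_object_def opc_simps Hom_opc by (intro conj_cong ball_cong refl conj_commute)

lemma is_biproduct_opc [simp]:
  "is_biproduct (opc \<A>) X Y S (i1, i2, p1, p2) \<longleftrightarrow> is_biproduct \<A> X Y S (p1, p2, i1, i2)"
  unfolding is_biproduct_def opc_simps Hom_opc prod.case
  by (rule iffI; elim conjE; intro conjI; assumption)

lemma is_short_exact_opc [simp]: "is_short_exact (opc \<A>) i p \<longleftrightarrow> is_short_exact \<A> p i"
  by (auto simp: is_short_exact_def)

lemma short_exact_typing:
  assumes "is_short_exact \<A> i p"
  shows "i \<in> Mor \<A>" "p \<in> Mor \<A>" "tgt \<A> i = src \<A> p" "p \<cdot>\<^bsub>\<A>\<^esub> i = zer \<A> (src \<A> i) (tgt \<A> p)"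
  using assms by (simp_all add: is_short_exact_def is_kernel_def)

text \<open>The middle object is recorded as \<open>tgt \<A> i\<close>; its dual is
  \<open>src \<A> p\<close>, and the two agree for a short exact pair.\<close>

lemma conflation_opc [simp]: "conflation (opc \<A>) C i p \<longleftrightarrow> conflation \<A> C p i"
  unfolding conflation_def by (auto dest: short_exact_typing(3))

section \<open>Opposites of the categorical structures\<close>

lemma category_opc:
  assumes "category \<A>" shows "category (opc \<A>)"
proof -
  interpret category \<A> by fact
  show ?thesis
    by unfold_locales (simp_all add: Hom_iff)
qed

lemma preadditive_category_opc:
  assumes "preadditive_category \<A>" shows "preadditive_category (opc \<A>)"
proof -
  interpret preadditive_category \<A> by fact
  show ?thesis
  proof (intro preadditive_category.intro preadditive_category_axioms.intro)
    show "category (opc \<A>)"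
      by (rule category_opc) unfold_locales
    fix X Y assume "X \<in> Obj (opc \<A>)" "Y \<in> Obj (opc \<A>)"
    then show "comm_group \<lparr>carrier = Hom (opc \<A>) X Y, mult = add (opc \<A>), one = zer (opc \<A>) X Y\<rparr>"
      using Hom_comm_group[of Y X] by simp
  qed (simp_all add: Hom_iff)
qed

lemma abelian_category_opc:
  assumes "abelian_category \<A>" shows "abelian_category (opc \<A>)"
proof -
  interpret abelian_category \<A> by fact
  show ?thesis
  proof (intro abelian_category.intro abelian_category_axioms.intro)
    show "preadditive_category (opc \<A>)"
      by (rule preadditive_category_opc) unfold_locales
    fix X Y assume "X \<in> Obj (opc \<A>)" "Y \<in> Obj (opc \<A>)"
    then obtain S i1 i2 p1 p2 where "S \<in> Obj \<A>" "is_biproduct \<A> X Y S (i1, i2, p1, p2)"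
      using ex_biproduct[of X Y] by auto
    then show "\<exists>S\<in>Obj (opc \<A>). \<exists>b. is_biproduct (opc \<A>) X Y S b"
      by (intro bexI[of _ S] exI[of _ "(p1, p2, i1, i2)"]) auto
  qed (simp_all add: ex_zero_object ex_kernel ex_cokernel mono_normal epi_normal)
qed

lemma extension_closed_subcategory_opc:
  assumes "extension_closed_subcategory \<A> C" shows "extension_closed_subcategory (opc \<A>) C"
proof -
  interpret extension_closed_subcategory \<A> C by fact
  show ?thesis
  proof (intro extension_closed_subcategory.intro extension_closed_subcategory_axioms.intro)
    show "abelian_category (opc \<A>)"
      by (rule abelian_category_opc) unfold_locales
    fix X Y assume "X \<in> C" "Y \<in> C"
    then obtain S i1 i2 p1 p2 where "S \<in> C" "is_biproduct \<A> X Y S (i1, i2, p1, p2)"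
      using C_biproduct[of X Y] by auto
    then show "\<exists>S\<in>C. \<exists>b. is_biproduct (opc \<A>) X Y S b"
      by (intro bexI[of _ S] exI[of _ "(p1, p2, i1, i2)"]) auto
  next
    fix i p assume "is_short_exact (opc \<A>) i p" "src (opc \<A>) i \<in> C" "tgt (opc \<A>) p \<in> C"
    then show "tgt (opc \<A>) i \<in> C"
      using C_extension[of p i] short_exact_typing(3)[of \<A> p i] by simp
  qed (simp_all add: C_Obj C_zero)
qed

section \<open>Exactness in abelian categories\<close>

lemma biproductD:
  assumes "is_biproduct \<A> X Y S (i1, i2, p1, p2)"
  shows "i1 \<in> Mor \<A>" "src \<A> i1 = X" "tgt \<A> i1 = S" "i2 \<in> Mor \<A>" "src \<A> i2 = Y" "tgt \<A> i2 = S"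
    "p1 \<in> Mor \<A>" "src \<A> p1 = S" "tgt \<A> p1 = X" "p2 \<in> Mor \<A>" "src \<A> p2 = S" "tgt \<A> p2 = Y"
    "p1 \<cdot>\<^bsub>\<A>\<^esub> i1 = idm \<A> X" "p2 \<cdot>\<^bsub>\<A>\<^esub> i2 = idm \<A> Y" "p1 \<cdot>\<^bsub>\<A>\<^esub> i2 = zer \<A> Y X" "p2 \<cdot>\<^bsub>\<A>\<^esub> i1 = zer \<A> X Y"
    "i1 \<cdot>\<^bsub>\<A>\<^esub> p1 \<boxplus>\<^bsub>\<A>\<^esub> i2 \<cdot>\<^bsub>\<A>\<^esub> p2 = idm \<A> S"
  using assms by (simp_all add: is_biproduct_def Hom_iff)

lemma pullbackD:
  assumes "is_pullback \<A> p h y p'"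
  shows "p \<in> Mor \<A>" "h \<in> Mor \<A>" "tgt \<A> p = tgt \<A> h" "y \<in> Mor \<A>" "tgt \<A> y = src \<A> p"
    "p' \<in> Mor \<A>" "src \<A> p' = src \<A> y" "tgt \<A> p' = src \<A> h" "p \<cdot>\<^bsub>\<A>\<^esub> y = h \<cdot>\<^bsub>\<A>\<^esub> p'"
  using assms by (simp_all add: is_pullback_def Hom_iff)

lemma pullback_lift:
  assumes "is_pullback \<A> p h y p'" "u \<in> Mor \<A>" "v \<in> Mor \<A>" "src \<A> u = src \<A> v"
    "tgt \<A> u = src \<A> p" "tgt \<A> v = src \<A> h" "p \<cdot>\<^bsub>\<A>\<^esub> u = h \<cdot>\<^bsub>\<A>\<^esub> v"
  obtains w where "w \<in> Mor \<A>" "src \<A> w = src \<A> u" "tgt \<A> w = src \<A> y" "y \<cdot>\<^bsub>\<A>\<^esub> w = u" "p' \<cdot>\<^bsub>\<A>\<^esub> w = v"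
proof -
  have "u \<in> Hom \<A> (src \<A> u) (src \<A> p)" "v \<in> Hom \<A> (src \<A> u) (src \<A> h)"
    using assms by (simp_all add: Hom_iff)
  with assms have "\<exists>!w. w \<in> Hom \<A> (src \<A> u) (src \<A> y) \<and> y \<cdot>\<^bsub>\<A>\<^esub> w = u \<and> p' \<cdot>\<^bsub>\<A>\<^esub> w = v"
    unfolding is_pullback_def by simp
  then show ?thesis using that by (auto simp: Hom_iff)
qed

lemma pushoutD:
  assumes "is_pushout \<A> i g x i'"
  shows "i \<in> Mor \<A>" "g \<in> Mor \<A>" "src \<A> i = src \<A> g" "x \<in> Mor \<A>" "src \<A> x = tgt \<A> i"
    "i' \<in> Mor \<A>" "tgt \<A> i' = tgt \<A> x" "src \<A> i' = tgt \<A> g" "x \<cdot>\<^bsub>\<A>\<^esub> i = i' \<cdot>\<^bsub>\<A>\<^esub> g"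
  using assms by (simp_all add: is_pushout_def Hom_iff)

lemma pushout_factor:
  assumes "is_pushout \<A> i g x i'" "u \<in> Mor \<A>" "v \<in> Mor \<A>" "tgt \<A> u = tgt \<A> v"
    "src \<A> u = tgt \<A> i" "src \<A> v = tgt \<A> g" "u \<cdot>\<^bsub>\<A>\<^esub> i = v \<cdot>\<^bsub>\<A>\<^esub> g"
  obtains w where "w \<in> Mor \<A>" "src \<A> w = tgt \<A> x" "tgt \<A> w = tgt \<A> u" "w \<cdot>\<^bsub>\<A>\<^esub> x = u" "w \<cdot>\<^bsub>\<A>\<^esub> i' = v"
  using pullback_lift[of "opc \<A>" i g x i' u v] assms by auto

section \<open>Kernels, monomorphisms, biproducts and their duals in a preadditive category\<close>

context preadditive_category
begin

lemma preadditive_opc: "preadditive_category (opc \<A>)"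
  by (rule preadditive_category_opc) unfold_locales

lemma kernel_cancel:
  assumes "is_kernel \<A> k f" "u \<in> Mor \<A>" "v \<in> Mor \<A>" "src \<A> u = src \<A> v" "tgt \<A> u = src \<A> k" "tgt \<A> v = src \<A> k"
    "k \<cdot> u = k \<cdot> v"
  shows "u = v"
proof -
  note k = kernelD[OF assms(1)]
  have "k \<cdot> v \<in> Hom \<A> (src \<A> v) (src \<A> f)" using assms k by (simp add: Hom_iff)
  moreover have "f \<cdot> (k \<cdot> v) = zer \<A> (src \<A> v) (tgt \<A> f)"
    using assms(2-) k cmp_eq[OF k(4), of v] by simp
  ultimately have "\<exists>!u. u \<in> Hom \<A> (src \<A> v) (src \<A> k) \<and> k \<cdot> u = k \<cdot> v"
    using assms(1) unfolding is_kernel_def by simp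
  then show ?thesis using assms(2-) by (auto simp: Hom_iff)
qed

text \<open>Two lifts differ by a map killed by \<open>k\<close>, so uniqueness of lifts reduces to
  the vanishing of such maps.\<close>

lemma kernelI:
  assumes "k \<in> Mor \<A>" "f \<in> Mor \<A>" "tgt \<A> k = src \<A> f" "f \<cdot> k = zer \<A> (src \<A> k) (tgt \<A> f)"
    and ex: "\<And>g. g \<in> Mor \<A> \<Longrightarrow> tgt \<A> g = src \<A> f \<Longrightarrow> f \<cdot> g = zer \<A> (src \<A> g) (tgt \<A> f)
      \<Longrightarrow> \<exists>u. u \<in> Mor \<A> \<and> src \<A> u = src \<A> g \<and> tgt \<A> u = src \<A> k \<and> k \<cdot> u = g"
    and inj: "\<And>u. u \<in> Mor \<A> \<Longrightarrow> tgt \<A> u = src \<A> k \<Longrightarrow> k \<cdot> u = zer \<A> (src \<A> u) (tgt \<A> k)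
      \<Longrightarrow> u = zer \<A> (src \<A> u) (src \<A> k)"
  shows "is_kernel \<A> k f"
  unfolding is_kernel_def
proof (intro conjI allI ballI impI)
  fix W g assume "g \<in> Hom \<A> W (src \<A> f)" "f \<cdot> g = zer \<A> W (tgt \<A> f)"
  then have g: "g \<in> Mor \<A>" "src \<A> g = W" "tgt \<A> g = src \<A> f" "f \<cdot> g = zer \<A> (src \<A> g) (tgt \<A> f)"
    by (auto simp: Hom_iff)
  from ex[OF g(1,3,4)] obtain u where u: "u \<in> Mor \<A>" "src \<A> u = W" "tgt \<A> u = src \<A> k" "k \<cdot> u = g"
    using g by auto
  show "\<exists>!u. u \<in> Hom \<A> W (src \<A> k) \<and> k \<cdot> u = g"
  proof (rule ex1I[of _ u])
    fix v assume "v \<in> Hom \<A> W (src \<A> k) \<and> k \<cdot> v = g"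
    then have v: "v \<in> Mor \<A>" "src \<A> v = W" "tgt \<A> v = src \<A> k" "k \<cdot> v = g" by (auto simp: Hom_iff)
    have "v \<boxplus> neg u = zer \<A> W (src \<A> k)"
      using inj[of "v \<boxplus> neg u"] u v g assms(1,3) by simp
    then show "v = u" using u v diff_eq_zer_iff[of v u] by simp
  qed (use u in \<open>simp add: Hom_iff\<close>)
qed (use assms in auto)

lemma cokernelI:
  assumes "q \<in> Mor \<A>" "f \<in> Mor \<A>" "src \<A> q = tgt \<A> f" "q \<cdot> f = zer \<A> (src \<A> f) (tgt \<A> q)"
    and "\<And>g. g \<in> Mor \<A> \<Longrightarrow> src \<A> g = tgt \<A> f \<Longrightarrow> g \<cdot> f = zer \<A> (src \<A> f) (tgt \<A> g)
      \<Longrightarrow> \<exists>u. u \<in> Mor \<A> \<and> tgt \<A> u = tgt \<A> g \<and> src \<A> u = tgt \<A> q \<and> u \<cdot> q = g"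
    and "\<And>u. u \<in> Mor \<A> \<Longrightarrow> src \<A> u = tgt \<A> q \<Longrightarrow> u \<cdot> q = zer \<A> (src \<A> q) (tgt \<A> u)
      \<Longrightarrow> u = zer \<A> (tgt \<A> q) (tgt \<A> u)"
  shows "is_cokernel \<A> q f"
  using preadditive_category.kernelI[OF preadditive_opc, of q f] assms by simp

lemma monoI:
  assumes "k \<in> Mor \<A>"
    and inj: "\<And>u. u \<in> Mor \<A> \<Longrightarrow> tgt \<A> u = src \<A> k \<Longrightarrow> k \<cdot> u = zer \<A> (src \<A> u) (tgt \<A> k)
      \<Longrightarrow> u = zer \<A> (src \<A> u) (src \<A> k)"
  shows "is_mono \<A> k"
  unfolding is_mono_def
proof (intro conjI allI ballI impI)
  fix W g h assume "g \<in> Hom \<A> W (src \<A> k)" "h \<in> Hom \<A> W (src \<A> k)" and eq: "k \<cdot> g = k \<cdot> h"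
  then have gh: "g \<in> Mor \<A>" "src \<A> g = W" "tgt \<A> g = src \<A> k" "h \<in> Mor \<A>" "src \<A> h = W" "tgt \<A> h = src \<A> k"
    by (auto simp: Hom_iff)
  then have "g \<boxplus> neg h = zer \<A> W (src \<A> k)"
    using inj[of "g \<boxplus> neg h"] assms(1) eq by simp
  then show "g = h" using gh diff_eq_zer_iff[of g h] by simp
qed fact

lemma epiI:
  assumes "q \<in> Mor \<A>"
    and "\<And>u. u \<in> Mor \<A> \<Longrightarrow> src \<A> u = tgt \<A> q \<Longrightarrow> u \<cdot> q = zer \<A> (src \<A> q) (tgt \<A> u)
      \<Longrightarrow> u = zer \<A> (tgt \<A> q) (tgt \<A> u)"
  shows "is_epi \<A> q"
  using preadditive_category.monoI[OF preadditive_opc, of q] assms by simp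

lemma mono_cancel:
  assumes "is_mono \<A> k" "u \<in> Mor \<A>" "v \<in> Mor \<A>" "src \<A> u = src \<A> v" "tgt \<A> u = src \<A> k" "tgt \<A> v = src \<A> k"
    "k \<cdot> u = k \<cdot> v"
  shows "u = v"
proof -
  have "u \<in> Hom \<A> (src \<A> v) (src \<A> k)" "v \<in> Hom \<A> (src \<A> v) (src \<A> k)"
    using assms by (simp_all add: Hom_iff)
  with assms(1,7) show ?thesis unfolding is_mono_def by blast
qed

lemma mono_zer:
  assumes "is_mono \<A> k" "u \<in> Mor \<A>" "tgt \<A> u = src \<A> k" "k \<cdot> u = zer \<A> (src \<A> u) (tgt \<A> k)"
  shows "u = zer \<A> (src \<A> u) (src \<A> k)"
proof (rule mono_cancel[OF assms(1)])
  have "k \<in> Mor \<A>" using assms(1) by (simp add: is_mono_def)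
  then show "k \<cdot> u = k \<cdot> zer \<A> (src \<A> u) (src \<A> k)" "zer \<A> (src \<A> u) (src \<A> k) \<in> Mor \<A>"
    "src \<A> u = src \<A> (zer \<A> (src \<A> u) (src \<A> k))" "tgt \<A> (zer \<A> (src \<A> u) (src \<A> k)) = src \<A> k"
    using assms by simp_all
qed (use assms in simp_all)

lemma epi_cancel:
  assumes "is_epi \<A> q" "u \<in> Mor \<A>" "v \<in> Mor \<A>" "tgt \<A> u = tgt \<A> v" "src \<A> u = tgt \<A> q" "src \<A> v = tgt \<A> q"
    "u \<cdot> q = v \<cdot> q"
  shows "u = v"
  using preadditive_category.mono_cancel[OF preadditive_opc, of q u v] assms by simp

lemma epi_zer:
  assumes "is_epi \<A> q" "u \<in> Mor \<A>" "src \<A> u = tgt \<A> q" "u \<cdot> q = zer \<A> (src \<A> q) (tgt \<A> u)"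
  shows "u = zer \<A> (tgt \<A> q) (tgt \<A> u)"
  using preadditive_category.mono_zer[OF preadditive_opc, of q u] assms by simp

lemma kernel_mono: "is_kernel \<A> k f \<Longrightarrow> is_mono \<A> k"
  unfolding is_mono_def by (auto simp: Hom_iff dest: kernelD(1) elim!: kernel_cancel)

lemma cokernel_epi: "is_cokernel \<A> q f \<Longrightarrow> is_epi \<A> q"
  using preadditive_category.kernel_mono[OF preadditive_opc, of q f] by simp

lemma biproduct_simps:
  assumes "is_biproduct \<A> X Y S (i1, i2, p1, p2)"
  shows "\<And>r. r \<in> Mor \<A> \<Longrightarrow> tgt \<A> r = X \<Longrightarrow> p1 \<cdot> (i1 \<cdot> r) = r"
    "\<And>r. r \<in> Mor \<A> \<Longrightarrow> tgt \<A> r = Y \<Longrightarrow> p2 \<cdot> (i2 \<cdot> r) = r"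
    "\<And>r. r \<in> Mor \<A> \<Longrightarrow> tgt \<A> r = Y \<Longrightarrow> p1 \<cdot> (i2 \<cdot> r) = zer \<A> (src \<A> r) X"
    "\<And>r. r \<in> Mor \<A> \<Longrightarrow> tgt \<A> r = X \<Longrightarrow> p2 \<cdot> (i1 \<cdot> r) = zer \<A> (src \<A> r) Y"
    "\<And>r. r \<in> Mor \<A> \<Longrightarrow> tgt \<A> r = S \<Longrightarrow> i1 \<cdot> (p1 \<cdot> r) \<boxplus> i2 \<cdot> (p2 \<cdot> r) = r"
proof -
  note b = biproductD[OF assms]
  have o: "X \<in> Obj \<A>" "Y \<in> Obj \<A>" using b src_in_Obj by blast+
  show "\<And>r. r \<in> Mor \<A> \<Longrightarrow> tgt \<A> r = X \<Longrightarrow> p1 \<cdot> (i1 \<cdot> r) = r"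
    "\<And>r. r \<in> Mor \<A> \<Longrightarrow> tgt \<A> r = Y \<Longrightarrow> p2 \<cdot> (i2 \<cdot> r) = r"
    "\<And>r. r \<in> Mor \<A> \<Longrightarrow> tgt \<A> r = Y \<Longrightarrow> p1 \<cdot> (i2 \<cdot> r) = zer \<A> (src \<A> r) X"
    "\<And>r. r \<in> Mor \<A> \<Longrightarrow> tgt \<A> r = X \<Longrightarrow> p2 \<cdot> (i1 \<cdot> r) = zer \<A> (src \<A> r) Y"
    using b o by (simp_all add: cmp_eq[OF b(13)] cmp_eq[OF b(14)] cmp_eq[OF b(15)] cmp_eq[OF b(16)])
  fix r assume r: "r \<in> Mor \<A>" "tgt \<A> r = S"
  have "i1 \<cdot> (p1 \<cdot> r) \<boxplus> i2 \<cdot> (p2 \<cdot> r) = (i1 \<cdot> p1 \<boxplus> i2 \<cdot> p2) \<cdot> r"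
    using b(1-12) r by simp
  also have "\<dots> = r" using b(17) r by simp
  finally show "i1 \<cdot> (p1 \<cdot> r) \<boxplus> i2 \<cdot> (p2 \<cdot> r) = r" .
qed

lemma biproduct_ext:
  assumes "is_biproduct \<A> X Y S (i1, i2, p1, p2)" "u \<in> Mor \<A>" "v \<in> Mor \<A>" "src \<A> u = src \<A> v"
    "tgt \<A> u = S" "tgt \<A> v = S" "p1 \<cdot> u = p1 \<cdot> v" "p2 \<cdot> u = p2 \<cdot> v"
  shows "u = v"
proof -
  have "u = i1 \<cdot> (p1 \<cdot> u) \<boxplus> i2 \<cdot> (p2 \<cdot> u)"
    using biproduct_simps(5)[OF assms(1,2,5)] ..
  also have "\<dots> = v"
    unfolding assms(7,8) by (rule biproduct_simps(5)[OF assms(1,3,6)])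
  finally show ?thesis .
qed

lemma biproduct_ext':
  assumes "is_biproduct \<A> X Y S (i1, i2, p1, p2)" "u \<in> Mor \<A>" "v \<in> Mor \<A>" "tgt \<A> u = tgt \<A> v"
    "src \<A> u = S" "src \<A> v = S" "u \<cdot> i1 = v \<cdot> i1" "u \<cdot> i2 = v \<cdot> i2"
  shows "u = v"
  using preadditive_category.biproduct_ext[OF preadditive_opc, of X Y S p1 p2 i1 i2 u v] assms by simp

text \<open>A pair of maps with \<open>q \<cdot> u = c \<cdot> v\<close> amounts to one map into the
  biproduct that is killed by the difference of \<open>q \<cdot> p1\<close> and
  \<open>c \<cdot> p2\<close>.\<close>

lemma pullback_of_kernel:
  assumes bp: "is_biproduct \<A> X Y S (i1, i2, p1, p2)" and "q \<in> Mor \<A>" "c \<in> Mor \<A>" "src \<A> q = X" "src \<A> c = Y"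
    "tgt \<A> q = tgt \<A> c" and k: "is_kernel \<A> k (q \<cdot> p1 \<boxplus> neg (c \<cdot> p2))"
  shows "is_pullback \<A> q c (p1 \<cdot> k) (p2 \<cdot> k)"
proof -
  note b = biproductD(1-12)[OF bp]
  note k1 = kernelD[OF k]
  have t: "src \<A> (q \<cdot> p1 \<boxplus> neg (c \<cdot> p2)) = S" "tgt \<A> (q \<cdot> p1 \<boxplus> neg (c \<cdot> p2)) = tgt \<A> c"
    "tgt \<A> k = S" using assms b k1 by simp_all
  have eq: "q \<cdot> (p1 \<cdot> k) = c \<cdot> (p2 \<cdot> k)"
    using k1 assms(2-6) b t diff_eq_zer_iff[of "q \<cdot> (p1 \<cdot> k)" "c \<cdot> (p2 \<cdot> k)"] by simp
  show ?thesis unfolding is_pullback_def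
  proof (intro conjI allI ballI impI)
    fix W u v assume "u \<in> Hom \<A> W (src \<A> q)" "v \<in> Hom \<A> W (src \<A> c)" and quv: "q \<cdot> u = c \<cdot> v"
    then have uv: "u \<in> Mor \<A>" "src \<A> u = W" "tgt \<A> u = X" "v \<in> Mor \<A>" "src \<A> v = W" "tgt \<A> v = Y"
      using assms by (simp_all add: Hom_iff)
    have "(q \<cdot> p1 \<boxplus> neg (c \<cdot> p2)) \<cdot> (i1 \<cdot> u \<boxplus> i2 \<cdot> v) = zer \<A> W (tgt \<A> c)"
      using assms(2-6) b uv quv src_in_Obj[OF uv(1)] by (simp add: biproduct_simps[OF bp])
    then obtain w where w: "w \<in> Mor \<A>" "src \<A> w = W" "tgt \<A> w = src \<A> k" "k \<cdot> w = i1 \<cdot> u \<boxplus> i2 \<cdot> v"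
      using kernel_lift[OF k, of "i1 \<cdot> u \<boxplus> i2 \<cdot> v"] uv b t by (auto simp del: distrib_left distrib_right)
    show "\<exists>!w. w \<in> Hom \<A> W (src \<A> (p1 \<cdot> k)) \<and> (p1 \<cdot> k) \<cdot> w = u \<and> (p2 \<cdot> k) \<cdot> w = v"
    proof (rule ex1I[of _ w])
      show "w \<in> Hom \<A> W (src \<A> (p1 \<cdot> k)) \<and> (p1 \<cdot> k) \<cdot> w = u \<and> (p2 \<cdot> k) \<cdot> w = v"
        using w b uv k1(1) t src_in_Obj[OF uv(1)] src_in_Obj[OF uv(4)] tgt_in_Obj[OF uv(1)] tgt_in_Obj[OF uv(4)]
        by (simp add: Hom_iff biproduct_simps[OF bp])
      fix w' assume "w' \<in> Hom \<A> W (src \<A> (p1 \<cdot> k)) \<and> (p1 \<cdot> k) \<cdot> w' = u \<and> (p2 \<cdot> k) \<cdot> w' = v"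
      then have w': "w' \<in> Mor \<A>" "src \<A> w' = W" "tgt \<A> w' = src \<A> k" "p1 \<cdot> (k \<cdot> w') = u" "p2 \<cdot> (k \<cdot> w') = v"
        using b k1(1) t by (auto simp add: Hom_iff)
      have "k \<cdot> w' = k \<cdot> w"
        using biproduct_simps(5)[OF bp, of "k \<cdot> w'"] w w' k1(1) t b by simp
      then show "w' = w" using kernel_cancel[OF k] w w' by simp
    qed
  qed (use assms b k1 eq t in \<open>simp_all add: Hom_iff\<close>)
qed

end

section \<open>Normality, pull-backs, push-outs and short exact sequences in an abelian
  category\<close>

context abelian_category
begin

lemma abelian_opc: "abelian_category (opc \<A>)"
  by (rule abelian_category_opc) unfold_locales

text \<open>If \<open>k\<close> is a kernel of \<open>f\<close>, then \<open>f\<close> factors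
  through the cokernel \<open>q\<close>, so anything killed by \<open>q\<close> is killed by
  \<open>f\<close> and lifts along \<open>k\<close>.\<close>

lemma mono_is_kernel:
  assumes "is_mono \<A> k" "is_cokernel \<A> q k"
  shows "is_kernel \<A> k q"
proof -
  from mono_normal[OF assms(1)] obtain f where kf: "is_kernel \<A> k f" by blast
  note k = kernelD[OF kf] note q = cokernelD[OF assms(2)]
  obtain v where v: "v \<in> Mor \<A>" "src \<A> v = tgt \<A> q" "tgt \<A> v = tgt \<A> f" "v \<cdot> q = f"
    using cokernel_factor[OF assms(2), of f] k by auto
  show ?thesis
  proof (rule kernelI)
    fix g assume g: "g \<in> Mor \<A>" "tgt \<A> g = src \<A> q" "q \<cdot> g = zer \<A> (src \<A> g) (tgt \<A> q)"
    have "f \<cdot> g = v \<cdot> (q \<cdot> g)" using v(4) g v(1,2) q(1) by auto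
    also have "\<dots> = zer \<A> (src \<A> g) (tgt \<A> f)" using g v by simp
    finally have "f \<cdot> g = zer \<A> (src \<A> g) (tgt \<A> f)" .
    from kernel_lift[OF kf g(1) _ this] obtain u where "u \<in> Mor \<A>" "src \<A> u = src \<A> g" "tgt \<A> u = src \<A> k" "k \<cdot> u = g"
      using g k q by auto
    then show "\<exists>u. u \<in> Mor \<A> \<and> src \<A> u = src \<A> g \<and> tgt \<A> u = src \<A> k \<and> k \<cdot> u = g" by blast
  next
    fix u assume "u \<in> Mor \<A>" "tgt \<A> u = src \<A> k" "k \<cdot> u = zer \<A> (src \<A> u) (tgt \<A> k)"
    then show "u = zer \<A> (src \<A> u) (src \<A> k)" by (rule mono_zer[OF assms(1)])
  qed (use k q in simp_all)
qed

lemma epi_is_cokernel: "is_epi \<A> q \<Longrightarrow> is_kernel \<A> k q \<Longrightarrow> is_cokernel \<A> q k"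
  using abelian_category.mono_is_kernel[OF abelian_opc, of q k] by simp

lemma short_exact_of_mono: "is_mono \<A> i \<Longrightarrow> is_cokernel \<A> p i \<Longrightarrow> is_short_exact \<A> i p"
  unfolding is_short_exact_def by (simp add: mono_is_kernel)

lemma short_exact_of_epi: "is_epi \<A> p \<Longrightarrow> is_kernel \<A> i p \<Longrightarrow> is_short_exact \<A> i p"
  unfolding is_short_exact_def by (simp add: epi_is_cokernel)

lemma short_exact_mono: "is_short_exact \<A> i p \<Longrightarrow> is_mono \<A> i"
  and short_exact_epi: "is_short_exact \<A> i p \<Longrightarrow> is_epi \<A> p"
  by (auto simp: is_short_exact_def intro: kernel_mono cokernel_epi)

text \<open>The difference map \<open>f\<close> on the biproduct is epi because it restricts to
  \<open>q\<close> on the first summand, so it is the cokernel of its kernel \<open>k\<close>. If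
  \<open>u\<close> kills \<open>p2 \<cdot> k\<close>, then \<open>u \<cdot> p2\<close> factors
  through \<open>f\<close>, and restriction to the first summand, where \<open>p2\<close> is zero,
  forces the factor to vanish.\<close>

lemma ex_pullback_epi:
  assumes "is_epi \<A> q" "c \<in> Mor \<A>" "tgt \<A> q = tgt \<A> c"
  shows "\<exists>x p. is_pullback \<A> q c x p \<and> is_epi \<A> p"
proof -
  have q: "q \<in> Mor \<A>" using assms(1) by (simp add: is_epi_def)
  obtain S i1 i2 p1 p2 where bp: "is_biproduct \<A> (src \<A> q) (src \<A> c) S (i1, i2, p1, p2)"
    using ex_biproduct[of "src \<A> q" "src \<A> c"] q assms by auto
  note b = biproductD[OF bp]
  define f where "f = q \<cdot> p1 \<boxplus> neg (c \<cdot> p2)"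
  have f: "f \<in> Mor \<A>" "src \<A> f = S" "tgt \<A> f = tgt \<A> c"
    using q assms b(1-12) by (simp_all add: f_def)
  have fi: "f \<cdot> i1 = q" using q assms b by (simp add: f_def)
  have "is_epi \<A> f"
  proof (rule epiI[OF f(1)])
    fix u assume u: "u \<in> Mor \<A>" "src \<A> u = tgt \<A> f" "u \<cdot> f = zer \<A> (src \<A> f) (tgt \<A> u)"
    have "u \<cdot> q = u \<cdot> f \<cdot> i1" using fi u(1,2) f b(1-12) by simp
    also have "\<dots> = zer \<A> (src \<A> q) (tgt \<A> u)" using u f b by simp
    finally show "u = zer \<A> (tgt \<A> f) (tgt \<A> u)" using epi_zer[OF assms(1), of u] u f assms(3) by simp
  qed
  obtain k where k: "is_kernel \<A> k f" using ex_kernel f by blast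
  have ck: "is_cokernel \<A> f k" by (rule epi_is_cokernel) fact+
  note kD = kernelD[OF k]
  have pb: "is_pullback \<A> q c (p1 \<cdot> k) (p2 \<cdot> k)"
    by (rule pullback_of_kernel[OF bp]) (use q assms k f_def in auto)
  moreover have "is_epi \<A> (p2 \<cdot> k)"
  proof (rule epiI)
    fix u assume "u \<in> Mor \<A>" "src \<A> u = tgt \<A> (p2 \<cdot> k)" "u \<cdot> (p2 \<cdot> k) = zer \<A> (src \<A> (p2 \<cdot> k)) (tgt \<A> u)"
    then have u: "u \<in> Mor \<A>" "src \<A> u = src \<A> c" "u \<cdot> p2 \<cdot> k = zer \<A> (src \<A> k) (tgt \<A> u)"
      using b kD f by auto
    obtain v where v: "v \<in> Mor \<A>" "src \<A> v = tgt \<A> f" "tgt \<A> v = tgt \<A> u" "v \<cdot> f = u \<cdot> p2"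
      using cokernel_factor[OF ck, of "u \<cdot> p2"] u b kD f by auto
    have "v \<cdot> q = v \<cdot> f \<cdot> i1" using fi v(1,2) f b(1-12) by simp
    also have "\<dots> = u \<cdot> (p2 \<cdot> i1)" unfolding v(4) using u b(1-12) by simp
    also have "\<dots> = zer \<A> (src \<A> q) (tgt \<A> u)" using u b q by simp
    finally have "v = zer \<A> (tgt \<A> q) (tgt \<A> u)" using epi_zer[OF assms(1), of v] v f assms(3) by simp
    then have up: "u \<cdot> p2 = zer \<A> S (tgt \<A> u)" using v(4) f u assms(3) by auto
    have "u = u \<cdot> p2 \<cdot> i2" using u b by simp
    also have "\<dots> = zer \<A> (src \<A> c) (tgt \<A> u)" unfolding up using u b by simp
    finally show "u = zer \<A> (tgt \<A> (p2 \<cdot> k)) (tgt \<A> u)" using b kD f by simp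
  qed (use b kD f in simp)
  ultimately show ?thesis by blast
qed

text \<open>The pull-back already known to have an epi leg \<open>p0\<close> maps to the given one,
  so \<open>p0\<close> factors through \<open>p\<close>.\<close>

lemma pullback_epi:
  assumes "is_pullback \<A> q c x p" "is_epi \<A> q" shows "is_epi \<A> p"
proof (rule epiI)
  note P = pullbackD[OF assms(1)]
  show "p \<in> Mor \<A>" by (rule P)
  obtain x0 p0 where pb: "is_pullback \<A> q c x0 p0" and e: "is_epi \<A> p0"
    using ex_pullback_epi[OF assms(2) P(2,3)] by blast
  note P0 = pullbackD[OF pb]
  obtain w where w: "w \<in> Mor \<A>" "src \<A> w = src \<A> x0" "tgt \<A> w = src \<A> x" "p \<cdot> w = p0"
    using pullback_lift[OF assms(1), of x0 p0] P0 by auto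
  fix u assume u: "u \<in> Mor \<A>" "src \<A> u = tgt \<A> p" "u \<cdot> p = zer \<A> (src \<A> p) (tgt \<A> u)"
  have "u \<cdot> p0 = u \<cdot> p \<cdot> w" using w u(1,2) P by simp
  also have "\<dots> = zer \<A> (src \<A> p0) (tgt \<A> u)" unfolding u(3) using w u P P0 by simp
  finally show "u = zer \<A> (tgt \<A> p) (tgt \<A> u)" using epi_zer[OF e, of u] u P P0 by simp
qed

lemma ex_pushout_mono:
  assumes "is_mono \<A> i" "g \<in> Mor \<A>" "src \<A> i = src \<A> g"
  shows "\<exists>x i'. is_pushout \<A> i g x i' \<and> is_mono \<A> i'"
  using abelian_category.ex_pullback_epi[OF abelian_opc, of i g] assms by simp

lemma pushout_mono: "is_pushout \<A> i g x i' \<Longrightarrow> is_mono \<A> i \<Longrightarrow> is_mono \<A> i'"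
  using abelian_category.pullback_epi[OF abelian_opc, of i g x i'] by simp

lemma pushout_ext:
  assumes "is_pushout \<A> i g x i'" "u \<in> Mor \<A>" "v \<in> Mor \<A>" "tgt \<A> u = tgt \<A> v" "src \<A> u = tgt \<A> x" "src \<A> v = tgt \<A> x"
    "u \<cdot> x = v \<cdot> x" "u \<cdot> i' = v \<cdot> i'"
  shows "u = v"
proof -
  note P = pushoutD[OF assms(1)]
  have "v \<cdot> x \<in> Hom \<A> (tgt \<A> i) (tgt \<A> v)" "v \<cdot> i' \<in> Hom \<A> (tgt \<A> g) (tgt \<A> v)" "v \<cdot> x \<cdot> i = v \<cdot> i' \<cdot> g"
    using P assms by (simp_all add: Hom_iff)
  then have "\<exists>!w. w \<in> Hom \<A> (tgt \<A> x) (tgt \<A> v) \<and> w \<cdot> x = v \<cdot> x \<and> w \<cdot> i' = v \<cdot> i'"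
    using assms(1) unfolding is_pushout_def by blast
  then show ?thesis using assms by (auto simp: Hom_iff)
qed

text \<open>A map killing \<open>i'\<close> kills \<open>i\<close> after restriction along
  \<open>x\<close>, so on that leg it factors through \<open>p\<close>; comparing on both legs of
  the push-out turns this into a factorization through \<open>p'\<close>.\<close>

lemma pushout_short_exact:
  assumes se: "is_short_exact \<A> i p" and po: "is_pushout \<A> i g x i'"
    and p': "p' \<in> Mor \<A>" "src \<A> p' = tgt \<A> i'" "tgt \<A> p' = tgt \<A> p" "p' \<cdot> x = p" "p' \<cdot> i' = zer \<A> (src \<A> i') (tgt \<A> p)"
  shows "is_short_exact \<A> i' p'"
proof (rule short_exact_of_mono)
  show "is_mono \<A> i'" by (rule pushout_mono[OF po short_exact_mono[OF se]])
  note s = short_exact_typing[OF se] and P = pushoutD[OF po]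
  have ck: "is_cokernel \<A> p i" using se by (simp add: is_short_exact_def)
  show "is_cokernel \<A> p' i'"
  proof (rule cokernelI)
    fix h assume h: "h \<in> Mor \<A>" "src \<A> h = tgt \<A> i'" "h \<cdot> i' = zer \<A> (src \<A> i') (tgt \<A> h)"
    have "h \<cdot> x \<cdot> i = h \<cdot> i' \<cdot> g" using h(1,2) P by simp
    also have "\<dots> = zer \<A> (src \<A> i) (tgt \<A> h)" unfolding h(3) using P h by simp
    finally obtain k where k: "k \<in> Mor \<A>" "src \<A> k = tgt \<A> p" "tgt \<A> k = tgt \<A> h" "k \<cdot> p = h \<cdot> x"
      using cokernel_factor[OF ck, of "h \<cdot> x"] h P by auto
    have "k \<cdot> p' = h"
      by (rule pushout_ext[OF po]) (use k h p' P in simp_all)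
    then show "\<exists>u. u \<in> Mor \<A> \<and> tgt \<A> u = tgt \<A> h \<and> src \<A> u = tgt \<A> p' \<and> u \<cdot> p' = h" using k p' by auto
  next
    fix u assume u: "u \<in> Mor \<A>" "src \<A> u = tgt \<A> p'" "u \<cdot> p' = zer \<A> (src \<A> p') (tgt \<A> u)"
    have "u \<cdot> p = u \<cdot> p' \<cdot> x" using u(1,2) p' P by simp
    also have "\<dots> = zer \<A> (src \<A> p) (tgt \<A> u)" unfolding u(3) using u P p' s by simp
    finally show "u = zer \<A> (tgt \<A> p') (tgt \<A> u)"
      using epi_zer[OF short_exact_epi[OF se], of u] u p' by simp
  qed (use P p' in simp_all)
qed

lemma ex_pushout_short_exact:
  assumes se: "is_short_exact \<A> i p" and g: "g \<in> Mor \<A>" "src \<A> i = src \<A> g"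
  obtains x i' p' where "is_pushout \<A> i g x i'" "p' \<in> Mor \<A>" "src \<A> p' = tgt \<A> i'" "tgt \<A> p' = tgt \<A> p"
    "p' \<cdot> x = p" "p' \<cdot> i' = zer \<A> (src \<A> i') (tgt \<A> p)"
proof -
  note s = short_exact_typing[OF se]
  obtain x i' where po: "is_pushout \<A> i g x i'"
    using ex_pushout_mono[OF short_exact_mono[OF se]] g by metis
  note P = pushoutD[OF po]
  obtain p' where "p' \<in> Mor \<A>" "src \<A> p' = tgt \<A> x" "tgt \<A> p' = tgt \<A> p"
    "p' \<cdot> x = p" "p' \<cdot> i' = zer \<A> (src \<A> i') (tgt \<A> p)"
    using pushout_factor[OF po, of p "zer \<A> (src \<A> i') (tgt \<A> p)"] s P g by auto
  with that[OF po] P show ?thesis by simp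
qed

text \<open>An element chase with epis in place of elements: after an epi \<open>e\<close> the map
  \<open>v\<close> lifts along \<open>p\<close>, the error of this lift against \<open>u\<close>
  comes from the common left end, and the corrected lift descends along \<open>e\<close>.\<close>

lemma short_exact_pullback:
  assumes se: "is_short_exact \<A> i p" "is_short_exact \<A> j q"
    and x: "x \<in> Mor \<A>" "src \<A> x = tgt \<A> i" "tgt \<A> x = tgt \<A> j" "src \<A> i = src \<A> j" "x \<cdot> i = j"
    and c: "c \<in> Mor \<A>" "src \<A> c = tgt \<A> p" "tgt \<A> c = tgt \<A> q" "c \<cdot> p = q \<cdot> x"
  shows "is_pullback \<A> q c x p"
proof -
  note s = short_exact_typing[OF se(1)] and t = short_exact_typing[OF se(2)]
  have k: "is_kernel \<A> i p" and l: "is_kernel \<A> j q" using se by (auto simp: is_short_exact_def)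
  \<comment> \<open>\<open>x\<close> and \<open>p\<close> are jointly monic: a map killed by
    \<open>p\<close> comes from \<open>i\<close>, and \<open>x \<cdot> i = j\<close> is
    monic.\<close>
  have inj: "d = zer \<A> (src \<A> d) (src \<A> p)"
    if d: "d \<in> Mor \<A>" "tgt \<A> d = src \<A> p" "x \<cdot> d = zer \<A> (src \<A> d) (tgt \<A> x)" "p \<cdot> d = zer \<A> (src \<A> d) (tgt \<A> p)" for d
  proof -
    obtain b where b: "b \<in> Mor \<A>" "src \<A> b = src \<A> d" "tgt \<A> b = src \<A> i" "i \<cdot> b = d"
      using kernel_lift[OF k, of d] d by auto
    have "j \<cdot> b = x \<cdot> d" using cmp_eq[OF x(5), of b] b x s by simp
    then have "b = zer \<A> (src \<A> b) (src \<A> j)"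
      using mono_zer[OF short_exact_mono[OF se(2)], of b] b d x by simp
    then have "i \<cdot> b = zer \<A> (src \<A> b) (tgt \<A> i)" using s b x by (metis cmp_zer src_in_Obj)
    then show ?thesis using b s by simp
  qed
  show ?thesis unfolding is_pullback_def
  proof (intro conjI allI ballI impI)
    fix W u v assume "u \<in> Hom \<A> W (src \<A> q)" "v \<in> Hom \<A> W (src \<A> c)" and quv: "q \<cdot> u = c \<cdot> v"
    then have uv: "u \<in> Mor \<A>" "src \<A> u = W" "tgt \<A> u = src \<A> q" "v \<in> Mor \<A>" "src \<A> v = W" "tgt \<A> v = tgt \<A> p"
      using c by (auto simp: Hom_iff)
    obtain w' e where pb: "is_pullback \<A> p v w' e" and e: "is_epi \<A> e"
      using ex_pullback_epi[OF short_exact_epi[OF se(1)], of v] uv by auto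
    note P = pullbackD(1,2,4-9)[OF pb]
    have xw: "x \<cdot> w' \<in> Mor \<A>" "src \<A> (x \<cdot> w') = src \<A> e" "tgt \<A> (x \<cdot> w') = src \<A> q"
      "u \<cdot> e \<in> Mor \<A>" "src \<A> (u \<cdot> e) = src \<A> e" "tgt \<A> (u \<cdot> e) = src \<A> q"
      using P x t uv s by auto
    have "q \<cdot> (x \<cdot> w') = c \<cdot> p \<cdot> w'" unfolding c(4) using x t P s by simp
    also have "\<dots> = c \<cdot> v \<cdot> e" using c(1-3) P uv s by simp
    also have "\<dots> = q \<cdot> (u \<cdot> e)" unfolding quv[symmetric] using uv P t by simp
    finally have "q \<cdot> (x \<cdot> w' \<boxplus> neg (u \<cdot> e)) = zer \<A> (src \<A> e) (tgt \<A> q)"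
      using xw t by (simp del: assoc)
    then obtain b where b: "b \<in> Mor \<A>" "src \<A> b = src \<A> e" "tgt \<A> b = src \<A> j" "j \<cdot> b = x \<cdot> w' \<boxplus> neg (u \<cdot> e)"
      using kernel_lift[OF l, of "x \<cdot> w' \<boxplus> neg (u \<cdot> e)"] xw t by auto
    \<comment> \<open>Subtracting \<open>i \<cdot> b\<close> does not change the composite with
      \<open>p\<close> and cancels the error, since \<open>x \<cdot> i = j\<close>.\<close>
    define w2 where "w2 = w' \<boxplus> neg (i \<cdot> b)"
    have w2: "w2 \<in> Mor \<A>" "src \<A> w2 = src \<A> e" "tgt \<A> w2 = src \<A> p"
      using P b s x by (simp_all add: w2_def)
    have "x \<cdot> w2 = x \<cdot> w' \<boxplus> neg (x \<cdot> i \<cdot> b)"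
      using P b s x(1-4) by (simp add: w2_def)
    also have "\<dots> = x \<cdot> w' \<boxplus> neg (x \<cdot> w' \<boxplus> neg (u \<cdot> e))" unfolding x(5) b(4) ..
    also have "\<dots> = u \<cdot> e"
    proof -
      have "neg (x \<cdot> w' \<boxplus> neg (u \<cdot> e)) = u \<cdot> e \<boxplus> neg (x \<cdot> w')"
      proof (rule neg_unique[symmetric])
        have "x \<cdot> w' \<boxplus> neg (u \<cdot> e) \<boxplus> (u \<cdot> e \<boxplus> neg (x \<cdot> w')) = x \<cdot> w' \<boxplus> (neg (u \<cdot> e) \<boxplus> u \<cdot> e \<boxplus> neg (x \<cdot> w'))"
          using xw by (simp add: add_assoc del: neg_simps(4,5))
        also have "\<dots> = zer \<A> (src \<A> e) (src \<A> q)" using xw by simp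
        finally show "x \<cdot> w' \<boxplus> neg (u \<cdot> e) \<boxplus> (u \<cdot> e \<boxplus> neg (x \<cdot> w')) =
           zer \<A> (src \<A> (x \<cdot> w' \<boxplus> neg (u \<cdot> e))) (tgt \<A> (x \<cdot> w' \<boxplus> neg (u \<cdot> e)))" using xw by simp
      qed (use xw in simp_all)
      also have "x \<cdot> w' \<boxplus> (u \<cdot> e \<boxplus> neg (x \<cdot> w')) = x \<cdot> w' \<boxplus> neg (x \<cdot> w') \<boxplus> u \<cdot> e"
        using xw by (simp add: add_assoc add_commute[of "u \<cdot> e"] del: neg_simps(4,5))
      also have "\<dots> = u \<cdot> e" using xw by simp
      finally show ?thesis .
    qed
    finally have xw2: "x \<cdot> w2 = u \<cdot> e" .
    have "p \<cdot> (i \<cdot> b) = zer \<A> (src \<A> b) (tgt \<A> p)" using cmp_eq[OF s(4), of b] s b x by simp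
    then have pw2: "p \<cdot> w2 = v \<cdot> e" using P b s x uv(6) by (simp add: w2_def)
    obtain k where k: "is_kernel \<A> k e" using ex_kernel P by blast
    have ck: "is_cokernel \<A> e k" by (rule epi_is_cokernel) fact+
    note kD = kernelD[OF k]
    \<comment> \<open>By joint monicity the corrected lift vanishes on the kernel of
      \<open>e\<close>, so it factors through \<open>e\<close>, the cokernel of that kernel.\<close>
    have "w2 \<cdot> k = zer \<A> (src \<A> (w2 \<cdot> k)) (src \<A> p)"
    proof (rule inj)
      have "x \<cdot> (w2 \<cdot> k) = u \<cdot> (e \<cdot> k)" "p \<cdot> (w2 \<cdot> k) = v \<cdot> (e \<cdot> k)"
        using cmp_eq[OF xw2, of k] cmp_eq[OF pw2, of k] w2 x s kD uv P by simp_all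
      then show "x \<cdot> (w2 \<cdot> k) = zer \<A> (src \<A> (w2 \<cdot> k)) (tgt \<A> x)" "p \<cdot> (w2 \<cdot> k) = zer \<A> (src \<A> (w2 \<cdot> k)) (tgt \<A> p)"
        unfolding kD(4) using w2 kD uv P t x by simp_all
    qed (use w2 kD in simp_all)
    then obtain w where w: "w \<in> Mor \<A>" "src \<A> w = tgt \<A> e" "tgt \<A> w = src \<A> p" "w \<cdot> e = w2"
      using cokernel_factor[OF ck, of w2] w2 kD by auto
    have "x \<cdot> w = u" "p \<cdot> w = v"
      by (rule epi_cancel[OF e]; use w w2 xw2 pw2 uv P x s t in simp)+
    show "\<exists>!w. w \<in> Hom \<A> W (src \<A> x) \<and> x \<cdot> w = u \<and> p \<cdot> w = v"
    proof (rule ex1I[of _ w])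
      show "w \<in> Hom \<A> W (src \<A> x) \<and> x \<cdot> w = u \<and> p \<cdot> w = v"
        using \<open>x \<cdot> w = u\<close> \<open>p \<cdot> w = v\<close> w P uv x s by (simp add: Hom_iff)
      fix y assume "y \<in> Hom \<A> W (src \<A> x) \<and> x \<cdot> y = u \<and> p \<cdot> y = v"
      then have y: "y \<in> Mor \<A>" "src \<A> y = W" "tgt \<A> y = src \<A> p" "x \<cdot> y = u" "p \<cdot> y = v"
        using x s by (auto simp: Hom_iff)
      have "y \<boxplus> neg w = zer \<A> (src \<A> (y \<boxplus> neg w)) (src \<A> p)"
        by (rule inj) (use y w \<open>x \<cdot> w = u\<close> \<open>p \<cdot> w = v\<close> x s uv P t in simp_all)
      then show "y = w" using diff_eq_zer_iff[of y w] y w P uv by simp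
    qed
  qed (use x c s t in \<open>simp_all add: Hom_iff\<close>)
qed

lemma biproduct_Obj:
  assumes "is_biproduct \<A> X Y S b"
  shows "X \<in> Obj \<A>" "Y \<in> Obj \<A>" "S \<in> Obj \<A>"
proof -
  obtain i1 i2 p1 p2 where "b = (i1, i2, p1, p2)" by (cases b)
  note b = biproductD[OF assms[unfolded this]]
  show "X \<in> Obj \<A>" "Y \<in> Obj \<A>" "S \<in> Obj \<A>"
    using src_in_Obj[OF b(1)] src_in_Obj[OF b(4)] src_in_Obj[OF b(7)] unfolding b(2,5,8) .
qed

text \<open>The Mayer-Vietoris sequence of the square. It lets two maps that agree over the base be
  handled as one map into the biproduct, by exactness at a single middle term.\<close>

lemma pullback_short_exact_biproduct:
  assumes bp: "is_biproduct \<A> X Y S (i1, i2, p1, p2)" and pb: "is_pullback \<A> q c x p" and "is_epi \<A> q"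
    and XY: "src \<A> q = X" "src \<A> c = Y"
  shows "is_short_exact \<A> (i1 \<cdot> x \<boxplus> i2 \<cdot> p) (q \<cdot> p1 \<boxplus> neg (c \<cdot> p2))"
proof (rule short_exact_of_epi)
  note b = biproductD[OF bp] biproduct_Obj[OF bp] and P = pullbackD[OF pb]
  note bs = biproduct_simps[OF bp]
  let ?f = "q \<cdot> p1 \<boxplus> neg (c \<cdot> p2)" and ?k = "i1 \<cdot> x \<boxplus> i2 \<cdot> p"
  have f: "?f \<in> Mor \<A>" "src \<A> ?f = S" "tgt \<A> ?f = tgt \<A> c" "?f \<cdot> i1 = q"
    using b P XY by simp_all
  have k: "?k \<in> Mor \<A>" "src \<A> ?k = src \<A> x" "tgt \<A> ?k = S"
    using b P XY by simp_all
  show "is_epi \<A> ?f"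
  proof (rule epiI[OF f(1)])
    fix u assume u: "u \<in> Mor \<A>" "src \<A> u = tgt \<A> ?f" "u \<cdot> ?f = zer \<A> (src \<A> ?f) (tgt \<A> u)"
    have "u \<cdot> ?f \<cdot> i1 = u \<cdot> (?f \<cdot> i1)"
      by (rule assoc) (use u(1,2) f(1-3) b(1-12) in simp_all)
    then have "u \<cdot> q = u \<cdot> ?f \<cdot> i1" unfolding f(4) ..
    also have "\<dots> = zer \<A> (src \<A> q) (tgt \<A> u)" unfolding u(3) f(2) using u b XY by simp
    finally show "u = zer \<A> (tgt \<A> ?f) (tgt \<A> u)"
      using epi_zer[OF assms(3), of u] u(1,2) P f(3) by simp
  qed
  show "is_kernel \<A> ?k ?f"
  proof (rule kernelI)
    have "?f \<cdot> ?k = q \<cdot> x \<boxplus> neg (c \<cdot> p)"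
      using b(1-12) P XY by (simp add: bs)
    also have "\<dots> = zer \<A> (src \<A> ?k) (tgt \<A> ?f)" unfolding P(9) k f using P by simp
    finally show "?f \<cdot> ?k = zer \<A> (src \<A> ?k) (tgt \<A> ?f)" .
  next
    fix g assume g: "g \<in> Mor \<A>" "tgt \<A> g = src \<A> ?f" "?f \<cdot> g = zer \<A> (src \<A> g) (tgt \<A> ?f)"
    then have tg: "tgt \<A> g = S" unfolding f(2) by simp
    have "q \<cdot> (p1 \<cdot> g) \<boxplus> neg (c \<cdot> (p2 \<cdot> g)) = zer \<A> (src \<A> g) (tgt \<A> c)"
      using g(1,3) tg b(1-12) P XY by simp
    then have "q \<cdot> (p1 \<cdot> g) = c \<cdot> (p2 \<cdot> g)"
      using diff_eq_zer_iff[of "q \<cdot> (p1 \<cdot> g)" "c \<cdot> (p2 \<cdot> g)"] g(1) tg b(1-12) P XY by simp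
    then obtain w where w: "w \<in> Mor \<A>" "src \<A> w = src \<A> g" "tgt \<A> w = src \<A> x" "x \<cdot> w = p1 \<cdot> g" "p \<cdot> w = p2 \<cdot> g"
      using pullback_lift[OF pb, of "p1 \<cdot> g" "p2 \<cdot> g"] g(1) tg b(1-12) XY by auto
    have "?k \<cdot> w = g" using w b(1-12) P XY g(1) tg by (simp add: bs)
    then show "\<exists>u. u \<in> Mor \<A> \<and> src \<A> u = src \<A> g \<and> tgt \<A> u = src \<A> ?k \<and> ?k \<cdot> u = g"
      using w k(2) by auto
  next
    fix u assume u: "u \<in> Mor \<A>" "tgt \<A> u = src \<A> ?k" "?k \<cdot> u = zer \<A> (src \<A> u) (tgt \<A> ?k)"
    have tu: "tgt \<A> u = src \<A> x" using u(2) unfolding k(2) .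
    have "x \<cdot> u = p1 \<cdot> (?k \<cdot> u)" "p \<cdot> u = p2 \<cdot> (?k \<cdot> u)"
      using u(1) tu b(1-12) P XY by (simp_all add: bs)
    then have z: "x \<cdot> u = x \<cdot> zer \<A> (src \<A> u) (src \<A> x)" "p \<cdot> u = p \<cdot> zer \<A> (src \<A> u) (src \<A> x)"
      unfolding u(3) k(3) using u(1) tu b(1-12) P XY by simp_all
    have "q \<cdot> (x \<cdot> u) = c \<cdot> (p \<cdot> u)"
      using cmp_eq[OF P(9), of u] u(1) tu P by simp
    then have "\<exists>!w. w \<in> Hom \<A> (src \<A> u) (src \<A> x) \<and> x \<cdot> w = x \<cdot> u \<and> p \<cdot> w = p \<cdot> u"
      using pb u(1) tu P(4-8) unfolding is_pullback_def by (simp add: Hom_iff)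
    moreover have "zer \<A> (src \<A> u) (src \<A> x) \<in> Hom \<A> (src \<A> u) (src \<A> x)"
      using u(1) P by (simp add: Hom_iff)
    ultimately show "u = zer \<A> (src \<A> u) (src \<A> ?k)"
      unfolding k(2) using z u(1) tu by (metis (no_types, lifting) Hom_iff)
  qed (use f k in simp_all)
qed

text \<open>A map killing \<open>j \<cdot> i\<close> restricts along \<open>j\<close> to a map that
  factors through \<open>p\<close>. This is precisely the datum for a map out of the push-out of
  \<open>j\<close> along \<open>p\<close>, so that push-out computes the cokernel of the
  composite.\<close>

lemma short_exact_cmp:
  assumes se: "is_short_exact \<A> i p" "is_short_exact \<A> j q" "tgt \<A> i = src \<A> j" and po: "is_pushout \<A> j p r j'"
  shows "is_short_exact \<A> (j \<cdot> i) r"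
proof (rule short_exact_of_mono)
  note s = short_exact_typing[OF se(1)] and t = short_exact_typing[OF se(2)] and P = pushoutD[OF po]
  have ck: "is_cokernel \<A> p i" using se by (simp add: is_short_exact_def)
  have T: "i \<in> Mor \<A>" "p \<in> Mor \<A>" "j \<in> Mor \<A>" "tgt \<A> i = src \<A> p" "src \<A> j = src \<A> p" "r \<in> Mor \<A>" "src \<A> r = tgt \<A> j"
    "j' \<in> Mor \<A>" "tgt \<A> j' = tgt \<A> r" "src \<A> j' = tgt \<A> p"
    using s t P by auto
  show "is_mono \<A> (j \<cdot> i)"
  proof (rule monoI)
    fix u assume u: "u \<in> Mor \<A>" "tgt \<A> u = src \<A> (j \<cdot> i)" "j \<cdot> i \<cdot> u = zer \<A> (src \<A> u) (tgt \<A> (j \<cdot> i))"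
    have "i \<cdot> u = zer \<A> (src \<A> (i \<cdot> u)) (src \<A> j)"
      by (rule mono_zer[OF short_exact_mono[OF se(2)]]) (use u T in simp_all)
    then have "u = zer \<A> (src \<A> u) (src \<A> i)"
      by (intro mono_zer[OF short_exact_mono[OF se(1)]]) (use u T in simp_all)
    then show "u = zer \<A> (src \<A> u) (src \<A> (j \<cdot> i))" using T by simp
  qed (use T in simp)
  show "is_cokernel \<A> r (j \<cdot> i)"
  proof (rule cokernelI)
    have "r \<cdot> (j \<cdot> i) = j' \<cdot> (p \<cdot> i)" using cmp_eq[OF P(9), of i] T by simp
    then show "r \<cdot> (j \<cdot> i) = zer \<A> (src \<A> (j \<cdot> i)) (tgt \<A> r)" unfolding s(4) using T by simp
    fix h assume "h \<in> Mor \<A>" "src \<A> h = tgt \<A> (j \<cdot> i)" "h \<cdot> (j \<cdot> i) = zer \<A> (src \<A> (j \<cdot> i)) (tgt \<A> h)"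
    then have h: "h \<in> Mor \<A>" "src \<A> h = tgt \<A> j" "h \<cdot> j \<cdot> i = zer \<A> (src \<A> i) (tgt \<A> h)" using T by simp_all
    obtain k where k: "k \<in> Mor \<A>" "src \<A> k = tgt \<A> p" "tgt \<A> k = tgt \<A> h" "k \<cdot> p = h \<cdot> j"
      using cokernel_factor[OF ck, of "h \<cdot> j"] h T by auto
    obtain w where "w \<in> Mor \<A>" "src \<A> w = tgt \<A> r" "tgt \<A> w = tgt \<A> h" "w \<cdot> r = h"
      using pushout_factor[OF po, of h k] h k by metis
    then show "\<exists>u. u \<in> Mor \<A> \<and> tgt \<A> u = tgt \<A> h \<and> src \<A> u = tgt \<A> r \<and> u \<cdot> r = h" by blast
  next
    fix u assume u: "u \<in> Mor \<A>" "src \<A> u = tgt \<A> r" "u \<cdot> r = zer \<A> (src \<A> r) (tgt \<A> u)"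
    have "u \<cdot> j' \<cdot> p = u \<cdot> r \<cdot> j" using u(1,2) T P(9) by simp
    also have "\<dots> = zer \<A> (src \<A> p) (tgt \<A> u)" unfolding u(3) using u(1) T by simp
    finally have uj: "u \<cdot> j' = zer \<A> (src \<A> j') (tgt \<A> u)"
      using epi_zer[OF short_exact_epi[OF se(1)], of "u \<cdot> j'"] u(1,2) T by simp
    show "u = zer \<A> (tgt \<A> r) (tgt \<A> u)"
      by (rule pushout_ext[OF po]) (use u uj T in simp_all)
  qed (use T in simp_all)
qed

text \<open>The push-out property supplies the middle component; compatibility with the quotient
  maps is tested on the two legs.\<close>

lemma pushout_morphism:
  assumes po: "is_pushout \<A> i g x i'" and p: "p \<in> Mor \<A>" "tgt \<A> i = src \<A> p"
    and p': "p' \<in> Mor \<A>" "src \<A> p' = tgt \<A> i'" "tgt \<A> p' = tgt \<A> p" "p' \<cdot> x = p" "p' \<cdot> i' = zer \<A> (src \<A> i') (tgt \<A> p)"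
    and se: "is_short_exact \<A> j q"
    and h: "h \<in> Mor \<A>" "src \<A> h = tgt \<A> g" "tgt \<A> h = src \<A> j"
    and y: "y \<in> Mor \<A>" "src \<A> y = tgt \<A> i" "tgt \<A> y = tgt \<A> j" "y \<cdot> i = j \<cdot> (h \<cdot> g)"
    and c: "c \<in> Mor \<A>" "src \<A> c = tgt \<A> p" "tgt \<A> c = tgt \<A> q" "c \<cdot> p = q \<cdot> y"
  obtains y' where "y' \<in> Mor \<A>" "src \<A> y' = tgt \<A> i'" "tgt \<A> y' = tgt \<A> j" "y' \<cdot> i' = j \<cdot> h" "c \<cdot> p' = q \<cdot> y'"
proof -
  note t = short_exact_typing[OF se] and P = pushoutD[OF po]
  obtain w where w: "w \<in> Mor \<A>" "src \<A> w = tgt \<A> x" "tgt \<A> w = tgt \<A> j" "w \<cdot> x = y" "w \<cdot> i' = j \<cdot> h"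
    using pushout_factor[OF po, of y "j \<cdot> h"] y h P t by auto
  have "c \<cdot> p' = q \<cdot> w"
  proof (rule pushout_ext[OF po])
    show "c \<cdot> p' \<cdot> x = q \<cdot> w \<cdot> x" using c p' w P t y by simp
    have "q \<cdot> w \<cdot> i' = q \<cdot> (j \<cdot> h)" using w P t by simp
    also have "\<dots> = zer \<A> (src \<A> i') (tgt \<A> q)" using cmp_eq[OF t(4), of h] h t P by simp
    also have "\<dots> = c \<cdot> p' \<cdot> i'" using c(1-3) p' P by simp
    finally show "c \<cdot> p' \<cdot> i' = q \<cdot> w \<cdot> i'" ..
  qed (use w c p' P t in simp_all)
  with w P show ?thesis using that by simp
qed

text \<open>Lifts are formed componentwise. Read in the opposite category, this also gives the
  cokernel half of \<open>short_exact_biproduct\<close>.\<close>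

lemma kernel_biproduct:
  assumes k: "is_kernel \<A> i p" "is_kernel \<A> j q"
    and B: "is_biproduct \<A> (src \<A> i) (src \<A> j) B (bi1, bi2, bp1, bp2)"
    and X: "is_biproduct \<A> (tgt \<A> i) (tgt \<A> j) X (xi1, xi2, xp1, xp2)"
    and L: "is_biproduct \<A> (tgt \<A> p) (tgt \<A> q) L (ci1, ci2, cp1, cp2)"
  shows "is_kernel \<A> (xi1 \<cdot> (i \<cdot> bp1) \<boxplus> xi2 \<cdot> (j \<cdot> bp2)) (ci1 \<cdot> (p \<cdot> xp1) \<boxplus> ci2 \<cdot> (q \<cdot> xp2))"
    (is "is_kernel \<A> ?k ?f")
proof -
  note K = kernelD[OF k(1)] kernelD[OF k(2)]
  note b = biproductD(1-12)[OF B] biproductD(1-12)[OF X] biproductD(1-12)[OF L]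
  note bs = biproduct_simps[OF B] biproduct_simps[OF X] biproduct_simps[OF L]
  have kT: "?k \<in> Mor \<A>" "src \<A> ?k = B" "tgt \<A> ?k = X" and fT: "?f \<in> Mor \<A>" "src \<A> ?f = X" "tgt \<A> ?f = L"
    using K b by simp_all
  have kk: "xp1 \<cdot> (?k \<cdot> u) = i \<cdot> (bp1 \<cdot> u)" "xp2 \<cdot> (?k \<cdot> u) = j \<cdot> (bp2 \<cdot> u)" if "u \<in> Mor \<A>" "tgt \<A> u = B" for u
    using that K b by (simp_all add: bs)
  have ff: "cp1 \<cdot> (?f \<cdot> u) = p \<cdot> (xp1 \<cdot> u)" "cp2 \<cdot> (?f \<cdot> u) = q \<cdot> (xp2 \<cdot> u)" if "u \<in> Mor \<A>" "tgt \<A> u = X" for u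
    using that K b by (simp_all add: bs)
  have O: "B \<in> Obj \<A>" "X \<in> Obj \<A>" "L \<in> Obj \<A>" using kT fT by force+
  show ?thesis
  proof (rule kernelI)
    show "?f \<cdot> ?k = zer \<A> (src \<A> ?k) (tgt \<A> ?f)"
    proof (rule biproduct_ext[OF L])
      have "xp1 \<cdot> ?k = i \<cdot> bp1" "xp2 \<cdot> ?k = j \<cdot> bp2" using K b by (simp_all add: bs)
      then show "cp1 \<cdot> (?f \<cdot> ?k) = cp1 \<cdot> zer \<A> (src \<A> ?k) (tgt \<A> ?f)"
        "cp2 \<cdot> (?f \<cdot> ?k) = cp2 \<cdot> zer \<A> (src \<A> ?k) (tgt \<A> ?f)"
        unfolding ff[OF kT(1,3)] kT(2) fT(3)
        using cmp_eq[OF K(4), of bp1] cmp_eq[OF K(8), of bp2] K b O by simp_all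
    qed (use kT fT O in \<open>simp_all del: distrib_left distrib_right\<close>)
  next
    fix g assume g: "g \<in> Mor \<A>" "tgt \<A> g = src \<A> ?f" "?f \<cdot> g = zer \<A> (src \<A> g) (tgt \<A> ?f)"
    note tg = g(2)[unfolded fT] and z = g(3)[unfolded fT]
    have e: "p \<cdot> (xp1 \<cdot> g) = zer \<A> (src \<A> g) (tgt \<A> p)" "q \<cdot> (xp2 \<cdot> g) = zer \<A> (src \<A> g) (tgt \<A> q)"
      unfolding ff[OF g(1) tg, symmetric] z using g(1) K b by simp_all
    obtain u1 where u1: "u1 \<in> Mor \<A>" "src \<A> u1 = src \<A> g" "tgt \<A> u1 = src \<A> i" "i \<cdot> u1 = xp1 \<cdot> g"
      using kernel_lift[OF k(1), of "xp1 \<cdot> g"] e g(1) tg K b by auto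
    obtain u2 where u2: "u2 \<in> Mor \<A>" "src \<A> u2 = src \<A> g" "tgt \<A> u2 = src \<A> j" "j \<cdot> u2 = xp2 \<cdot> g"
      using kernel_lift[OF k(2), of "xp2 \<cdot> g"] e g(1) tg K b by auto
    define u where "u = bi1 \<cdot> u1 \<boxplus> bi2 \<cdot> u2"
    have u: "u \<in> Mor \<A>" "src \<A> u = src \<A> g" "tgt \<A> u = B" "bp1 \<cdot> u = u1" "bp2 \<cdot> u = u2"
      using u1(1-3) u2(1-3) b K src_in_Obj[OF g(1)] src_in_Obj[OF K(1)] src_in_Obj[OF K(5)]
      by (simp_all add: u_def bs)
    have "?k \<cdot> u = g"
      by (rule biproduct_ext[OF X])
        (use kk[OF u(1,3)] kT g(1) tg u u1 u2 in \<open>simp_all del: distrib_left distrib_right\<close>)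
    then show "\<exists>u. u \<in> Mor \<A> \<and> src \<A> u = src \<A> g \<and> tgt \<A> u = src \<A> ?k \<and> ?k \<cdot> u = g"
      unfolding kT using u by blast
  next
    fix u assume u: "u \<in> Mor \<A>" "tgt \<A> u = src \<A> ?k" "?k \<cdot> u = zer \<A> (src \<A> u) (tgt \<A> ?k)"
    note tu = u(2)[unfolded kT] and z = u(3)[unfolded kT]
    have "i \<cdot> (bp1 \<cdot> u) = zer \<A> (src \<A> u) (tgt \<A> i)" "j \<cdot> (bp2 \<cdot> u) = zer \<A> (src \<A> u) (tgt \<A> j)"
      unfolding kk[OF u(1) tu, symmetric] z using u(1) K b by simp_all
    then have v: "bp1 \<cdot> u = zer \<A> (src \<A> (bp1 \<cdot> u)) (src \<A> i)" "bp2 \<cdot> u = zer \<A> (src \<A> (bp2 \<cdot> u)) (src \<A> j)"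
      using mono_zer[OF kernel_mono[OF k(1)], of "bp1 \<cdot> u"] mono_zer[OF kernel_mono[OF k(2)], of "bp2 \<cdot> u"]
        u(1) tu b K by simp_all
    show "u = zer \<A> (src \<A> u) (src \<A> ?k)"
      unfolding kT by (rule biproduct_ext[OF B]) (use v u(1) tu b O K in simp_all)
  qed (use kT fT in \<open>simp_all del: distrib_left distrib_right\<close>)
qed

lemma short_exact_biproduct:
  assumes se: "is_short_exact \<A> i p" "is_short_exact \<A> j q"
    and B: "is_biproduct \<A> (src \<A> i) (src \<A> j) B (bi1, bi2, bp1, bp2)"
    and X: "is_biproduct \<A> (tgt \<A> i) (tgt \<A> j) X (xi1, xi2, xp1, xp2)"
    and L: "is_biproduct \<A> (tgt \<A> p) (tgt \<A> q) L (ci1, ci2, cp1, cp2)"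
  shows "is_short_exact \<A> (xi1 \<cdot> (i \<cdot> bp1) \<boxplus> xi2 \<cdot> (j \<cdot> bp2)) (ci1 \<cdot> (p \<cdot> xp1) \<boxplus> ci2 \<cdot> (q \<cdot> xp2))"
proof -
  note s = short_exact_typing[OF se(1)] and t = short_exact_typing[OF se(2)]
  note b = biproductD(1-12)[OF B] biproductD(1-12)[OF X] biproductD(1-12)[OF L]
  have "is_cokernel \<A> (ci1 \<cdot> p \<cdot> xp1 \<boxplus> ci2 \<cdot> q \<cdot> xp2) (xi1 \<cdot> i \<cdot> bp1 \<boxplus> xi2 \<cdot> j \<cdot> bp2)"
    using abelian_category.kernel_biproduct[OF abelian_opc, of p i q j L cp1 cp2 ci1 ci2 X xp1 xp2 xi1 xi2 B bp1 bp2 bi1 bi2]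
      se B X L s(3) t(3) by (simp add: is_short_exact_def)
  then show ?thesis
    using kernel_biproduct[of i p j q B bi1 bi2 bp1 bp2 X xi1 xi2 xp1 xp2 L ci1 ci2 cp1 cp2] se B X L s(1-3) t(1-3) b
    by (simp add: is_short_exact_def)
qed

end

section \<open>Spliced sequences and their morphisms\<close>

lemma spliced_append:
  "spliced \<A> C B (\<xi> @ \<zeta>) A \<longleftrightarrow> (\<exists>D. spliced \<A> C B \<xi> D \<and> spliced \<A> C D \<zeta> A)"
  by (induction \<xi> arbitrary: B) auto

text \<open>The empty list is spliced from any object to itself, inside \<open>C\<close> or not,
  which accounts for the disjunction.\<close>

lemma spliced_C:
  assumes "spliced \<A> C B \<xi> A" "B \<in> C \<or> A \<in> C \<or> \<xi> \<noteq> []"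
  shows "B \<in> C" "A \<in> C"
proof -
  have "(B \<in> C \<or> A \<in> C \<or> \<xi> \<noteq> []) \<longrightarrow> B \<in> C \<and> A \<in> C"
    using assms(1) by (induction \<xi> arbitrary: B) (auto simp: conflation_def)
  with assms(2) show "B \<in> C" "A \<in> C" by auto
qed

lemma spliced_unique:
  assumes "spliced \<A> C B \<xi> A" "spliced \<A> C B' \<xi> A'" "\<xi> \<noteq> []"
  shows "B = B'" "A = A'"
proof -
  have "A = A'" if "spliced \<A> C D \<xi> A" "spliced \<A> C D \<xi> A'" for D
    using that by (induction \<xi> arbitrary: D) auto
  moreover show "B = B'" using assms by (cases \<xi>) auto
  ultimately show "A = A'" using assms by simp
qed

lemma seq_map_length: "seq_map \<A> b \<xi> \<zeta> a \<Longrightarrow> length \<zeta> = length \<xi>"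
  by (induction \<A> b \<xi> \<zeta> a rule: seq_map.induct) auto

lemma seq_map_append:
  "seq_map \<A> b \<xi> \<zeta> c \<Longrightarrow> seq_map \<A> c \<xi>' \<zeta>' a \<Longrightarrow> seq_map \<A> b (\<xi> @ \<xi>') (\<zeta> @ \<zeta>') a"
  by (induction \<A> b \<xi> \<zeta> c rule: seq_map.induct) auto

text \<open>The same exact sequence as seen in the opposite category.\<close>

definition flip :: "'m seq \<Rightarrow> 'm seq" where
  "flip \<xi> = rev (map prod.swap \<xi>)"

lemma flip_simps [simp]:
  "flip [] = []" "flip ((i, p) # \<xi>) = flip \<xi> @ [(p, i)]" "flip (\<xi> @ \<zeta>) = flip \<zeta> @ flip \<xi>"
  "flip (flip \<xi>) = \<xi>" "length (flip \<xi>) = length \<xi>" "flip \<xi> = [] \<longleftrightarrow> \<xi> = []"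
  by (simp_all add: flip_def rev_map[symmetric])

lemma spliced_flip [simp]: "spliced (opc \<A>) C A (flip \<xi>) B \<longleftrightarrow> spliced \<A> C B \<xi> A"
proof (induction \<xi> arbitrary: B)
  case (Cons ip \<xi>)
  then show ?case
    by (cases ip) (auto simp: spliced_append)
qed auto

lemma seq_pushout_flip [simp]: "seq_pushout (opc \<A>) h (flip \<xi>) (flip \<zeta>) \<longleftrightarrow> seq_pullback \<A> h \<xi> \<zeta>"
proof -
  have r: "flip \<xi> = (p, i) # \<rho> \<longleftrightarrow> \<xi> = flip \<rho> @ [(i, p)]" for \<xi> :: "('b \<times> 'b) list" and p i \<rho>
    by (metis flip_simps(1,2,4) append_Nil flip_simps(3))
  show ?thesis
    unfolding seq_pushout_def seq_pullback_def r is_pushout_opc Hom_opc opc_simps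
    by (metis flip_simps(4))
qed

section \<open>Morphisms, push-outs and pull-backs of sequences in the subcategory\<close>

context extension_closed_subcategory
begin

lemma extension_closed_opc: "extension_closed_subcategory (opc \<A>) C"
  by (rule extension_closed_subcategory_opc) unfold_locales

lemma C_in_Obj [simp]: "X \<in> C \<Longrightarrow> X \<in> Obj \<A>"
  using C_Obj by blast

lemma conflationD:
  assumes "conflation \<A> C i p"
  shows "i \<in> Mor \<A>" "p \<in> Mor \<A>" "tgt \<A> i = src \<A> p" "src \<A> i \<in> C" "src \<A> p \<in> C" "tgt \<A> p \<in> C"
    "is_short_exact \<A> i p" "p \<cdot> i = zer \<A> (src \<A> i) (tgt \<A> p)"
  using assms short_exact_typing[of \<A> i p] by (auto simp: conflation_def)

lemma seq_map_Hom:
  assumes "seq_map \<A> b \<xi> \<zeta> a" "spliced \<A> C B \<xi> A" "spliced \<A> C B' \<zeta> A'" "b \<in> Hom \<A> B B'"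
  shows "a \<in> Hom \<A> A A'"
  using assms by (induction \<A> b \<xi> \<zeta> a arbitrary: B B' rule: seq_map.induct) auto

lemma seq_map_refl:
  assumes "spliced \<A> C B \<xi> A" "B \<in> C"
  shows "seq_map \<A> (idm \<A> B) \<xi> \<xi> (idm \<A> A)"
  using assms
proof (induction \<xi> arbitrary: B)
  case (Cons ip \<xi>)
  obtain i p where ip: "ip = (i, p)" by force
  have c: "conflation \<A> C i p" "src \<A> i = B" "spliced \<A> C (tgt \<A> p) \<xi> A" using Cons.prems ip by auto
  note d = conflationD[OF c(1)]
  show ?case unfolding ip seq_map.simps
    using d c(2) Cons.IH[OF c(3) d(6)]
    by (intro bexI[of _ "idm \<A> (src \<A> p)"] bexI[of _ "idm \<A> (tgt \<A> p)"]) (auto simp: Hom_iff)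
qed simp

lemma seq_map_trans:
  assumes "seq_map \<A> b \<xi> \<zeta> a" "seq_map \<A> b' \<zeta> \<tau> a'" "spliced \<A> C B \<xi> A" "spliced \<A> C B' \<zeta> A'"
    "spliced \<A> C B'' \<tau> A''" "b \<in> Hom \<A> B B'" "b' \<in> Hom \<A> B' B''"
  shows "seq_map \<A> (b' \<cdot> b) \<xi> \<tau> (a' \<cdot> a)"
  using assms
proof (induction \<xi> arbitrary: \<zeta> \<tau> b b' B B' B'')
  case Nil
  then show ?case by (cases \<zeta>; cases \<tau>) auto
next
  case (Cons ip \<xi>)
  obtain i p where ip: "ip = (i, p)" by force
  obtain j q \<zeta>' where z: "\<zeta> = (j, q) # \<zeta>'" using Cons.prems(1) ip by (cases \<zeta>) auto
  obtain k r \<tau>' where t: "\<tau> = (k, r) # \<tau>'" using Cons.prems(2) z by (cases \<tau>) auto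
  obtain x c where x: "x \<in> Hom \<A> (tgt \<A> i) (tgt \<A> j)" "c \<in> Hom \<A> (tgt \<A> p) (tgt \<A> q)" "x \<cdot> i = j \<cdot> b" "c \<cdot> p = q \<cdot> x"
    "seq_map \<A> c \<xi> \<zeta>' a"
    using Cons.prems(1) ip z by auto
  obtain y d where y: "y \<in> Hom \<A> (tgt \<A> j) (tgt \<A> k)" "d \<in> Hom \<A> (tgt \<A> q) (tgt \<A> r)" "y \<cdot> j = k \<cdot> b'" "d \<cdot> q = r \<cdot> y"
    "seq_map \<A> d \<zeta>' \<tau>' a'"
    using Cons.prems(2) t z by auto
  have sp: "conflation \<A> C i p" "src \<A> i = B" "spliced \<A> C (tgt \<A> p) \<xi> A"
    "conflation \<A> C j q" "src \<A> j = B'" "spliced \<A> C (tgt \<A> q) \<zeta>' A'"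
    "conflation \<A> C k r" "src \<A> k = B''" "spliced \<A> C (tgt \<A> r) \<tau>' A''"
    using Cons.prems ip z t by auto
  note D = conflationD(1-3)[OF sp(1)] conflationD(1-3)[OF sp(4)] conflationD(1-3)[OF sp(7)]
  have bb: "b \<in> Mor \<A>" "src \<A> b = B" "tgt \<A> b = B'" "b' \<in> Mor \<A>" "src \<A> b' = B'" "tgt \<A> b' = B''"
    using Cons.prems(6,7) by (auto simp: Hom_iff)
  have X: "x \<in> Mor \<A>" "src \<A> x = src \<A> p" "tgt \<A> x = src \<A> q" "c \<in> Mor \<A>" "src \<A> c = tgt \<A> p" "tgt \<A> c = tgt \<A> q"
    "y \<in> Mor \<A>" "src \<A> y = src \<A> q" "tgt \<A> y = src \<A> r" "d \<in> Mor \<A>" "src \<A> d = tgt \<A> q" "tgt \<A> d = tgt \<A> r"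
    using x(1,2) y(1,2) D by (auto simp: Hom_iff)
  have e1: "y \<cdot> x \<cdot> i = k \<cdot> (b' \<cdot> b)"
    using x(3) cmp_eq[OF y(3), of b] X D bb sp(2,5,8) by simp
  have "d \<cdot> c \<cdot> p = d \<cdot> q \<cdot> x" using x(4) X D by simp
  also have "\<dots> = r \<cdot> (y \<cdot> x)" unfolding y(4) using X D by simp
  finally have e2: "d \<cdot> c \<cdot> p = r \<cdot> (y \<cdot> x)" .
  have "seq_map \<A> (d \<cdot> c) \<xi> \<tau>' (a' \<cdot> a)"
    by (rule Cons.IH[OF x(5) y(5) sp(3,6,9)]) (use x y in auto)
  then show ?case unfolding ip t seq_map.simps
    using e1 e2 X D by (intro bexI[of _ "y \<cdot> x"] bexI[of _ "d \<cdot> c"]) (auto simp: Hom_iff)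
qed

text \<open>Dualizing reverses the morphism, so the two sequences change places together with the
  end maps.\<close>

lemma seq_map_flip:
  assumes "seq_map \<A> b \<xi> \<zeta> a" "spliced \<A> C B \<xi> A" "spliced \<A> C B' \<zeta> A'" "b \<in> Hom \<A> B B'"
  shows "seq_map (opc \<A>) a (flip \<zeta>) (flip \<xi>) b"
  using assms
proof (induction \<xi> arbitrary: \<zeta> b B B')
  case Nil
  then show ?case by (cases \<zeta>) auto
next
  case (Cons ip \<xi>)
  obtain i p where ip: "ip = (i, p)" by force
  obtain j q \<zeta>' where z: "\<zeta> = (j, q) # \<zeta>'" using Cons.prems(1) ip by (cases \<zeta>) auto
  obtain x c where x: "x \<in> Hom \<A> (tgt \<A> i) (tgt \<A> j)" "c \<in> Hom \<A> (tgt \<A> p) (tgt \<A> q)" "x \<cdot> i = j \<cdot> b" "c \<cdot> p = q \<cdot> x"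
    "seq_map \<A> c \<xi> \<zeta>' a"
    using Cons.prems(1) ip z by auto
  have sp: "conflation \<A> C i p" "src \<A> i = B" "spliced \<A> C (tgt \<A> p) \<xi> A"
    "conflation \<A> C j q" "src \<A> j = B'" "spliced \<A> C (tgt \<A> q) \<zeta>' A'"
    using Cons.prems ip z by auto
  note D = conflationD(1-3)[OF sp(1)] conflationD(1-3)[OF sp(4)]
  have "seq_map (opc \<A>) c [(q, j)] [(p, i)] b"
    using x(1-4) D sp(2,5) Cons.prems(4)
    by (simp, intro bexI[of _ x] bexI[of _ b]) (auto simp: Hom_iff)
  from seq_map_append[OF Cons.IH[OF x(5) sp(3,6) x(2)] this] show ?case unfolding ip z by simp
qed

text \<open>Extension-closure enters here: the new middle term is an extension of
  \<open>tgt \<A> p\<close> by \<open>tgt \<A> g\<close>.\<close>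

lemma pushout_conflation:
  assumes c: "conflation \<A> C i p" and po: "is_pushout \<A> i g x i'" and g: "tgt \<A> g \<in> C"
    and p': "p' \<in> Hom \<A> (tgt \<A> i') (tgt \<A> p)" "p' \<cdot> x = p" "p' \<cdot> i' = zer \<A> (src \<A> i') (tgt \<A> p)"
  shows "conflation \<A> C i' p'"
proof -
  note D = conflationD[OF c] and P = pushoutD[OF po]
  have "is_short_exact \<A> i' p'"
    by (rule pushout_short_exact[OF D(7) po]) (use p' in \<open>auto simp: Hom_iff\<close>)
  then show ?thesis
    using C_extension[of i' p'] D P g p'(1) by (simp add: conflation_def Hom_iff)
qed

lemma ex_pushout_conflation:
  assumes c: "conflation \<A> C i p" and g: "g \<in> Mor \<A>" "src \<A> i = src \<A> g" "tgt \<A> g \<in> C"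
  obtains x i' p' where "is_pushout \<A> i g x i'" "p' \<in> Hom \<A> (tgt \<A> i') (tgt \<A> p)" "p' \<cdot> x = p"
    "p' \<cdot> i' = zer \<A> (src \<A> i') (tgt \<A> p)" "conflation \<A> C i' p'"
proof -
  obtain x i' p' where 1: "is_pushout \<A> i g x i'" "p' \<in> Mor \<A>" "src \<A> p' = tgt \<A> i'" "tgt \<A> p' = tgt \<A> p"
    "p' \<cdot> x = p" "p' \<cdot> i' = zer \<A> (src \<A> i') (tgt \<A> p)"
    using ex_pushout_short_exact[OF conflationD(7)[OF c] g(1,2)] by metis
  then have 2: "p' \<in> Hom \<A> (tgt \<A> i') (tgt \<A> p)" by (simp add: Hom_iff)
  show ?thesis
    by (rule that[OF 1(1) 2 1(5,6)]) (rule pushout_conflation[OF c 1(1) g(3) 2 1(5,6)])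
qed

lemma ex_seq_pushout:
  assumes "spliced \<A> C B \<xi> A" "\<xi> \<noteq> []" "g \<in> Hom \<A> B B'" "B' \<in> C"
  obtains \<zeta> where "seq_pushout \<A> g \<xi> \<zeta>"
proof -
  obtain i p \<rho> where x: "\<xi> = (i, p) # \<rho>" using assms(2) by (metis list.exhaust surj_pair)
  then have c: "conflation \<A> C i p" "src \<A> i = B" using assms(1) by auto
  obtain x i' p' where "is_pushout \<A> i g x i'" "p' \<in> Hom \<A> (tgt \<A> i') (tgt \<A> p)" "p' \<cdot> x = p"
    "p' \<cdot> i' = zer \<A> (src \<A> i') (tgt \<A> p)"
    by (rule ex_pushout_conflation[of i p g]) (use c assms(3,4) in \<open>auto simp: Hom_iff\<close>)
  with x that show ?thesis unfolding seq_pushout_def by blast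
qed

lemma seq_pushoutD:
  assumes "spliced \<A> C B \<xi> A" "seq_pushout \<A> g \<xi> \<zeta>" "g \<in> Hom \<A> B B'" "B' \<in> C"
  shows "spliced \<A> C B' \<zeta> A" "seq_map \<A> g \<xi> \<zeta> (idm \<A> A)" "\<xi> \<noteq> []" "\<zeta> \<noteq> []" "length \<zeta> = length \<xi>"
proof -
  obtain i p x i' p' \<rho> where e: "\<xi> = (i, p) # \<rho>" "\<zeta> = (i', p') # \<rho>"
    and po: "is_pushout \<A> i g x i'" and p': "p' \<in> Hom \<A> (tgt \<A> i') (tgt \<A> p)"
     "p' \<cdot> x = p" "p' \<cdot> i' = zer \<A> (src \<A> i') (tgt \<A> p)"
    using assms(2) unfolding seq_pushout_def by blast
  then show "\<xi> \<noteq> []" "\<zeta> \<noteq> []" "length \<zeta> = length \<xi>" by auto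
  have sp: "conflation \<A> C i p" "src \<A> i = B" "spliced \<A> C (tgt \<A> p) \<rho> A" using assms(1) e by auto
  note D = conflationD[OF sp(1)] and P = pushoutD[OF po]
  have g: "g \<in> Mor \<A>" "src \<A> g = B" "tgt \<A> g = B'" using assms(3) by (auto simp: Hom_iff)
  have "conflation \<A> C i' p'"
    by (rule pushout_conflation[OF sp(1) po _ p']) (use g assms(4) in simp)
  then show "spliced \<A> C B' \<zeta> A" using e sp P p'(1) g by (simp add: Hom_iff)
  show "seq_map \<A> g \<xi> \<zeta> (idm \<A> A)" unfolding e seq_map.simps
    using P p' D seq_map_refl[OF sp(3) D(6)]
    by (intro bexI[of _ x] bexI[of _ "idm \<A> (tgt \<A> p)"]) (simp_all add: Hom_iff)
qed

text \<open>Only the first conflation changes under push-out, so a factorization there can be joined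
  to the unchanged components on the rest of the sequence.\<close>

lemma seq_pushout_map:
  assumes sp: "spliced \<A> C B \<xi> A" and po: "seq_pushout \<A> g \<xi> \<zeta>" and g: "g \<in> Hom \<A> B B'" "B' \<in> C"
    and h: "h \<in> Hom \<A> B' B''" and t: "spliced \<A> C B'' \<tau> A''" and m: "seq_map \<A> (h \<cdot> g) \<xi> \<tau> a"
  shows "seq_map \<A> h \<zeta> \<tau> a"
proof -
  obtain i p x i' p' \<rho> where e: "\<xi> = (i, p) # \<rho>" "\<zeta> = (i', p') # \<rho>"
    and po: "is_pushout \<A> i g x i'" and p': "p' \<in> Hom \<A> (tgt \<A> i') (tgt \<A> p)"
     "p' \<cdot> x = p" "p' \<cdot> i' = zer \<A> (src \<A> i') (tgt \<A> p)"
    using po unfolding seq_pushout_def by blast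
  obtain j q \<tau>' where te: "\<tau> = (j, q) # \<tau>'" using m e by (cases \<tau>) auto
  have s: "conflation \<A> C i p" "src \<A> i = B" "conflation \<A> C j q" "src \<A> j = B''" using sp e t te by auto
  note D = conflationD[OF s(1)] conflationD[OF s(3)] and P = pushoutD[OF po]
  obtain y c where y: "y \<in> Hom \<A> (tgt \<A> i) (tgt \<A> j)" "c \<in> Hom \<A> (tgt \<A> p) (tgt \<A> q)"
    "y \<cdot> i = j \<cdot> (h \<cdot> g)" "c \<cdot> p = q \<cdot> y" "seq_map \<A> c \<rho> \<tau>' a"
    using m e te by auto
  obtain y' where "y' \<in> Mor \<A>" "src \<A> y' = tgt \<A> i'" "tgt \<A> y' = tgt \<A> j" "y' \<cdot> i' = j \<cdot> h" "c \<cdot> p' = q \<cdot> y'"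
    by (rule pushout_morphism[OF po, of p p' j q h y c])
      (use D(2,3,15) p' h g(1) s(4) y in \<open>auto simp: Hom_iff\<close>)
  then show ?thesis unfolding e te seq_map.simps using y p'(1) P(7)
    by (intro bexI[of _ y'] bexI[of _ c]) (simp_all add: Hom_iff)
qed

lemma ex_seq_pullback:
  assumes "spliced \<A> C B \<xi> A" "\<xi> \<noteq> []" "h \<in> Hom \<A> A' A" "A' \<in> C"
  obtains \<zeta> where "seq_pullback \<A> h \<xi> \<zeta>"
proof -
  obtain \<zeta> where "seq_pushout (opc \<A>) h (flip \<xi>) \<zeta>"
    using extension_closed_subcategory.ex_seq_pushout[OF extension_closed_opc, of A "flip \<xi>" B h A'] assms by auto
  then have "seq_pushout (opc \<A>) h (flip \<xi>) (flip (flip \<zeta>))" by simp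
  then show ?thesis using that unfolding seq_pushout_flip by blast
qed

lemma seq_pullbackD:
  assumes "spliced \<A> C B \<xi> A" "seq_pullback \<A> h \<xi> \<zeta>" "h \<in> Hom \<A> A' A" "A' \<in> C"
  shows "spliced \<A> C B \<zeta> A'" "seq_map \<A> (idm \<A> B) \<zeta> \<xi> h" "\<xi> \<noteq> []" "\<zeta> \<noteq> []" "length \<zeta> = length \<xi>"
proof -
  interpret op: extension_closed_subcategory "opc \<A>" C by (rule extension_closed_opc)
  note d = op.seq_pushoutD[of A "flip \<xi>" B h "flip \<zeta>" A']
  have a: "spliced (opc \<A>) C A (flip \<xi>) B" "seq_pushout (opc \<A>) h (flip \<xi>) (flip \<zeta>)" "h \<in> Hom (opc \<A>) A A'" "A' \<in> C"
    using assms by simp_all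
  note d = d[OF a]
  show "spliced \<A> C B \<zeta> A'" "\<xi> \<noteq> []" "\<zeta> \<noteq> []" "length \<zeta> = length \<xi>"
    using d(1,3,4,5) by simp_all
  show "seq_map \<A> (idm \<A> B) \<zeta> \<xi> h"
    using op.seq_map_flip[OF d(2) a(1) d(1)] assms(3) by simp
qed

lemma seq_pullback_map:
  assumes "spliced \<A> C B \<xi> A" "seq_pullback \<A> h \<xi> \<zeta>" "h \<in> Hom \<A> A' A" "A' \<in> C"
    and k: "k \<in> Hom \<A> A'' A'" and t: "spliced \<A> C B'' \<tau> A''" and b: "b \<in> Hom \<A> B'' B" and m: "seq_map \<A> b \<tau> \<xi> (h \<cdot> k)"
  shows "seq_map \<A> b \<tau> \<zeta> k"
proof -
  interpret op: extension_closed_subcategory "opc \<A>" C by (rule extension_closed_opc)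
  have "seq_map (opc \<A>) k (flip \<zeta>) (flip \<tau>) b"
  proof (rule op.seq_pushout_map[of A "flip \<xi>" B h "flip \<zeta>" A' k A'' "flip \<tau>" B'' b])
    show "seq_map (opc \<A>) (k \<cdot>\<^bsub>opc \<A>\<^esub> h) (flip \<xi>) (flip \<tau>) b"
      using seq_map_flip[OF m t assms(1) b] by simp
  qed (use assms in simp_all)
  from op.seq_map_flip[OF this] show ?thesis
    using k t seq_pullbackD(1)[OF assms(1-4)] by simp
qed

end

section \<open>Zero sequences\<close>

context preadditive_category
begin

lemma zero_objectD:
  assumes "is_zero_object \<A> Z"
  shows "Z \<in> Obj \<A>"
    "\<And>f. f \<in> Mor \<A> \<Longrightarrow> src \<A> f = Z \<Longrightarrow> f = zer \<A> Z (tgt \<A> f)"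
    "\<And>f. f \<in> Mor \<A> \<Longrightarrow> tgt \<A> f = Z \<Longrightarrow> f = zer \<A> (src \<A> f) Z"
proof -
  show Z: "Z \<in> Obj \<A>" using assms by (simp add: is_zero_object_def)
  have u: "\<exists>!f. f \<in> Hom \<A> X Z" "\<exists>!f. f \<in> Hom \<A> Z X" if "X \<in> Obj \<A>" for X
    using assms that by (simp_all add: is_zero_object_def)
  show "f = zer \<A> Z (tgt \<A> f)" if "f \<in> Mor \<A>" "src \<A> f = Z" for f
  proof -
    have "f \<in> Hom \<A> Z (tgt \<A> f)" "zer \<A> Z (tgt \<A> f) \<in> Hom \<A> Z (tgt \<A> f)"
      using that Z by (simp_all add: Hom_iff)
    with u(2)[of "tgt \<A> f"] that show ?thesis by auto
  qed
  show "f = zer \<A> (src \<A> f) Z" if "f \<in> Mor \<A>" "tgt \<A> f = Z" for f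
  proof -
    have "f \<in> Hom \<A> (src \<A> f) Z" "zer \<A> (src \<A> f) Z \<in> Hom \<A> (src \<A> f) Z"
      using that Z by (simp_all add: Hom_iff)
    with u(1)[of "src \<A> f"] that show ?thesis by auto
  qed
qed

lemma kernel_idm_zer:
  assumes "is_zero_object \<A> Z" "X \<in> Obj \<A>"
  shows "is_kernel \<A> (idm \<A> X) (zer \<A> X Z)" "is_cokernel \<A> (zer \<A> X Z) (idm \<A> X)"
proof -
  note Z = zero_objectD[OF assms(1)]
  show "is_kernel \<A> (idm \<A> X) (zer \<A> X Z)"
    by (rule kernelI) (use assms Z(1) in auto)
  show "is_cokernel \<A> (zer \<A> X Z) (idm \<A> X)"
  proof (rule cokernelI)
    fix g assume "g \<in> Mor \<A>" "src \<A> g = tgt \<A> (idm \<A> X)" "g \<cdot> idm \<A> X = zer \<A> (src \<A> (idm \<A> X)) (tgt \<A> g)"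
    then have g: "g \<in> Mor \<A>" "src \<A> g = X" "g = zer \<A> X (tgt \<A> g)" using assms by simp_all
    then have "zer \<A> Z (tgt \<A> g) \<cdot> zer \<A> X Z = g" using assms Z(1) by simp
    then show "\<exists>u. u \<in> Mor \<A> \<and> tgt \<A> u = tgt \<A> g \<and> src \<A> u = tgt \<A> (zer \<A> X Z) \<and> u \<cdot> zer \<A> X Z = g"
      using g Z(1) assms(2) by (intro exI[of _ "zer \<A> Z (tgt \<A> g)"]) simp
  qed (use assms Z in auto)
qed

lemma short_exact_idm_zer:
  assumes "is_zero_object \<A> Z" "X \<in> Obj \<A>"
  shows "is_short_exact \<A> (idm \<A> X) (zer \<A> X Z)" "is_short_exact \<A> (zer \<A> Z X) (idm \<A> X)"
  using kernel_idm_zer[OF assms] preadditive_category.kernel_idm_zer[OF preadditive_opc, of Z X] assms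
  by (simp_all add: is_short_exact_def)

lemma kernel_biproduct_inj:
  assumes "is_biproduct \<A> X Y S (i1, i2, p1, p2)" shows "is_kernel \<A> i1 p2"
proof (rule kernelI)
  note b = biproductD[OF assms]
  note bs = biproduct_simps[OF assms]
  have o: "X \<in> Obj \<A>" "Y \<in> Obj \<A>" using src_in_Obj[OF b(1)] src_in_Obj[OF b(4)] unfolding b(2,5) .
  show "i1 \<in> Mor \<A>" "p2 \<in> Mor \<A>" "tgt \<A> i1 = src \<A> p2" "p2 \<cdot> i1 = zer \<A> (src \<A> i1) (tgt \<A> p2)"
    using b by simp_all
  fix g assume g: "g \<in> Mor \<A>" "tgt \<A> g = src \<A> p2" "p2 \<cdot> g = zer \<A> (src \<A> g) (tgt \<A> p2)"
  have "i1 \<cdot> (p1 \<cdot> g) = g" using bs(5)[of g] g b(1-12) o by simp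
  then show "\<exists>u. u \<in> Mor \<A> \<and> src \<A> u = src \<A> g \<and> tgt \<A> u = src \<A> i1 \<and> i1 \<cdot> u = g"
    using g b(1-12) by (intro exI[of _ "p1 \<cdot> g"]) simp
next
  note b = biproductD[OF assms]
  note bs = biproduct_simps[OF assms]
  fix u assume u: "u \<in> Mor \<A>" "tgt \<A> u = src \<A> i1" "i1 \<cdot> u = zer \<A> (src \<A> u) (tgt \<A> i1)"
  then have "u = p1 \<cdot> (i1 \<cdot> u)" using bs(1)[of u] b(1-12) by simp
  also have "\<dots> = zer \<A> (src \<A> u) (src \<A> i1)" unfolding u(3) using u(1) b(1-12) by simp
  finally show "u = zer \<A> (src \<A> u) (src \<A> i1)" .
qed

lemma biproduct_swap:
  assumes "is_biproduct \<A> X Y S (i1, i2, p1, p2)" shows "is_biproduct \<A> Y X S (i2, i1, p2, p1)"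
proof -
  note b = biproductD[OF assms]
  have "i2 \<cdot> p2 \<boxplus> i1 \<cdot> p1 = idm \<A> S"
    unfolding b(17)[symmetric] by (rule add_commute) (use b(1-12) in simp_all)
  then show ?thesis using b(1-16) unfolding is_biproduct_def Hom_iff by simp
qed

lemma short_exact_biproduct_split:
  assumes "is_biproduct \<A> X Y S (i1, i2, p1, p2)" shows "is_short_exact \<A> i1 p2"
  using kernel_biproduct_inj[OF assms] biproduct_swap[OF assms]
    preadditive_category.kernel_biproduct_inj[OF preadditive_opc, of Y X S p2 p1 i2 i1]
  by (simp add: is_short_exact_def)

end

context extension_closed_subcategory
begin

lemma spliced_zero_tail:
  assumes "is_zero_object \<A> Z" "Z \<in> C" "A \<in> C"
  shows "spliced \<A> C Z (replicate k (zer \<A> Z Z, zer \<A> Z Z) @ [(zer \<A> Z A, idm \<A> A)]) A"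
proof -
  note Z = zero_objectD[OF assms(1)]
  \<comment> \<open>On a zero object the zero map is the identity, so the padding conflations are
    instances of the identity-zero conflation.\<close>
  have "zer \<A> Z Z = idm \<A> Z" using Z(2)[of "idm \<A> Z"] Z(1) by simp
  then have "conflation \<A> C (zer \<A> Z Z) (zer \<A> Z Z)"
    using short_exact_idm_zer(1)[OF assms(1) Z(1)] assms Z(1) by (simp add: conflation_def)
  moreover have "conflation \<A> C (zer \<A> Z A) (idm \<A> A)"
    using short_exact_idm_zer(2)[OF assms(1), of A] assms Z(1) by (simp add: conflation_def)
  ultimately show ?thesis using Z(1) assms by (induction k) simp_all
qed

lemma zero_seqs_spliced:
  assumes "\<zeta> \<in> zero_seqs \<A> C t A B" "A \<in> C" "B \<in> C"
  shows "spliced \<A> C B \<zeta> A" "length \<zeta> = t" "t \<noteq> 0"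
proof -
  have "spliced \<A> C B \<zeta> A \<and> length \<zeta> = t \<and> t \<noteq> 0"
  proof (cases t)
    case (Suc t')
    show ?thesis
    proof (cases t')
      case 0
      then obtain i1 i2 p1 p2 S where z: "\<zeta> = [(i1, p2)]" and b: "is_biproduct \<A> B A S (i1, i2, p1, p2)"
        using assms(1) Suc by auto
      have "is_short_exact \<A> i1 p2" by (rule short_exact_biproduct_split[OF b])
      then show ?thesis
        using biproductD[OF b] C_extension[of i1 p2] assms z Suc 0 by (simp add: conflation_def)
    next
      case (Suc k)
      then obtain Z where Z: "Z \<in> C" "is_zero_object \<A> Z" and
        z: "\<zeta> = [(idm \<A> B, zer \<A> B Z)] @ replicate k (zer \<A> Z Z, zer \<A> Z Z) @ [(zer \<A> Z A, idm \<A> A)]"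
        using assms(1) \<open>t = Suc t'\<close> by auto
      then show ?thesis
        using spliced_zero_tail[OF Z(2,1) assms(2), of k] short_exact_idm_zer(1)[OF Z(2), of B] assms Suc \<open>t = Suc t'\<close>
        by (simp add: conflation_def)
    qed
  qed (use assms in simp)
  then show "spliced \<A> C B \<zeta> A" "length \<zeta> = t" "t \<noteq> 0" by auto
qed

lemma ex_zero_seq:
  assumes "A \<in> C" "B \<in> C" "t \<noteq> 0"
  shows "\<exists>\<zeta>. \<zeta> \<in> zero_seqs \<A> C t A B"
proof -
  obtain t' where t: "t = Suc t'" using assms(3) by (cases t) auto
  obtain S i1 i2 p1 p2 where "is_biproduct \<A> B A S (i1, i2, p1, p2)"
    using C_biproduct[OF assms(2,1)] by auto
  moreover obtain Z where "Z \<in> C" "is_zero_object \<A> Z" using C_zero by blast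
  ultimately show ?thesis using t by (cases t') (simp, blast)+
qed

lemma zero_tail_map:
  assumes "is_zero_object \<A> Z" "Z \<in> C" "A \<in> C" "spliced \<A> C D \<rho> A'" "length \<rho> = Suc k"
  shows "seq_map \<A> (zer \<A> Z D) (replicate k (zer \<A> Z Z, zer \<A> Z Z) @ [(zer \<A> Z A, idm \<A> A)]) \<rho> (zer \<A> A A')"
  using assms(4,5)
proof (induction k arbitrary: D \<rho>)
  case 0
  then obtain j q where r: "\<rho> = [(j, q)]" and c: "conflation \<A> C j q" "src \<A> j = D" "tgt \<A> q = A'"
    by (cases \<rho>) auto
  note d = conflationD[OF c(1)]
  show ?case using r c(2,3) d(1-6) assms(2,3)
    by (simp, intro bexI[of _ "zer \<A> A (src \<A> q)"]) (simp_all add: Hom_iff)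
next
  case (Suc k)
  then obtain j q \<rho>' where r: "\<rho> = (j, q) # \<rho>'" and c: "conflation \<A> C j q" "src \<A> j = D" "spliced \<A> C (tgt \<A> q) \<rho>' A'"
    by (cases \<rho>) auto
  note d = conflationD[OF c(1)]
  show ?case unfolding r replicate_Suc append_Cons seq_map.simps
    using r c(2) d(1-6) assms(2,3) Suc.IH[OF c(3)] Suc.prems(2)
    by (intro bexI[of _ "zer \<A> Z (src \<A> q)"] bexI[of _ "zer \<A> Z (tgt \<A> q)"]) (simp_all add: Hom_iff)
qed

text \<open>The map can stop after \<open>j \<cdot> b\<close>, because \<open>q\<close> kills
  \<open>j\<close>; the later components are zero. This freedom on the left combined with zero on
  the right is what makes these sequences represent zero.\<close>

lemma zero_seqs_map:
  assumes "\<zeta> \<in> zero_seqs \<A> C t A B" "A \<in> C" "B \<in> C" "spliced \<A> C B' \<rho> A'" "length \<rho> = t" "b \<in> Hom \<A> B B'"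
  shows "seq_map \<A> b \<zeta> \<rho> (zer \<A> A A')"
proof -
  have "t \<noteq> 0" using zero_seqs_spliced(3)[OF assms(1-3)] .
  then obtain j q \<rho>' where r: "\<rho> = (j, q) # \<rho>'" and c: "conflation \<A> C j q" "src \<A> j = B'" "spliced \<A> C (tgt \<A> q) \<rho>' A'"
    using assms(4,5) by (cases \<rho>) auto
  note d = conflationD[OF c(1)]
  have b: "b \<in> Mor \<A>" "src \<A> b = B" "tgt \<A> b = B'" using assms(6) by (auto simp: Hom_iff)
  have qjb: "q \<cdot> (j \<cdot> b) = zer \<A> B (tgt \<A> q)" using cmp_eq[OF d(8), of b] d(1-6) b c(2) by simp
  show ?thesis
  proof (cases \<rho>')
    case Nil
    then obtain i1 i2 p1 p2 S where z: "\<zeta> = [(i1, p2)]" and bp: "is_biproduct \<A> B A S (i1, i2, p1, p2)"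
      using assms(1,5) r by auto
    note B = biproductD[OF bp]
    have S: "S \<in> Obj \<A>" using tgt_in_Obj[OF B(1)] B(3) by simp
    \<comment> \<open>In length 1 the middle term is a biproduct, and the component is
      \<open>j \<cdot> b\<close> on the first summand and zero on the second.\<close>
    have "q \<cdot> (j \<cdot> (b \<cdot> p1)) = zer \<A> S (tgt \<A> q)"
      using cmp_eq[OF d(8), of "b \<cdot> p1"] d(1-6) b c(2) B by simp
    then show ?thesis using z r Nil c(2,3) d(1-6) b B(1-16) S assms(2,3)
      by (simp, intro bexI[of _ "j \<cdot> (b \<cdot> p1)"]) (simp_all add: Hom_iff)
  next
    case (Cons jq \<rho>'')
    define k where "k = length \<rho>''"
    have tk: "t = Suc (Suc k)" using assms(5) r Cons by (simp add: k_def)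
    then obtain Z where Z: "Z \<in> C" "is_zero_object \<A> Z" and
      z: "\<zeta> = (idm \<A> B, zer \<A> B Z) # replicate k (zer \<A> Z Z, zer \<A> Z Z) @ [(zer \<A> Z A, idm \<A> A)]"
      using assms(1) by auto
    have "seq_map \<A> (zer \<A> Z (tgt \<A> q)) (replicate k (zer \<A> Z Z, zer \<A> Z Z) @ [(zer \<A> Z A, idm \<A> A)]) \<rho>' (zer \<A> A A')"
      by (rule zero_tail_map[OF Z(2,1) assms(2) c(3)]) (simp add: Cons k_def)
    then show ?thesis unfolding z r seq_map.simps using qjb c(2) d(1-6) b Z(1) assms(3)
      by (intro bexI[of _ "j \<cdot> b"] bexI[of _ "zer \<A> Z (tgt \<A> q)"]) (simp_all add: Hom_iff)
  qed
qed

end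

section \<open>Exactness at the connecting homomorphism\<close>

context extension_closed_subcategory
begin

text \<open>A pair \<open>(\<rho>, s)\<close> stands for the pull-back of \<open>\<rho>\<close> along \<open>s\<close>. With \<open>\<rho> = []\<close> it is the morphism \<open>s\<close>,
  so degree \<open>0\<close> needs no separate treatment.\<close>

definition ext_rep :: "'a \<Rightarrow> 'a \<Rightarrow> 'b seq \<Rightarrow> 'b \<Rightarrow> bool" where
  "ext_rep Z B \<rho> s \<longleftrightarrow> s \<in> Mor \<A> \<and> src \<A> s = Z \<and> tgt \<A> s \<in> C \<and> spliced \<A> C B \<rho> (tgt \<A> s)"

text \<open>Such data witness that the push-out along \<open>b\<close> of the class given by
  \<open>(\<rho>, s)\<close> is the class given by \<open>(\<rho>', s')\<close>, with the right end
  held fixed.\<close>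

definition ext_map :: "'b \<Rightarrow> 'b seq \<Rightarrow> 'b \<Rightarrow> 'b seq \<Rightarrow> 'b \<Rightarrow> bool" where
  "ext_map b \<rho> s \<rho>' s' \<longleftrightarrow> (\<exists>d. seq_map \<A> b \<rho> \<rho>' d \<and> d \<in> Hom \<A> (tgt \<A> s) (tgt \<A> s') \<and> d \<cdot> s = s')"

lemma ext_repD:
  assumes "ext_rep Z B \<rho> s"
  shows "s \<in> Mor \<A>" "src \<A> s = Z" "tgt \<A> s \<in> C" "spliced \<A> C B \<rho> (tgt \<A> s)" "B \<in> C" "Z \<in> Obj \<A>"
  using assms spliced_C(1)[of \<A> C B \<rho> "tgt \<A> s"] by (auto simp: ext_rep_def)

lemma ext_map_length: "ext_map b \<rho> s \<rho>' s' \<Longrightarrow> length \<rho>' = length \<rho>"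
  by (auto simp: ext_map_def dest: seq_map_length)

lemma ext_map_trans:
  assumes "ext_map b \<rho> s \<rho>' s'" "ext_map b' \<rho>' s' \<rho>'' s''" "ext_rep Z B \<rho> s" "ext_rep Z B' \<rho>' s'" "ext_rep Z B'' \<rho>'' s''"
    "b \<in> Hom \<A> B B'" "b' \<in> Hom \<A> B' B''"
  shows "ext_map (b' \<cdot> b) \<rho> s \<rho>'' s''"
proof -
  note g = ext_repD[OF assms(3)] and g' = ext_repD[OF assms(4)] and g'' = ext_repD[OF assms(5)]
  obtain d where d: "seq_map \<A> b \<rho> \<rho>' d" "d \<in> Hom \<A> (tgt \<A> s) (tgt \<A> s')" "d \<cdot> s = s'"
    using assms(1) by (auto simp: ext_map_def)
  obtain d' where d': "seq_map \<A> b' \<rho>' \<rho>'' d'" "d' \<in> Hom \<A> (tgt \<A> s') (tgt \<A> s'')" "d' \<cdot> s' = s''"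
    using assms(2) by (auto simp: ext_map_def)
  have "seq_map \<A> (b' \<cdot> b) \<rho> \<rho>'' (d' \<cdot> d)"
    by (rule seq_map_trans[OF d(1) d'(1) g(4) g'(4) g''(4) assms(6,7)])
  moreover have "d' \<cdot> d \<cdot> s = s''" "d' \<cdot> d \<in> Hom \<A> (tgt \<A> s) (tgt \<A> s'')"
    using d(2,3) d'(2,3) g by (auto simp: Hom_iff)
  ultimately show ?thesis unfolding ext_map_def by blast
qed

text \<open>Composition in degree 0 and push-out in positive degree are given one common universal
  property, so that later arguments can push forward uniformly in the degree.\<close>

lemma ext_map_push:
  assumes "ext_rep Z B \<rho> s" "g \<in> Hom \<A> B B'" "B' \<in> C"
  obtains \<rho>' s' where "ext_rep Z B' \<rho>' s'" "ext_map g \<rho> s \<rho>' s'" "length \<rho>' = length \<rho>"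
    "\<And>h \<tau> \<sigma> B''. h \<in> Hom \<A> B' B'' \<Longrightarrow> ext_rep Z B'' \<tau> \<sigma> \<Longrightarrow> ext_map (h \<cdot> g) \<rho> s \<tau> \<sigma> \<Longrightarrow> ext_map h \<rho>' s' \<tau> \<sigma>"
proof (cases "\<rho> = []")
  case True
  note g = ext_repD[OF assms(1)]
  have s: "tgt \<A> s = B" using g(4) True by simp
  show ?thesis
  proof (rule that[of "[]" "g \<cdot> s"])
    show "ext_rep Z B' [] (g \<cdot> s)" using g s assms by (auto simp: ext_rep_def Hom_iff)
    show "ext_map g \<rho> s [] (g \<cdot> s)" using g s assms True by (auto simp: ext_map_def Hom_iff)
    show "ext_map h [] (g \<cdot> s) \<tau> \<sigma>" if "h \<in> Hom \<A> B' B''" "ext_rep Z B'' \<tau> \<sigma>" "ext_map (h \<cdot> g) \<rho> s \<tau> \<sigma>" for h \<tau> \<sigma> B''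
    proof -
      have "\<tau> = []" using ext_map_length[OF that(3)] True by simp
      then show ?thesis using that g s assms True by (auto simp: ext_map_def Hom_iff)
    qed
  qed (simp add: True)
next
  case False
  note g = ext_repD[OF assms(1)]
  obtain \<rho>' where po: "seq_pushout \<A> g \<rho> \<rho>'" using ex_seq_pushout[OF g(4) False assms(2,3)] .
  note P = seq_pushoutD[OF g(4) po assms(2,3)]
  show ?thesis
  proof (rule that[of \<rho>' s])
    show "ext_rep Z B' \<rho>' s" using g P by (simp add: ext_rep_def)
    show "ext_map g \<rho> s \<rho>' s" using g P by (auto simp: ext_map_def Hom_iff)
    show "ext_map h \<rho>' s \<tau> \<sigma>" if "h \<in> Hom \<A> B' B''" "ext_rep Z B'' \<tau> \<sigma>" "ext_map (h \<cdot> g) \<rho> s \<tau> \<sigma>" for h \<tau> \<sigma> B''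
      using that(3) seq_pushout_map[OF g(4) po assms(2,3) that(1) ext_repD(4)[OF that(2)]]
      unfolding ext_map_def by blast
  qed (rule P)
qed

text \<open>The zero classes, generated from zero right-hand maps by zigzags that fix both ends. The
  inductive form lets exactness be proved arrow by arrow, and it covers degree 0 as well as right
  ends \<open>Z\<close> outside \<open>C\<close>.\<close>

inductive null :: "'a \<Rightarrow> 'a \<Rightarrow> 'b seq \<Rightarrow> 'b \<Rightarrow> bool" for Z B where
  null_zer: "spliced \<A> C B \<rho> A \<Longrightarrow> A \<in> C \<Longrightarrow> Z \<in> Obj \<A> \<Longrightarrow> null Z B \<rho> (zer \<A> Z A)"
| null_fwd: "null Z B \<rho> s \<Longrightarrow> ext_rep Z B \<rho> s \<Longrightarrow> ext_rep Z B \<rho>' s' \<Longrightarrow> ext_map (idm \<A> B) \<rho> s \<rho>' s' \<Longrightarrow> null Z B \<rho>' s'"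
| null_bwd: "null Z B \<rho>' s' \<Longrightarrow> ext_rep Z B \<rho> s \<Longrightarrow> ext_rep Z B \<rho>' s' \<Longrightarrow> ext_map (idm \<A> B) \<rho> s \<rho>' s' \<Longrightarrow> null Z B \<rho> s"

lemma null_ext_rep: "null Z B \<rho> s \<Longrightarrow> ext_rep Z B \<rho> s"
  by (induction rule: null.induct) (auto simp: ext_rep_def)

lemma ext_map_Nil: "ext_map b [] s [] s' \<longleftrightarrow> b \<in> Hom \<A> (tgt \<A> s) (tgt \<A> s') \<and> b \<cdot> s = s'"
  by (simp add: ext_map_def)

text \<open>Over the empty sequence every arrow of a zigzag is an identity, so the right-hand map
  never changes.\<close>

lemma null_Nil:
  assumes "null Z B [] s" shows "s = zer \<A> Z B"
proof -
  have "\<rho> = [] \<Longrightarrow> s = zer \<A> Z B" if "null Z B \<rho> s" for \<rho>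
    using that
  proof (induction rule: null.induct)
    case (null_fwd \<rho> s \<rho>' s')
    have "\<rho> = []" using ext_map_length[OF null_fwd.hyps(4)] null_fwd.prems by simp
    then have "idm \<A> B \<cdot> s = s'" "s \<in> Mor \<A>" "tgt \<A> s = B" "s = zer \<A> Z B"
      using null_fwd.hyps(2,4) null_fwd.IH null_fwd.prems by (simp_all add: ext_map_Nil ext_rep_def)
    then show ?case by (metis idm_cmp')
  next
    case (null_bwd \<rho>' s' \<rho> s)
    have "\<rho>' = []" using ext_map_length[OF null_bwd.hyps(4)] null_bwd.prems by simp
    then have "idm \<A> B \<cdot> s = s'" "s \<in> Mor \<A>" "tgt \<A> s = B" "s' = zer \<A> Z B"
      using null_bwd.hyps(2,4) null_bwd.IH null_bwd.prems by (simp_all add: ext_map_Nil ext_rep_def)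
    then show ?case by (metis idm_cmp')
  qed simp
  then show ?thesis using assms by blast
qed

lemma null_push:
  assumes "null Z B \<rho> s" "ext_map g \<rho> s \<tau> \<sigma>" "ext_rep Z B' \<tau> \<sigma>" "g \<in> Hom \<A> B B'"
  shows "null Z B' \<tau> \<sigma>"
  using assms
proof (induction arbitrary: \<tau> \<sigma> rule: null.induct)
  case (null_zer \<rho> A)
  obtain d where d': "d \<in> Hom \<A> (tgt \<A> (zer \<A> Z A)) (tgt \<A> \<sigma>)" "d \<cdot> zer \<A> Z A = \<sigma>"
    using null_zer(4) unfolding ext_map_def by blast
  then have d: "d \<in> Mor \<A>" "src \<A> d = A" "tgt \<A> d = tgt \<A> \<sigma>" "d \<cdot> zer \<A> Z A = \<sigma>"
    using null_zer(2,3) unfolding Hom_iff by simp_all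
  have "\<sigma> = zer \<A> Z (tgt \<A> \<sigma>)" using d(4) cmp_zer[OF d(1,2) null_zer(3)] unfolding d(3) by simp
  moreover have "null Z B' \<tau> (zer \<A> Z (tgt \<A> \<sigma>))"
    by (rule null.null_zer) (use ext_repD[OF null_zer(5)] in auto)
  ultimately show ?case by simp
next
  case (null_fwd \<rho> s \<rho>' s')
  have B: "B \<in> C" by (rule ext_repD(5)[OF null_fwd(2)])
  have "ext_map (g \<cdot> idm \<A> B) \<rho> s \<tau> \<sigma>"
    by (rule ext_map_trans[OF null_fwd.hyps(4) null_fwd.prems(1) null_fwd.hyps(2,3) null_fwd.prems(2) _ null_fwd.prems(3)])
      (use B in \<open>simp add: Hom_iff\<close>)
  then have "ext_map g \<rho> s \<tau> \<sigma>" using null_fwd.prems(3) by (simp add: Hom_iff)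
  then show ?case using null_fwd.IH null_fwd.prems by blast
next
  case (null_bwd \<rho>' s' \<rho> s)
  have B: "B \<in> C" by (rule ext_repD(5)[OF null_bwd.hyps(2)])
  have B': "B' \<in> C" by (rule ext_repD(5)[OF null_bwd.prems(2)])
  have g: "g \<in> Mor \<A>" "src \<A> g = B" "tgt \<A> g = B'" "g \<cdot> idm \<A> B = g" "idm \<A> B' \<cdot> g = g"
    using null_bwd.prems(3) by (auto simp: Hom_iff)
  \<comment> \<open>The zigzag arrow and the map to \<open>(\<tau>, \<sigma>)\<close> both leave
    \<open>(\<rho>, s)\<close>, so they do not compose. Pushing both ends of the arrow out along
    \<open>g\<close> turns the configuration into a zigzag over \<open>B'\<close>.\<close>
  obtain \<rho>1 s1 where 1: "ext_rep Z B' \<rho>1 s1" "ext_map g \<rho> s \<rho>1 s1"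
    "\<And>h \<tau> \<sigma> B''. h \<in> Hom \<A> B' B'' \<Longrightarrow> ext_rep Z B'' \<tau> \<sigma> \<Longrightarrow> ext_map (h \<cdot> g) \<rho> s \<tau> \<sigma> \<Longrightarrow> ext_map h \<rho>1 s1 \<tau> \<sigma>"
    using ext_map_push[OF null_bwd.hyps(2) null_bwd.prems(3) B'] by metis
  obtain \<rho>2 s2 where 2: "ext_rep Z B' \<rho>2 s2" "ext_map g \<rho>' s' \<rho>2 s2"
    using ext_map_push[OF null_bwd.hyps(3) null_bwd.prems(3) B'] by metis
  have i: "idm \<A> B' \<in> Hom \<A> B' B'" "idm \<A> B \<in> Hom \<A> B B" using B B' by (simp_all add: Hom_iff)
  have "ext_map (g \<cdot> idm \<A> B) \<rho> s \<rho>2 s2"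
    by (rule ext_map_trans[OF null_bwd.hyps(4) 2(2) null_bwd.hyps(2,3) 2(1) i(2) null_bwd.prems(3)])
  then have "ext_map (idm \<A> B') \<rho>1 s1 \<rho>2 s2"
    using 1(3)[OF i(1) 2(1)] g(4,5) by simp
  moreover have "null Z B' \<rho>2 s2" using null_bwd.IH 2 null_bwd.prems(3) by blast
  ultimately have "null Z B' \<rho>1 s1" using null.null_bwd 1(1) 2(1) by blast
  moreover have "ext_map (idm \<A> B') \<rho>1 s1 \<tau> \<sigma>" using 1(3)[OF i(1) null_bwd.prems(2)] null_bwd.prems(1) g(5) by simp
  ultimately show ?case using null.null_fwd 1(1) null_bwd.prems(2) by blast
qed

lemma ext_rep_pull: "ext_rep Z B \<rho> s \<Longrightarrow> t \<in> Hom \<A> Z' Z \<Longrightarrow> ext_rep Z' B \<rho> (s \<cdot> t)"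
  by (auto simp: ext_rep_def Hom_iff)

lemma ext_map_pull:
  assumes "ext_map b \<rho> s \<rho>' s'" "ext_rep Z B \<rho> s" "t \<in> Hom \<A> Z' Z"
  shows "ext_map b \<rho> (s \<cdot> t) \<rho>' (s' \<cdot> t)"
proof -
  obtain d where d: "seq_map \<A> b \<rho> \<rho>' d" "d \<in> Hom \<A> (tgt \<A> s) (tgt \<A> s')" "d \<cdot> s = s'"
    using assms(1) by (auto simp: ext_map_def)
  moreover have "d \<cdot> (s \<cdot> t) = s' \<cdot> t"
    using cmp_eq[OF d(3), of t] d(2) assms(2,3) by (simp add: Hom_iff ext_rep_def)
  moreover have "tgt \<A> (s \<cdot> t) = tgt \<A> s" "tgt \<A> (s' \<cdot> t) = tgt \<A> s'"
    using d(2,3) assms(2,3) by (auto simp: Hom_iff ext_rep_def)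
  ultimately show ?thesis unfolding ext_map_def by auto
qed

text \<open>A pull-back only composes the right-hand map with \<open>t\<close>, so a zigzag is
  carried over arrow by arrow.\<close>

lemma null_pull: "null Z B \<rho> s \<Longrightarrow> t \<in> Hom \<A> Z' Z \<Longrightarrow> null Z' B \<rho> (s \<cdot> t)"
proof (induction rule: null.induct)
  case (null_zer \<rho> A)
  have "zer \<A> Z A \<cdot> t = zer \<A> Z' A" "Z' \<in> Obj \<A>" using null_zer by (auto simp: Hom_iff)
  then show ?case using null.null_zer[of B \<rho> A Z'] null_zer by simp
next
  case (null_fwd \<rho> s \<rho>' s')
  show ?case
    by (rule null.null_fwd[OF null_fwd.IH[OF null_fwd.prems] ext_rep_pull[OF null_fwd.hyps(2) null_fwd.prems]
      ext_rep_pull[OF null_fwd.hyps(3) null_fwd.prems] ext_map_pull[OF null_fwd.hyps(4,2) null_fwd.prems]])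
next
  case (null_bwd \<rho>' s' \<rho> s)
  show ?case
    by (rule null.null_bwd[OF null_bwd.IH[OF null_bwd.prems] ext_rep_pull[OF null_bwd.hyps(2) null_bwd.prems]
      ext_rep_pull[OF null_bwd.hyps(3) null_bwd.prems] ext_map_pull[OF null_bwd.hyps(4,2) null_bwd.prems]])
qed

lemma seq_map_neg:
  assumes "seq_map \<A> b \<xi> \<zeta> a" "spliced \<A> C B \<xi> A" "spliced \<A> C B' \<zeta> A'" "b \<in> Hom \<A> B B'"
  shows "seq_map \<A> (neg b) \<xi> \<zeta> (neg a)"
  using assms
proof (induction \<xi> arbitrary: \<zeta> b B B')
  case Nil
  then show ?case by (cases \<zeta>) auto
next
  case (Cons ip \<xi>)
  obtain i p where ip: "ip = (i, p)" by force
  obtain j q \<zeta>' where z: "\<zeta> = (j, q) # \<zeta>'" using Cons.prems(1) ip by (cases \<zeta>) auto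
  obtain x c where x: "x \<in> Hom \<A> (tgt \<A> i) (tgt \<A> j)" "c \<in> Hom \<A> (tgt \<A> p) (tgt \<A> q)" "x \<cdot> i = j \<cdot> b" "c \<cdot> p = q \<cdot> x"
    "seq_map \<A> c \<xi> \<zeta>' a"
    using Cons.prems(1) ip z by auto
  have sp: "conflation \<A> C i p" "src \<A> i = B" "spliced \<A> C (tgt \<A> p) \<xi> A"
    "conflation \<A> C j q" "src \<A> j = B'" "spliced \<A> C (tgt \<A> q) \<zeta>' A'"
    using Cons.prems ip z by auto
  note D = conflationD(1-3)[OF sp(1)] conflationD(1-3)[OF sp(4)]
  show ?case unfolding ip z seq_map.simps
    using Cons.IH[OF x(5) sp(3,6) x(2)] x(1-4) D sp(2,5) Cons.prems(4)
    by (intro bexI[of _ "neg x"] bexI[of _ "neg c"]) (simp_all add: Hom_iff)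
qed

text \<open>The left biproduct is prescribed and the right one is produced, because the induction
  runs from the left and each splicing biproduct becomes the left end of what remains. The last
  property is the copairing of two morphisms out of the sum.\<close>

lemma seq_biproduct:
  assumes "spliced \<A> C B \<rho> A" "spliced \<A> C B' \<rho>' A'" "length \<rho> = length \<rho>'"
    "A \<in> C" "A' \<in> C" "is_biproduct \<A> B B' S (i1, i2, p1, p2)" "S \<in> C"
  obtains \<sigma> T k1 k2 q1 q2 where "spliced \<A> C S \<sigma> T" "is_biproduct \<A> A A' T (k1, k2, q1, q2)" "T \<in> C"
    "length \<sigma> = length \<rho>" "seq_map \<A> p2 \<sigma> \<rho>' q2"
    "\<And>f1 f2 \<tau> D E d1 d2. \<lbrakk>f1 \<in> Hom \<A> B D; f2 \<in> Hom \<A> B' D; spliced \<A> C D \<tau> E; seq_map \<A> f1 \<rho> \<tau> d1; seq_map \<A> f2 \<rho>' \<tau> d2\<rbrakk>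
      \<Longrightarrow> seq_map \<A> (f1 \<cdot> p1 \<boxplus> f2 \<cdot> p2) \<sigma> \<tau> (d1 \<cdot> q1 \<boxplus> d2 \<cdot> q2)"
  using assms
proof (induction \<rho> arbitrary: \<rho>' B B' S i1 i2 p1 p2 thesis)
  case Nil
  have e: "\<rho>' = []" "B = A" "B' = A'" using Nil.prems by auto
  show ?case
  proof (rule Nil.prems(1)[of "[]" S i1 i2 p1 p2])
    fix f1 f2 \<tau> D E d1 d2
    assume "seq_map \<A> f1 [] \<tau> d1" "seq_map \<A> f2 \<rho>' \<tau> d2"
    then show "seq_map \<A> (f1 \<cdot> p1 \<boxplus> f2 \<cdot> p2) [] \<tau> (d1 \<cdot> p1 \<boxplus> d2 \<cdot> p2)"
      using e by (cases \<tau>) auto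
  qed (use Nil.prems e in auto)
next
  case (Cons ip \<rho>)
  obtain i p where ip: "ip = (i, p)" by force
  obtain j q \<rho>'' where r: "\<rho>' = (j, q) # \<rho>''" using Cons.prems(4) by (cases \<rho>') auto
  have sp: "conflation \<A> C i p" "src \<A> i = B" "spliced \<A> C (tgt \<A> p) \<rho> A"
    "conflation \<A> C j q" "src \<A> j = B'" "spliced \<A> C (tgt \<A> q) \<rho>'' A'"
    using Cons.prems ip r by auto
  note D = conflationD[OF sp(1)] conflationD[OF sp(4)]
  obtain X xi1 xi2 xp1 xp2 where X: "X \<in> C" "is_biproduct \<A> (tgt \<A> i) (tgt \<A> j) X (xi1, xi2, xp1, xp2)"
    using C_biproduct[of "tgt \<A> i" "tgt \<A> j"] D(3,5,11,13) by auto
  obtain L ci1 ci2 cp1 cp2 where L: "L \<in> C" "is_biproduct \<A> (tgt \<A> p) (tgt \<A> q) L (ci1, ci2, cp1, cp2)"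
    using C_biproduct[of "tgt \<A> p" "tgt \<A> q"] D(6,14) by auto
  have bp: "is_biproduct \<A> (src \<A> i) (src \<A> j) S (i1, i2, p1, p2)" using Cons.prems(7) sp by simp
  note b = biproductD(1-12)[OF bp] biproductD(1-12)[OF X(2)] biproductD(1-12)[OF L(2)]
  note bs = biproduct_simps[OF bp] biproduct_simps[OF X(2)] biproduct_simps[OF L(2)]
  note T = D(1-3,9-11) b
  define k where "k = xi1 \<cdot> (i \<cdot> p1) \<boxplus> xi2 \<cdot> (j \<cdot> p2)"
  define l where "l = ci1 \<cdot> (p \<cdot> xp1) \<boxplus> ci2 \<cdot> (q \<cdot> xp2)"
  have kl: "k \<in> Mor \<A>" "src \<A> k = S" "tgt \<A> k = X" "l \<in> Mor \<A>" "src \<A> l = X" "tgt \<A> l = L"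
    using T by (simp_all add: k_def l_def)
  have xk: "xp1 \<cdot> k = i \<cdot> p1" "xp2 \<cdot> k = j \<cdot> p2" "cp1 \<cdot> l = p \<cdot> xp1" "cp2 \<cdot> l = q \<cdot> xp2"
    using T by (simp_all add: k_def l_def bs)
  have se: "is_short_exact \<A> k l"
    unfolding k_def l_def by (rule short_exact_biproduct[OF D(7,15) bp X(2) L(2)])
  have c: "conflation \<A> C k l" using se kl X L Cons.prems(8) by (simp add: conflation_def)
  obtain \<sigma> T k1 k2 q1 q2 where s: "spliced \<A> C L \<sigma> T" "is_biproduct \<A> A A' T (k1, k2, q1, q2)" "T \<in> C"
    "length \<sigma> = length \<rho>" "seq_map \<A> cp2 \<sigma> \<rho>'' q2"
    "\<And>f1 f2 \<tau> D E d1 d2. \<lbrakk>f1 \<in> Hom \<A> (tgt \<A> p) D; f2 \<in> Hom \<A> (tgt \<A> q) D; spliced \<A> C D \<tau> E; seq_map \<A> f1 \<rho> \<tau> d1; seq_map \<A> f2 \<rho>'' \<tau> d2\<rbrakk>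
      \<Longrightarrow> seq_map \<A> (f1 \<cdot> cp1 \<boxplus> f2 \<cdot> cp2) \<sigma> \<tau> (d1 \<cdot> q1 \<boxplus> d2 \<cdot> q2)"
    by (rule Cons.IH[OF _ sp(3,6) _ Cons.prems(5,6) L(2,1)]) (use Cons.prems(4) r in auto)
  show ?case
  proof (rule Cons.prems(1)[of "(k, l) # \<sigma>" T k1 k2 q1 q2])
    show "seq_map \<A> p2 ((k, l) # \<sigma>) \<rho>' q2" unfolding r seq_map.simps
      using xk s(5) kl T by (intro bexI[of _ xp2] bexI[of _ cp2]) (simp_all add: Hom_iff)
    fix f1 f2 \<tau> D E d1 d2
    assume f: "f1 \<in> Hom \<A> B D" "f2 \<in> Hom \<A> B' D" and t: "spliced \<A> C D \<tau> E" "seq_map \<A> f1 (ip # \<rho>) \<tau> d1" "seq_map \<A> f2 \<rho>' \<tau> d2"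
    obtain m r' \<tau>' where \<tau>: "\<tau> = (m, r') # \<tau>'" using t(2) ip by (cases \<tau>) auto
    obtain x c where x: "x \<in> Hom \<A> (tgt \<A> i) (tgt \<A> m)" "c \<in> Hom \<A> (tgt \<A> p) (tgt \<A> r')" "x \<cdot> i = m \<cdot> f1" "c \<cdot> p = r' \<cdot> x"
      "seq_map \<A> c \<rho> \<tau>' d1" using t(2) ip \<tau> by auto
    obtain y d where y: "y \<in> Hom \<A> (tgt \<A> j) (tgt \<A> m)" "d \<in> Hom \<A> (tgt \<A> q) (tgt \<A> r')" "y \<cdot> j = m \<cdot> f2" "d \<cdot> q = r' \<cdot> y"
      "seq_map \<A> d \<rho>'' \<tau>' d2" using t(3) r \<tau> by auto
    have tc: "conflation \<A> C m r'" "src \<A> m = D" "spliced \<A> C (tgt \<A> r') \<tau>' E" using t(1) \<tau> by auto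
    note M = conflationD(1-3)[OF tc(1)]
    have F: "f1 \<in> Mor \<A>" "src \<A> f1 = src \<A> i" "tgt \<A> f1 = D" "f2 \<in> Mor \<A>" "src \<A> f2 = src \<A> j" "tgt \<A> f2 = D"
      using f sp by (auto simp: Hom_iff)
    have XY: "x \<in> Mor \<A>" "src \<A> x = src \<A> p" "tgt \<A> x = src \<A> r'" "y \<in> Mor \<A>" "src \<A> y = src \<A> q" "tgt \<A> y = src \<A> r'"
      "c \<in> Mor \<A>" "src \<A> c = tgt \<A> p" "tgt \<A> c = tgt \<A> r'" "d \<in> Mor \<A>" "src \<A> d = tgt \<A> q" "tgt \<A> d = tgt \<A> r'"
      using x(1,2) y(1,2) T M by (auto simp: Hom_iff)
    have "(x \<cdot> xp1 \<boxplus> y \<cdot> xp2) \<cdot> k = m \<cdot> (f1 \<cdot> p1 \<boxplus> f2 \<cdot> p2)"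
      using XY T kl xk F M tc(2) cmp_eq[OF x(3), of p1] cmp_eq[OF y(3), of p2] by simp
    moreover have "(c \<cdot> cp1 \<boxplus> d \<cdot> cp2) \<cdot> l = r' \<cdot> (x \<cdot> xp1 \<boxplus> y \<cdot> xp2)"
      using XY T kl xk F M tc(2) cmp_eq[OF x(4), of xp1] cmp_eq[OF y(4), of xp2] by simp
    moreover have "seq_map \<A> (c \<cdot> cp1 \<boxplus> d \<cdot> cp2) \<sigma> \<tau>' (d1 \<cdot> q1 \<boxplus> d2 \<cdot> q2)"
      by (rule s(6)[OF x(2) y(2) tc(3) x(5) y(5)])
    ultimately show "seq_map \<A> (f1 \<cdot> p1 \<boxplus> f2 \<cdot> p2) ((k, l) # \<sigma>) \<tau> (d1 \<cdot> q1 \<boxplus> d2 \<cdot> q2)"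
      unfolding \<tau> seq_map.simps using XY T kl M
      by (intro bexI[of _ "x \<cdot> xp1 \<boxplus> y \<cdot> xp2"] bexI[of _ "c \<cdot> cp1 \<boxplus> d \<cdot> cp2"]) (simp_all add: Hom_iff)
  qed (use c kl s in auto)
qed


text \<open>The right square is a pull-back, so \<open>src \<A> p\<close> is the left end of a
  conflation through the biproduct of \<open>src \<A> q\<close> and \<open>tgt \<A> p\<close>, with
  the difference of \<open>q\<close> and \<open>c\<close> as deflation. The two given classes agree
  over \<open>tgt \<A> q\<close>, so this difference kills their direct sum; middle exactness lifts
  the sum to \<open>src \<A> p\<close>, and the second projection returns
  \<open>(\<rho>, s)\<close>.\<close>

lemma exact_along_pullback:
  assumes q: "conflation \<A> C i p" "conflation \<A> C j q" "src \<A> i = src \<A> j"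
    and x: "x \<in> Hom \<A> (tgt \<A> i) (tgt \<A> j)" "x \<cdot> i = j"
    and c: "c \<in> Hom \<A> (tgt \<A> p) (tgt \<A> q)" "c \<cdot> p = q \<cdot> x"
    and y: "ext_rep Z (src \<A> q) y u" "ext_map q y u \<rho>' s'" and r: "ext_rep Z (tgt \<A> p) \<rho> s" "ext_map c \<rho> s \<rho>' s'"
    and r': "ext_rep Z (tgt \<A> q) \<rho>' s'"
    and exact: "\<And>i p \<rho> s \<tau> \<sigma>. \<lbrakk>conflation \<A> C i p; length \<rho> = length \<rho>'; ext_rep Z (src \<A> p) \<rho> s; null Z (tgt \<A> p) \<tau> \<sigma>; ext_map p \<rho> s \<tau> \<sigma>\<rbrakk>
      \<Longrightarrow> \<exists>\<kappa> u. ext_rep Z (src \<A> i) \<kappa> u \<and> ext_map i \<kappa> u \<rho> s"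
  shows "\<exists>y u. ext_rep Z (src \<A> p) y u \<and> ext_map p y u \<rho> s"
proof -
  note D = conflationD[OF q(1)] conflationD[OF q(2)]
  note gy = ext_repD[OF y(1)] and gr = ext_repD[OF r(1)] and gr' = ext_repD[OF r'(1)]
  have X: "x \<in> Mor \<A>" "src \<A> x = src \<A> p" "tgt \<A> x = src \<A> q" "c \<in> Mor \<A>" "src \<A> c = tgt \<A> p" "tgt \<A> c = tgt \<A> q"
    using x c D by (simp_all add: Hom_iff)
  have pb: "is_pullback \<A> q c x p"
    by (rule short_exact_pullback[OF D(7,15)]) (use X D(3,11) q(3) x(2) c(2) in simp_all)
  obtain S i1 i2 p1 p2 where S: "S \<in> C" "is_biproduct \<A> (src \<A> q) (tgt \<A> p) S (i1, i2, p1, p2)"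
    using C_biproduct[of "src \<A> q" "tgt \<A> p"] D(6,13) by auto
  note b = biproductD(1-12)[OF S(2)] and bs = biproduct_simps[OF S(2)]
  have len: "length y = length \<rho>'" "length \<rho> = length \<rho>'" using ext_map_length y(2) r(2) by metis+
  obtain \<sigma> T k1 k2 q1 q2 where s: "spliced \<A> C S \<sigma> T" "is_biproduct \<A> (tgt \<A> u) (tgt \<A> s) T (k1, k2, q1, q2)" "T \<in> C"
    "length \<sigma> = length y" "seq_map \<A> p2 \<sigma> \<rho> q2"
    "\<And>f1 f2 \<tau> D E d1 d2. \<lbrakk>f1 \<in> Hom \<A> (src \<A> q) D; f2 \<in> Hom \<A> (tgt \<A> p) D; spliced \<A> C D \<tau> E; seq_map \<A> f1 y \<tau> d1; seq_map \<A> f2 \<rho> \<tau> d2\<rbrakk>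
      \<Longrightarrow> seq_map \<A> (f1 \<cdot> p1 \<boxplus> f2 \<cdot> p2) \<sigma> \<tau> (d1 \<cdot> q1 \<boxplus> d2 \<cdot> q2)"
    by (rule seq_biproduct[OF gy(4) gr(4) _ gy(3) gr(3) S(2,1)]) (use len in auto)
  note bT = biproductD(1-12)[OF s(2)] and bsT = biproduct_simps[OF s(2)]
  \<comment> \<open>The direct sum has a biproduct as right end; the map with components
    \<open>u\<close> and \<open>s\<close> brings it back to \<open>Z\<close>.\<close>
  define v where "v = k1 \<cdot> u \<boxplus> k2 \<cdot> s"
  have v: "v \<in> Mor \<A>" "src \<A> v = Z" "tgt \<A> v = T" "q1 \<cdot> v = u" "q2 \<cdot> v = s"
    using gy(1-3,6) gr(1-3,6) bT by (simp_all add: v_def bsT)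
  have gv: "ext_rep Z S \<sigma> v" using v s by (simp add: ext_rep_def)
  obtain d1 where d1: "seq_map \<A> q y \<rho>' d1" "d1 \<in> Hom \<A> (tgt \<A> u) (tgt \<A> s')" "d1 \<cdot> u = s'"
    using y(2) by (auto simp: ext_map_def)
  obtain d2 where d2: "seq_map \<A> c \<rho> \<rho>' d2" "d2 \<in> Hom \<A> (tgt \<A> s) (tgt \<A> s')" "d2 \<cdot> s = s'"
    using r(2) by (auto simp: ext_map_def)
  have dT: "d1 \<in> Mor \<A>" "src \<A> d1 = tgt \<A> u" "tgt \<A> d1 = tgt \<A> s'" "d2 \<in> Mor \<A>" "src \<A> d2 = tgt \<A> s" "tgt \<A> d2 = tgt \<A> s'"
    using d1(2) d2(2) by (auto simp: Hom_iff)
  let ?k = "i1 \<cdot> x \<boxplus> i2 \<cdot> p" and ?f = "q \<cdot> p1 \<boxplus> neg (c \<cdot> p2)"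
  have kf: "?k \<in> Mor \<A>" "src \<A> ?k = src \<A> p" "tgt \<A> ?k = S" "?f \<in> Mor \<A>" "src \<A> ?f = S" "tgt \<A> ?f = tgt \<A> q"
    using X D(1-3,9-11) b by simp_all
  have "is_short_exact \<A> ?k ?f"
    by (rule pullback_short_exact_biproduct[OF S(2) pb short_exact_epi[OF D(15)]]) (use X in simp_all)
  then have cf: "conflation \<A> C ?k ?f"
    using kf D S by (simp add: conflation_def del: distrib_left distrib_right)
  have "seq_map \<A> (q \<cdot> p1 \<boxplus> neg c \<cdot> p2) \<sigma> \<rho>' (d1 \<cdot> q1 \<boxplus> neg d2 \<cdot> q2)"
    by (rule s(6)[OF _ _ gr'(4) d1(1) seq_map_neg[OF d2(1) gr(4) gr'(4)]])
      (use X D(9,10) c(1) in \<open>simp_all add: Hom_iff\<close>)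
  \<comment> \<open>Both \<open>d1 \<cdot> u\<close> and \<open>d2 \<cdot> s\<close> equal
    \<open>s'\<close>, so the difference has zero right-hand map.\<close>
  moreover have "(d1 \<cdot> q1 \<boxplus> neg d2 \<cdot> q2) \<cdot> v = zer \<A> Z (tgt \<A> s')"
    using dT bT v d1(3) d2(3) gr' by simp
  ultimately have "ext_map ?f \<sigma> v \<rho>' (zer \<A> Z (tgt \<A> s'))"
    unfolding ext_map_def using dT bT v gr' X b
    by (intro exI[of _ "d1 \<cdot> q1 \<boxplus> neg d2 \<cdot> q2"]) (simp add: Hom_iff)
  moreover have "null Z (tgt \<A> ?f) \<rho>' (zer \<A> Z (tgt \<A> s'))"
    unfolding kf by (rule null_zer) (use gr' in auto)
  moreover have "ext_rep Z (src \<A> ?f) \<sigma> v" using gv unfolding kf .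
  ultimately obtain \<kappa> w where w: "ext_rep Z (src \<A> ?k) \<kappa> w" "ext_map ?k \<kappa> w \<sigma> v"
    using exact[OF cf, of \<sigma> v \<rho>' "zer \<A> Z (tgt \<A> s')"] s(4) len by auto
  have "ext_map p2 \<sigma> v \<rho> s"
    unfolding ext_map_def using s(5) v bT by (intro exI[of _ q2]) (simp add: Hom_iff)
  from ext_map_trans[OF w(2) this w(1) gv r(1)] have "ext_map (p2 \<cdot> ?k) \<kappa> w \<rho> s"
    using kf b by (simp add: Hom_iff del: distrib_left distrib_right)
  moreover have "p2 \<cdot> ?k = p" using X D(1-3) b C_in_Obj[OF D(6)] by (simp add: bs)
  ultimately show ?thesis using w(1) kf(2) by auto
qed

text \<open>Induction along the zigzag that kills the class. A forward arrow pushes the lift out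
  along its middle component, a backward arrow is \<open>exact_along_pullback\<close>. Middle
  exactness is assumed only in length \<open>t\<close>, so that the lemma can be called inside the
  induction that proves it.\<close>

lemma connecting_exact_step:
  assumes exact: "\<And>i p \<rho> s \<tau> \<sigma>. \<lbrakk>conflation \<A> C i p; length \<rho> = t; ext_rep Z (src \<A> p) \<rho> s; null Z (tgt \<A> p) \<tau> \<sigma>; ext_map p \<rho> s \<tau> \<sigma>\<rbrakk>
      \<Longrightarrow> \<exists>\<kappa> u. ext_rep Z (src \<A> i) \<kappa> u \<and> ext_map i \<kappa> u \<rho> s"
    and "null Z B \<xi> s" "\<xi> = (i, p) # \<rho>" "length \<rho> = t"
  shows "\<exists>y u. ext_rep Z (src \<A> p) y u \<and> ext_map p y u \<rho> s"
  using assms(2-)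
proof (induction arbitrary: i p \<rho> rule: null.induct)
  case (null_zer \<xi> A)
  then have c: "conflation \<A> C i p" "spliced \<A> C (tgt \<A> p) \<rho> A" by auto
  note D = conflationD[OF c(1)]
  show ?case
  proof (cases "\<rho> = []")
    case True
    then have "ext_map p [] (zer \<A> Z (src \<A> p)) \<rho> (zer \<A> Z A)"
      using c D null_zer by (simp add: ext_map_def Hom_iff)
    moreover have "ext_rep Z (src \<A> p) [] (zer \<A> Z (src \<A> p))" using D null_zer by (simp add: ext_rep_def)
    ultimately show ?thesis by blast
  next
    case False
    \<comment> \<open>The lift is a zero sequence pulled back along a zero map. Its right end may be
      any object of \<open>C\<close>; as \<open>Z\<close> need not lie in \<open>C\<close>,
      \<open>src \<A> p\<close> is taken.\<close>
    then obtain \<zeta> where z: "\<zeta> \<in> zero_seqs \<A> C (length \<rho>) (src \<A> p) (src \<A> p)"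
      using ex_zero_seq[OF D(5,5), of "length \<rho>"] by auto
    have "seq_map \<A> p \<zeta> \<rho> (zer \<A> (src \<A> p) A)"
      by (rule zero_seqs_map[OF z D(5,5) c(2)]) (use D in \<open>auto simp: Hom_iff\<close>)
    then have "ext_map p \<zeta> (zer \<A> Z (src \<A> p)) \<rho> (zer \<A> Z A)"
      using D null_zer unfolding ext_map_def by (intro exI[of _ "zer \<A> (src \<A> p) A"]) (simp add: Hom_iff)
    moreover have "ext_rep Z (src \<A> p) \<zeta> (zer \<A> Z (src \<A> p))"
      using D null_zer zero_seqs_spliced(1)[OF z D(5,5)] by (simp add: ext_rep_def)
    ultimately show ?thesis by blast
  qed
next
  case (null_fwd \<xi> s \<xi>' s' j q \<rho>')
  have x': "\<xi>' = (j, q) # \<rho>'" by fact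
  obtain d where d: "seq_map \<A> (idm \<A> B) \<xi> \<xi>' d" "d \<in> Hom \<A> (tgt \<A> s) (tgt \<A> s')" "d \<cdot> s = s'"
    using null_fwd.hyps(4) by (auto simp: ext_map_def)
  obtain i p \<rho> where x: "\<xi> = (i, p) # \<rho>" using d(1) x' by (cases \<xi>) auto
  obtain y c where y: "y \<in> Hom \<A> (tgt \<A> i) (tgt \<A> j)" "c \<in> Hom \<A> (tgt \<A> p) (tgt \<A> q)" "c \<cdot> p = q \<cdot> y" "seq_map \<A> c \<rho> \<rho>' d"
    using d(1) x x' by auto
  note g = ext_repD[OF null_fwd.hyps(2)] and g' = ext_repD[OF null_fwd.hyps(3)]
  have c: "conflation \<A> C i p" "conflation \<A> C j q" using g(4) g'(4) x x' by auto
  note D = conflationD[OF c(1)] conflationD[OF c(2)]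
  have gr: "ext_rep Z (tgt \<A> p) \<rho> s" "ext_rep Z (tgt \<A> q) \<rho>' s'" using g g' x x' by (auto simp: ext_rep_def)
  have ar: "ext_map c \<rho> s \<rho>' s'" using y(4) d by (auto simp: ext_map_def)
  obtain z u where z: "ext_rep Z (src \<A> p) z u" "ext_map p z u \<rho> s"
    using null_fwd.IH[OF x] null_fwd.prems seq_map_length[OF y(4)] by auto
  have y': "y \<in> Hom \<A> (src \<A> p) (src \<A> q)" "p \<in> Hom \<A> (src \<A> p) (tgt \<A> p)" "q \<in> Hom \<A> (src \<A> q) (tgt \<A> q)"
    using y(1) D(2,3,10,11) by (simp_all add: Hom_iff)
  from ext_map_trans[OF z(2) ar z(1) gr y'(2) y(2)] have "ext_map (q \<cdot> y) z u \<rho>' s'" unfolding y(3) .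
  moreover obtain z' u' where "ext_rep Z (src \<A> q) z' u'"
    "\<And>h \<tau> \<sigma> B''. h \<in> Hom \<A> (src \<A> q) B'' \<Longrightarrow> ext_rep Z B'' \<tau> \<sigma> \<Longrightarrow> ext_map (h \<cdot> y) z u \<tau> \<sigma> \<Longrightarrow> ext_map h z' u' \<tau> \<sigma>"
    using ext_map_push[OF z(1) y'(1) D(13)] by metis
  ultimately show ?case using y'(3) gr(2) by blast
next
  case (null_bwd \<xi>' s' \<xi> s i p \<rho>)
  have x: "\<xi> = (i, p) # \<rho>" by fact
  obtain d where d: "seq_map \<A> (idm \<A> B) \<xi> \<xi>' d" "d \<in> Hom \<A> (tgt \<A> s) (tgt \<A> s')" "d \<cdot> s = s'"
    using null_bwd.hyps(4) by (auto simp: ext_map_def)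
  obtain j q \<rho>' where x': "\<xi>' = (j, q) # \<rho>'" using d(1) x by (cases \<xi>') auto
  obtain y c where y: "y \<in> Hom \<A> (tgt \<A> i) (tgt \<A> j)" "c \<in> Hom \<A> (tgt \<A> p) (tgt \<A> q)" "y \<cdot> i = j \<cdot> idm \<A> B" "c \<cdot> p = q \<cdot> y" "seq_map \<A> c \<rho> \<rho>' d"
    using d(1) x x' by auto
  note g = ext_repD[OF null_bwd.hyps(2)] and g' = ext_repD[OF null_bwd.hyps(3)]
  have c: "conflation \<A> C i p" "src \<A> i = B" "conflation \<A> C j q" "src \<A> j = B" using g(4) g'(4) x x' by auto
  have yi: "y \<cdot> i = j" using y(3) c(4) conflationD(1)[OF c(3)] by simp
  have gr: "ext_rep Z (tgt \<A> p) \<rho> s" "ext_rep Z (tgt \<A> q) \<rho>' s'" using g g' x x' by (auto simp: ext_rep_def)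
  have ar: "ext_map c \<rho> s \<rho>' s'" using y(5) d by (auto simp: ext_map_def)
  have len: "length \<rho>' = t" using seq_map_length[OF y(5)] null_bwd.prems by simp
  obtain z u where z: "ext_rep Z (src \<A> q) z u" "ext_map q z u \<rho>' s'"
    using null_bwd.IH[OF x' len] by auto
  show ?case
  proof (rule exact_along_pullback[OF c(1,3) _ y(1) yi y(2,4) z gr(1) ar gr(2)])
    show "src \<A> i = src \<A> j" using c by simp
  qed (rule exact, use len in auto)
qed

text \<open>Exactness at the middle term and at the connecting homomorphism are proved by simultaneous
  induction: a class \<open>(j, q) # \<rho>\<close> killed by \<open>p\<close> is lifted by applying the
  connecting statement, one degree lower, to the push-out of \<open>(j, q)\<close> along \<open>p\<close>.\<close>

lemma middle_exact:
  assumes "conflation \<A> C i p" "ext_rep Z (src \<A> p) \<rho> s" "null Z (tgt \<A> p) \<tau> \<sigma>" "ext_map p \<rho> s \<tau> \<sigma>"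
  shows "\<exists>\<kappa> u. ext_rep Z (src \<A> i) \<kappa> u \<and> ext_map i \<kappa> u \<rho> s"
  using assms
proof (induction "length \<rho>" arbitrary: i p \<rho> s \<tau> \<sigma>)
  case 0
  note D = conflationD[OF 0(2)] and g = ext_repD[OF 0(3)]
  have \<rho>: "\<rho> = []" using 0 by simp
  have \<tau>: "\<tau> = []" using ext_map_length[OF 0(5)] \<rho> by simp
  have s: "tgt \<A> s = src \<A> p" using g(4) \<rho> by simp
  have "p \<cdot> s = \<sigma>" using 0(5) unfolding \<rho> \<tau> ext_map_Nil by simp
  also have "\<sigma> = zer \<A> Z (tgt \<A> p)" using 0(4) unfolding \<tau> by (rule null_Nil)
  finally have "p \<cdot> s = zer \<A> (src \<A> s) (tgt \<A> p)" using g by simp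
  moreover have "is_kernel \<A> i p" using D(7) by (simp add: is_short_exact_def)
  ultimately obtain u where u: "u \<in> Mor \<A>" "src \<A> u = src \<A> s" "tgt \<A> u = src \<A> i" "i \<cdot> u = s"
    using kernel_lift[of \<A> i p s] g(1) s by metis
  have "ext_rep Z (src \<A> i) [] u" using u g D by (simp add: ext_rep_def)
  moreover have "ext_map i [] u [] s" using u D s by (simp add: ext_map_Nil Hom_iff)
  ultimately show ?case using \<rho> by blast
next
  case (Suc t)
  note D = conflationD[OF Suc.prems(1)] and g = ext_repD[OF Suc.prems(2)]
  obtain j q \<rho>' where r: "\<rho> = (j, q) # \<rho>'" using Suc.hyps(2) by (cases \<rho>) auto
  have c: "conflation \<A> C j q" "src \<A> j = src \<A> p" "spliced \<A> C (tgt \<A> q) \<rho>' (tgt \<A> s)" using g(4) r by auto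
  note E = conflationD[OF c(1)]
  \<comment> \<open>Pushing the first conflation out along \<open>p\<close> represents the image
    class, which is null, while the tail \<open>\<rho>'\<close> is kept.\<close>
  obtain x j' q' where po: "is_pushout \<A> j p x j'" and q': "q' \<in> Hom \<A> (tgt \<A> j') (tgt \<A> q)" "q' \<cdot> x = q"
    "q' \<cdot> j' = zer \<A> (src \<A> j') (tgt \<A> q)" and c': "conflation \<A> C j' q'"
    by (rule ex_pushout_conflation[OF c(1) D(2) c(2) D(6)])
  note P = pushoutD[OF po] and F = conflationD[OF c']
  have sq: "seq_pushout \<A> p \<rho> ((j', q') # \<rho>')"
    unfolding seq_pushout_def using r po q' by blast
  have p: "p \<in> Hom \<A> (src \<A> p) (tgt \<A> p)" using D by (simp add: Hom_iff)
  note SP = seq_pushoutD[OF g(4) sq p D(6)]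
  have g': "ext_rep Z (tgt \<A> p) ((j', q') # \<rho>') s" using SP(1) g by (simp add: ext_rep_def)
  have gt: "ext_rep Z (tgt \<A> p) \<tau> \<sigma>" by (rule null_ext_rep) fact
  have i: "idm \<A> (tgt \<A> p) \<in> Hom \<A> (tgt \<A> p) (tgt \<A> p)" using D by (simp add: Hom_iff)
  have "idm \<A> (tgt \<A> p) \<cdot> p = p" using D(2) by simp
  then have "ext_map (idm \<A> (tgt \<A> p)) ((j', q') # \<rho>') s \<tau> \<sigma>"
    using Suc.prems(4) seq_pushout_map[OF g(4) sq p D(6) i ext_repD(4)[OF gt]] unfolding ext_map_def by auto
  with Suc.prems(3) g' gt have "null Z (tgt \<A> p) ((j', q') # \<rho>') s" by (rule null_bwd)
  \<comment> \<open>The tail has length \<open>t\<close>, so the connecting statement calls middle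
    exactness only in that length, which is the induction hypothesis.\<close>
  from connecting_exact_step[OF _ this refl, of t]
  obtain y u where y: "ext_rep Z (src \<A> q') y u" "ext_map q' y u \<rho>' s"
    using Suc.hyps r by fastforce
  \<comment> \<open>The push-out leg \<open>x\<close> is the cokernel of \<open>j \<cdot> i\<close>,
    so \<open>y\<close> can be spliced onto a conflation starting at \<open>src \<A> i\<close>; the
    result is the required lift.\<close>
  have se: "is_short_exact \<A> (j \<cdot> i) x"
    by (rule short_exact_cmp[OF D(7) E(7) _ po]) (use D c in simp)
  have T: "j \<cdot> i \<in> Mor \<A>" "src \<A> (j \<cdot> i) = src \<A> i" "tgt \<A> (j \<cdot> i) = src \<A> q" "tgt \<A> x = src \<A> q'"
    using D E c P(7) F(3) by simp_all
  have tq: "tgt \<A> q' = tgt \<A> q" using q'(1) by (simp add: Hom_iff)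
  have cc: "conflation \<A> C (j \<cdot> i) x" unfolding conflation_def using se T D E F by simp
  have "ext_rep Z (src \<A> i) ((j \<cdot> i, x) # y) u" using ext_repD[OF y(1)] cc T by (simp add: ext_rep_def)
  moreover have "ext_map i ((j \<cdot> i, x) # y) u \<rho> s"
  proof -
    obtain d where d: "seq_map \<A> q' y \<rho>' d" "d \<in> Hom \<A> (tgt \<A> u) (tgt \<A> s)" "d \<cdot> u = s"
      using y(2) by (auto simp: ext_map_def)
    \<comment> \<open>The first two components are the identity of the middle term and
      \<open>q'\<close>; their square commutes because \<open>q' \<cdot> x = q\<close>.\<close>
    have "seq_map \<A> i ((j \<cdot> i, x) # y) \<rho> d" unfolding r seq_map.simps
      using T E D F q'(2) d(1) c(2) tq
      by (intro bexI[of _ "idm \<A> (src \<A> q)"] bexI[of _ q']) (simp_all add: Hom_iff)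
    then show ?thesis using d unfolding ext_map_def by blast
  qed
  ultimately show ?case by blast
qed

lemma connecting_exact:
  assumes "null Z B ((i, p) # \<rho>) s"
  shows "\<exists>y u. ext_rep Z (src \<A> p) y u \<and> ext_map p y u \<rho> s"
  by (rule connecting_exact_step[OF _ assms refl refl]) (rule middle_exact)

end

section \<open>Equivalence of sequences\<close>

lemma seq_equiv_refl [simp]: "(\<xi>, \<xi>) \<in> seq_equiv \<A> C"
  by (simp add: seq_equiv_def)

lemma seq_equiv_trans: "(\<xi>, \<zeta>) \<in> seq_equiv \<A> C \<Longrightarrow> (\<zeta>, \<tau>) \<in> seq_equiv \<A> C \<Longrightarrow> (\<xi>, \<tau>) \<in> seq_equiv \<A> C"
  unfolding seq_equiv_def by (rule rtrancl_trans)

lemma seq_equiv_sym: "(\<xi>, \<zeta>) \<in> seq_equiv \<A> C \<Longrightarrow> (\<zeta>, \<xi>) \<in> seq_equiv \<A> C"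
proof -
  have "sym ((seq_step \<A> C \<union> (seq_step \<A> C)\<inverse>)\<^sup>*)" by (intro sym_rtrancl) (auto simp: sym_def)
  then show "(\<xi>, \<zeta>) \<in> seq_equiv \<A> C \<Longrightarrow> (\<zeta>, \<xi>) \<in> seq_equiv \<A> C" unfolding seq_equiv_def sym_def by blast
qed

lemma seq_equivI:
  "spliced \<A> C B \<xi> A \<Longrightarrow> spliced \<A> C B \<zeta> A \<Longrightarrow> seq_map \<A> (idm \<A> B) \<xi> \<zeta> (idm \<A> A) \<Longrightarrow> (\<xi>, \<zeta>) \<in> seq_equiv \<A> C"
  unfolding seq_equiv_def seq_step_def by blast

text \<open>The ends stay fixed along a zigzag because a nonempty sequence determines them; the
  empty list does not, hence the side condition.\<close>

lemma seq_equiv_induct [consumes 3, case_names refl fwd bwd]: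
  assumes "(\<xi>, \<zeta>) \<in> seq_equiv \<A> C" "spliced \<A> C B \<xi> A" "\<xi> \<noteq> []"
    and "P \<xi>"
    and fwd: "\<And>\<zeta> \<tau>. \<lbrakk>(\<xi>, \<zeta>) \<in> seq_equiv \<A> C; spliced \<A> C B \<zeta> A; spliced \<A> C B \<tau> A; \<zeta> \<noteq> []; \<tau> \<noteq> []; seq_map \<A> (idm \<A> B) \<zeta> \<tau> (idm \<A> A); P \<zeta>\<rbrakk> \<Longrightarrow> P \<tau>"
    and bwd: "\<And>\<zeta> \<tau>. \<lbrakk>(\<xi>, \<zeta>) \<in> seq_equiv \<A> C; spliced \<A> C B \<zeta> A; spliced \<A> C B \<tau> A; \<zeta> \<noteq> []; \<tau> \<noteq> []; seq_map \<A> (idm \<A> B) \<tau> \<zeta> (idm \<A> A); P \<zeta>\<rbrakk> \<Longrightarrow> P \<tau>"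
  shows "P \<zeta> \<and> spliced \<A> C B \<zeta> A \<and> \<zeta> \<noteq> []"
  using assms(1)[unfolded seq_equiv_def]
proof (induction rule: rtrancl_induct)
  case (step \<zeta> \<tau>)
  then have e: "(\<xi>, \<zeta>) \<in> seq_equiv \<A> C" and z: "P \<zeta>" "spliced \<A> C B \<zeta> A" "\<zeta> \<noteq> []" by (auto simp: seq_equiv_def)
  from step(2) obtain A' B' where s: "spliced \<A> C B' \<zeta> A'" "spliced \<A> C B' \<tau> A'"
    "seq_map \<A> (idm \<A> B') \<zeta> \<tau> (idm \<A> A') \<or> seq_map \<A> (idm \<A> B') \<tau> \<zeta> (idm \<A> A')"
    by (auto simp: seq_step_def)
  then have "B' = B" "A' = A" using spliced_unique[OF s(1) z(2,3)] by auto
  moreover have "\<tau> \<noteq> []" using s(3) z(3) seq_map_length by fastforce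
  ultimately show ?case using fwd[OF e z(2)] bwd[OF e z(2)] z s by blast
qed (use assms in simp)

definition seq_class :: "('o, 'm) cat_data \<Rightarrow> 'o set \<Rightarrow> 'm seq \<Rightarrow> 'm ext" where
  "seq_class \<A> C \<xi> = ClsE (seq_equiv \<A> C `` {\<xi>})"

lemma seq_class_eq_iff: "seq_class \<A> C \<xi> = seq_class \<A> C \<zeta> \<longleftrightarrow> (\<xi>, \<zeta>) \<in> seq_equiv \<A> C"
  unfolding seq_class_def by (auto intro: seq_equiv_trans seq_equiv_sym)

lemma Ext_iff:
  assumes "t \<noteq> 0"
  shows "\<gamma> \<in> Ext \<A> C t A B \<longleftrightarrow> (\<exists>\<xi>. length \<xi> = t \<and> spliced \<A> C B \<xi> A \<and> \<gamma> = seq_class \<A> C \<xi>)"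
  using assms by (auto simp: Ext_def quotient_def exact_seqs_def seq_class_def)

context extension_closed_subcategory
begin

lemma zero_seqs_flip:
  assumes "\<zeta> \<in> zero_seqs \<A> C t A B"
  shows "flip \<zeta> \<in> zero_seqs (opc \<A>) C t B A"
proof (cases t)
  case (Suc t')
  show ?thesis
  proof (cases t')
    case 0
    then obtain i1 i2 p1 p2 S where z: "\<zeta> = [(i1, p2)]" and b: "is_biproduct \<A> B A S (i1, i2, p1, p2)"
      using assms Suc by auto
    have "is_biproduct (opc \<A>) A B S (p2, p1, i2, i1)" using biproduct_swap[OF b] by simp
    then show ?thesis using z Suc 0 by (simp, blast)
  next
    case (Suc k)
    then obtain Z where Z: "Z \<in> C" "is_zero_object \<A> Z" and
      z: "\<zeta> = [(idm \<A> B, zer \<A> B Z)] @ replicate k (zer \<A> Z Z, zer \<A> Z Z) @ [(zer \<A> Z A, idm \<A> A)]"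
      using assms \<open>t = Suc t'\<close> by auto
    have "flip \<zeta> = [(idm \<A> A, zer \<A> Z A)] @ replicate k (zer \<A> Z Z, zer \<A> Z Z) @ [(zer \<A> B Z, idm \<A> B)]"
      unfolding z by (simp add: flip_def)
    then show ?thesis using Z Suc \<open>t = Suc t'\<close> by auto
  qed
qed (use assms in simp)

lemma seq_equiv_flip:
  assumes "(\<xi>, \<zeta>) \<in> seq_equiv \<A> C" "spliced \<A> C B \<xi> A" "\<xi> \<noteq> []"
  shows "(flip \<xi>, flip \<zeta>) \<in> seq_equiv (opc \<A>) C"
proof -
  have B: "B \<in> C" using spliced_C(1)[OF assms(2)] assms(3) by blast
  then have i: "idm \<A> B \<in> Hom \<A> B B" by (simp add: Hom_iff)
  have f: "(flip \<tau>, flip \<zeta>) \<in> seq_equiv (opc \<A>) C"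
    if "spliced \<A> C B \<zeta> A" "spliced \<A> C B \<tau> A" "seq_map \<A> (idm \<A> B) \<zeta> \<tau> (idm \<A> A)" for \<zeta> \<tau>
    by (rule seq_equivI[of _ _ A _ B]) (use that seq_map_flip[OF that(3,1,2) i] in simp_all)
  from assms have "(flip \<xi>, flip \<zeta>) \<in> seq_equiv (opc \<A>) C \<and> spliced \<A> C B \<zeta> A \<and> \<zeta> \<noteq> []"
  proof (induction rule: seq_equiv_induct)
    case (fwd \<zeta> \<tau>)
    then show ?case using f[of \<zeta> \<tau>] by (blast intro: seq_equiv_trans seq_equiv_sym)
  next
    case (bwd \<zeta> \<tau>)
    then show ?case using f[of \<tau> \<zeta>] by (blast intro: seq_equiv_trans seq_equiv_sym)
  qed simp
  then show ?thesis ..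
qed

lemma seq_equiv_append:
  assumes "(\<xi>, \<zeta>) \<in> seq_equiv \<A> C" "spliced \<A> C B \<xi> A" "\<xi> \<noteq> []" "spliced \<A> C A \<rho> D"
  shows "(\<xi> @ \<rho>, \<zeta> @ \<rho>) \<in> seq_equiv \<A> C"
proof -
  have "A \<in> C" using spliced_C(2)[OF assms(2)] assms(3) by blast
  from seq_map_refl[OF assms(4) this]
  have f: "(\<zeta> @ \<rho>, \<tau> @ \<rho>) \<in> seq_equiv \<A> C"
    if "spliced \<A> C B \<zeta> A" "spliced \<A> C B \<tau> A" "seq_map \<A> (idm \<A> B) \<zeta> \<tau> (idm \<A> A)" for \<zeta> \<tau>
    using that assms(4) by (intro seq_equivI[of _ _ B _ D]) (auto simp: spliced_append intro: seq_map_append)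
  from assms(1-3) have "(\<xi> @ \<rho>, \<zeta> @ \<rho>) \<in> seq_equiv \<A> C \<and> spliced \<A> C B \<zeta> A \<and> \<zeta> \<noteq> []"
  proof (induction rule: seq_equiv_induct)
    case (fwd \<zeta> \<tau>)
    then show ?case using f[of \<zeta> \<tau>] by (blast intro: seq_equiv_trans seq_equiv_sym)
  next
    case (bwd \<zeta> \<tau>)
    then show ?case using f[of \<tau> \<zeta>] by (blast intro: seq_equiv_trans seq_equiv_sym)
  qed simp
  then show ?thesis ..
qed

lemma seq_equiv_prepend:
  assumes "(\<xi>, \<zeta>) \<in> seq_equiv \<A> C" "spliced \<A> C B \<xi> A" "\<xi> \<noteq> []" "spliced \<A> C D \<rho> B"
  shows "(\<rho> @ \<xi>, \<rho> @ \<zeta>) \<in> seq_equiv \<A> C"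
proof -
  interpret op: extension_closed_subcategory "opc \<A>" C by (rule extension_closed_opc)
  have "(flip \<xi> @ flip \<rho>, flip \<zeta> @ flip \<rho>) \<in> seq_equiv (opc \<A>) C"
    by (rule op.seq_equiv_append[OF seq_equiv_flip[OF assms(1-3)], of A B _ D]) (use assms in simp_all)
  then have "(flip (flip (\<rho> @ \<xi>)), flip (flip (\<rho> @ \<zeta>))) \<in> seq_equiv (opc (opc \<A>)) C"
    by (intro op.seq_equiv_flip[of _ _ A D]) (use assms in \<open>auto simp: spliced_append\<close>)
  then show ?thesis unfolding opc_opc flip_simps(4) .
qed

text \<open>Push-outs depend on choices; their universal property turns each arrow of the zigzag
  into an arrow between arbitrarily chosen push-outs of its ends.\<close>

lemma pushouts_equiv:
  assumes "(\<xi>, \<xi>') \<in> seq_equiv \<A> C" "spliced \<A> C B \<xi> A" "\<xi> \<noteq> []" "g \<in> Hom \<A> B B'" "B' \<in> C"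
    "seq_pushout \<A> g \<xi> \<zeta>" "seq_pushout \<A> g \<xi>' \<zeta>'"
  shows "(\<zeta>, \<zeta>') \<in> seq_equiv \<A> C"
proof -
  have C: "B \<in> C" "A \<in> C" using spliced_C[OF assms(2)] assms(3) by blast+
  have iB: "idm \<A> B \<in> Hom \<A> B B" and iB': "idm \<A> B' \<in> Hom \<A> B' B'"
    and gi: "g \<cdot> idm \<A> B = g" "idm \<A> B' \<cdot> g = g" and iA: "idm \<A> A \<cdot> idm \<A> A = idm \<A> A"
    using C assms(4,5) by (simp_all add: Hom_iff)
  have m: "(\<zeta>1, \<zeta>2) \<in> seq_equiv \<A> C"
    if "spliced \<A> C B \<xi>1 A" "spliced \<A> C B \<xi>2 A" "seq_map \<A> (idm \<A> B) \<xi>1 \<xi>2 (idm \<A> A)"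
      "seq_pushout \<A> g \<xi>1 \<zeta>1" "seq_pushout \<A> g \<xi>2 \<zeta>2" for \<xi>1 \<xi>2 \<zeta>1 \<zeta>2
  proof -
    note P1 = seq_pushoutD[OF that(1,4) assms(4,5)] and P2 = seq_pushoutD[OF that(2,5) assms(4,5)]
    have "seq_map \<A> g \<xi>1 \<zeta>2 (idm \<A> A)"
      using seq_map_trans[OF that(3) P2(2) that(1,2) P2(1) iB assms(4)] gi iA by simp
    then have "seq_map \<A> (idm \<A> B') \<zeta>1 \<zeta>2 (idm \<A> A)"
      using seq_pushout_map[OF that(1,4) assms(4,5) iB' P2(1)] gi by simp
    with P1(1) P2(1) show ?thesis by (rule seq_equivI)
  qed
  from assms(1-3) have "(\<forall>\<zeta>'. seq_pushout \<A> g \<xi>' \<zeta>' \<longrightarrow> (\<zeta>, \<zeta>') \<in> seq_equiv \<A> C) \<and> spliced \<A> C B \<xi>' A \<and> \<xi>' \<noteq> []"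
  proof (induction rule: seq_equiv_induct)
    case refl
    show ?case using m[OF assms(2,2) seq_map_refl[OF assms(2) C(1)] assms(6)] by blast
  next
    case (fwd \<xi>1 \<xi>2)
    obtain \<zeta>1 where "seq_pushout \<A> g \<xi>1 \<zeta>1" using ex_seq_pushout[OF fwd(2,6) assms(4,5)] .
    then show ?case using fwd(5) m[OF fwd(2,3,4)] seq_equiv_trans by blast
  next
    case (bwd \<xi>1 \<xi>2)
    obtain \<zeta>1 where "seq_pushout \<A> g \<xi>1 \<zeta>1" using ex_seq_pushout[OF bwd(2,6) assms(4,5)] .
    then show ?case using bwd(5) m[OF bwd(3,2,4)] seq_equiv_trans seq_equiv_sym by blast
  qed
  then show ?thesis using assms(7) by blast
qed

lemma pullbacks_equiv:
  assumes "(\<xi>, \<xi>') \<in> seq_equiv \<A> C" "spliced \<A> C B \<xi> A" "\<xi> \<noteq> []" "h \<in> Hom \<A> A' A" "A' \<in> C"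
    "seq_pullback \<A> h \<xi> \<zeta>" "seq_pullback \<A> h \<xi>' \<zeta>'"
  shows "(\<zeta>, \<zeta>') \<in> seq_equiv \<A> C"
proof -
  interpret op: extension_closed_subcategory "opc \<A>" C by (rule extension_closed_opc)
  have "(flip \<zeta>, flip \<zeta>') \<in> seq_equiv (opc \<A>) C"
    by (rule op.pushouts_equiv[OF seq_equiv_flip[OF assms(1-3)], of A B h A']) (use assms in simp_all)
  from op.seq_equiv_flip[OF this, of A' B] show ?thesis
    using seq_pullbackD[OF assms(2,6,4,5)] by simp
qed

text \<open>Allows \<open>push\<close> to be computed from any morphism with left component
  \<open>g\<close> and identity on the right: its target receives a map from an actual push-out and
  is therefore equivalent to it.\<close>

lemma push_seq_class:
  assumes "spliced \<A> C B \<xi> A" "\<xi> \<noteq> []" "g \<in> Hom \<A> B B'" "spliced \<A> C B' \<zeta> A" "seq_map \<A> g \<xi> \<zeta> (idm \<A> A)"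
  shows "push \<A> C g (seq_class \<A> C \<xi>) = seq_class \<A> C \<zeta>"
proof -
  have "\<zeta> \<noteq> []" using seq_map_length[OF assms(5)] assms(2) by auto
  then have B': "B' \<in> C" using spliced_C(1)[OF assms(4)] by blast
  obtain \<zeta>0 where z: "seq_pushout \<A> g \<xi> \<zeta>0" using ex_seq_pushout[OF assms(1-3) B'] .
  note P = seq_pushoutD[OF assms(1) z assms(3) B']
  have "seq_map \<A> (idm \<A> B') \<zeta>0 \<zeta> (idm \<A> A)"
    by (rule seq_pushout_map[OF assms(1) z assms(3) B' _ assms(4)])
      (use assms(3,5) B' in \<open>simp_all add: Hom_iff\<close>)
  then have e: "(\<zeta>0, \<zeta>) \<in> seq_equiv \<A> C" using P(1) assms(4) by (intro seq_equivI)
  let ?S = "{\<zeta>. \<exists>\<xi>' \<in> seq_equiv \<A> C `` {\<xi>}. seq_pushout \<A> g \<xi>' \<zeta>}"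
  have "\<zeta>0 \<in> ?S" using z by auto
  moreover have "(\<zeta>, \<tau>) \<in> seq_equiv \<A> C" if "\<tau> \<in> ?S" for \<tau>
    using that pushouts_equiv[OF _ assms(1-3) B' z] seq_equiv_trans[OF seq_equiv_sym[OF e]] by blast
  ultimately have "seq_equiv \<A> C `` ?S = seq_equiv \<A> C `` {\<zeta>}"
    using e seq_equiv_trans by fast
  then show ?thesis by (simp add: seq_class_def)
qed

lemma pull_seq_class:
  assumes "spliced \<A> C B \<xi> A" "\<xi> \<noteq> []" "h \<in> Hom \<A> A' A" "spliced \<A> C B \<zeta> A'" "seq_map \<A> (idm \<A> B) \<zeta> \<xi> h"
  shows "pull \<A> C (seq_class \<A> C \<xi>) h = seq_class \<A> C \<zeta>"
proof -
  have "\<zeta> \<noteq> []" using seq_map_length[OF assms(5)] assms(2) by auto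
  then have A': "A' \<in> C" and B: "B \<in> C" using spliced_C[OF assms(4)] by blast+
  obtain \<zeta>0 where z: "seq_pullback \<A> h \<xi> \<zeta>0" using ex_seq_pullback[OF assms(1-3) A'] .
  note P = seq_pullbackD[OF assms(1) z assms(3) A']
  have "seq_map \<A> (idm \<A> B) \<zeta> \<zeta>0 (idm \<A> A')"
    by (rule seq_pullback_map[OF assms(1) z assms(3) A' _ assms(4)])
      (use assms(3,5) A' B in \<open>simp_all add: Hom_iff\<close>)
  then have e: "(\<zeta>0, \<zeta>) \<in> seq_equiv \<A> C" using P(1) assms(4) by (intro seq_equiv_sym[OF seq_equivI])
  let ?S = "{\<zeta>. \<exists>\<xi>' \<in> seq_equiv \<A> C `` {\<xi>}. seq_pullback \<A> h \<xi>' \<zeta>}"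
  have "\<zeta>0 \<in> ?S" using z by auto
  moreover have "(\<zeta>, \<tau>) \<in> seq_equiv \<A> C" if "\<tau> \<in> ?S" for \<tau>
    using that pullbacks_equiv[OF _ assms(1-3) A' z] seq_equiv_trans[OF seq_equiv_sym[OF e]] by blast
  ultimately have "seq_equiv \<A> C `` ?S = seq_equiv \<A> C `` {\<zeta>}"
    using e seq_equiv_trans by fast
  then show ?thesis by (simp add: seq_class_def)
qed

section \<open>Null sequences\<close>

abbreviation null_seq :: "'a \<Rightarrow> 'b seq \<Rightarrow> 'a \<Rightarrow> bool" where
  "null_seq B \<xi> A \<equiv> null A B \<xi> (idm \<A> A)"

lemma ext_rep_idm: "spliced \<A> C B \<xi> A \<Longrightarrow> A \<in> C \<Longrightarrow> ext_rep A B \<xi> (idm \<A> A)"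
  by (simp add: ext_rep_def)

lemma ext_map_idm: "spliced \<A> C B \<xi> A \<Longrightarrow> A \<in> C \<Longrightarrow> seq_map \<A> b \<xi> \<zeta> s \<Longrightarrow> s \<in> Hom \<A> A (tgt \<A> s) \<Longrightarrow> ext_map b \<xi> (idm \<A> A) \<zeta> s"
  unfolding ext_map_def by (intro exI[of _ s]) (auto simp: Hom_iff)

text \<open>The morphism exhibits \<open>\<xi>\<close> as the pull-back of \<open>\<zeta>\<close>
  along \<open>a\<close>, so vanishing travels against the arrow.\<close>

lemma null_seq_map_right:
  assumes "null A' B \<zeta> (idm \<A> A')" "spliced \<A> C B \<xi> A" "A \<in> C" "seq_map \<A> (idm \<A> B) \<xi> \<zeta> a"
  shows "null_seq B \<xi> A"
proof -
  note g = ext_repD[OF null_ext_rep[OF assms(1)]]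
  have A': "A' \<in> C" "spliced \<A> C B \<zeta> A'" using g by simp_all
  have a: "a \<in> Hom \<A> A A'" by (rule seq_map_Hom[OF assms(4,2) A'(2)]) (use g in \<open>simp add: Hom_iff\<close>)
  then have "null A B \<zeta> a" using null_pull[OF assms(1) a] by (simp add: Hom_iff)
  moreover have "ext_map (idm \<A> B) \<xi> (idm \<A> A) \<zeta> a"
    by (rule ext_map_idm[OF assms(2-4)]) (use a in \<open>simp add: Hom_iff\<close>)
  ultimately show ?thesis using null_bwd ext_rep_idm[OF assms(2,3)] null_ext_rep by blast
qed

text \<open>Here \<open>\<zeta>\<close> is the push-out of \<open>\<xi>\<close> along
  \<open>b\<close>, so vanishing travels along the arrow.\<close>

lemma null_seq_map_left:
  assumes "null_seq B \<xi> A" "spliced \<A> C B' \<zeta> A" "b \<in> Hom \<A> B B'" "seq_map \<A> b \<xi> \<zeta> (idm \<A> A)"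
  shows "null_seq B' \<zeta> A"
proof (rule null_push[OF assms(1) _ _ assms(3)])
  have A: "A \<in> Obj \<A>" using ext_repD(6)[OF null_ext_rep[OF assms(1)]] .
  then have A: "A \<in> C" "spliced \<A> C B \<xi> A" using ext_repD(3,4)[OF null_ext_rep[OF assms(1)]] by simp_all
  show "ext_rep A B' \<zeta> (idm \<A> A)" by (rule ext_rep_idm[OF assms(2) A(1)])
  show "ext_map b \<xi> (idm \<A> A) \<zeta> (idm \<A> A)"
    by (rule ext_map_idm[OF A(2,1) assms(4)]) (use A in \<open>simp add: Hom_iff\<close>)
qed

lemma null_seq_equiv:
  assumes "(\<xi>, \<zeta>) \<in> seq_equiv \<A> C" "spliced \<A> C B \<xi> A" "\<xi> \<noteq> []" "null_seq B \<xi> A"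
  shows "null_seq B \<zeta> A"
proof -
  have C: "B \<in> C" "A \<in> C" using spliced_C[OF assms(2)] assms(3) by blast+
  from assms(1-3) have "null_seq B \<zeta> A \<and> spliced \<A> C B \<zeta> A \<and> \<zeta> \<noteq> []"
  proof (induction rule: seq_equiv_induct)
    case (fwd \<zeta> \<tau>)
    show ?case by (rule null_seq_map_left[OF fwd(5,3) _ fwd(4)]) (use C in \<open>simp add: Hom_iff\<close>)
  next
    case (bwd \<zeta> \<tau>)
    show ?case by (rule null_seq_map_right[OF bwd(5,3) C(2) bwd(4)])
  qed (rule assms)
  then show ?thesis ..
qed

text \<open>A zero sequence has an endomorphism that is the identity on the left and zero on the
  right; it links the identity as right-hand map to the zero map.\<close>

lemma zero_seqs_null:
  assumes "\<zeta> \<in> zero_seqs \<A> C t A B" "A \<in> C" "B \<in> C"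
  shows "null_seq B \<zeta> A"
proof -
  note z = zero_seqs_spliced[OF assms]
  have "seq_map \<A> (idm \<A> B) \<zeta> \<zeta> (zer \<A> A A)"
    by (rule zero_seqs_map[OF assms z(1,2)]) (use assms in \<open>simp add: Hom_iff\<close>)
  then have "ext_map (idm \<A> B) \<zeta> (idm \<A> A) \<zeta> (zer \<A> A A)"
    using z(1) assms by (intro ext_map_idm) (simp_all add: Hom_iff)
  moreover have "null A B \<zeta> (zer \<A> A A)" by (rule null_zer) (use z assms in auto)
  ultimately show ?thesis using null_bwd ext_rep_idm[OF z(1) assms(2)] null_ext_rep by blast
qed

lemma pullbacks_ext_map_equiv:
  assumes "ext_rep A B \<rho> s" "ext_rep A B \<rho>' s'" "ext_map (idm \<A> B) \<rho> s \<rho>' s'" "A \<in> C"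
    "seq_pullback \<A> s \<rho> \<zeta>" "seq_pullback \<A> s' \<rho>' \<zeta>'"
  shows "(\<zeta>, \<zeta>') \<in> seq_equiv \<A> C"
proof -
  note g = ext_repD[OF assms(1)] and g' = ext_repD[OF assms(2)]
  have s: "s \<in> Hom \<A> A (tgt \<A> s)" "s' \<in> Hom \<A> A (tgt \<A> s')" and i: "idm \<A> B \<in> Hom \<A> B B" "idm \<A> A \<in> Hom \<A> A A"
    "idm \<A> B \<cdot> idm \<A> B = idm \<A> B" "s' \<cdot> idm \<A> A = s'"
    using g g' assms(4) by (simp_all add: Hom_iff)
  note Z = seq_pullbackD[OF g(4) assms(5) s(1) assms(4)] and Z' = seq_pullbackD[OF g'(4) assms(6) s(2) assms(4)]
  obtain d where d: "seq_map \<A> (idm \<A> B) \<rho> \<rho>' d" "d \<cdot> s = s'" using assms(3) by (auto simp: ext_map_def)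
  have "seq_map \<A> (idm \<A> B) \<zeta> \<rho>' (s' \<cdot> idm \<A> A)"
    using seq_map_trans[OF Z(2) d(1) Z(1) g(4) g'(4) i(1,1)] i d(2) by simp
  then have "seq_map \<A> (idm \<A> B) \<zeta> \<zeta>' (idm \<A> A)"
    by (rule seq_pullback_map[OF g'(4) assms(6) s(2) assms(4) i(2) Z(1) i(1)])
  then show ?thesis by (rule seq_equivI[OF Z(1) Z'(1)])
qed

text \<open>The pairs along a zigzag have sequences with varying right ends. Pulling each sequence
  back along its own map gives sequences from \<open>B\<close> to \<open>A\<close>, which
  \<open>seq_equiv\<close> can compare.\<close>

lemma null_pullback_zero:
  assumes "null A B \<rho> s" "A \<in> C" "\<rho> \<noteq> []" "seq_pullback \<A> s \<rho> \<zeta>"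
  shows "\<exists>\<omega> \<in> zero_seqs \<A> C (length \<rho>) A B. (\<omega>, \<zeta>) \<in> seq_equiv \<A> C"
  using assms(1,3,4)
proof (induction arbitrary: \<zeta> rule: null.induct)
  case (null_zer \<rho> A')
  have B: "B \<in> C" using spliced_C(1)[OF null_zer(1)] null_zer(2) by blast
  obtain \<omega> where w: "\<omega> \<in> zero_seqs \<A> C (length \<rho>) A B"
    using ex_zero_seq[OF assms(2) B, of "length \<rho>"] null_zer(4) by auto
  note W = zero_seqs_spliced[OF w assms(2) B]
  have i: "idm \<A> B \<in> Hom \<A> B B" "idm \<A> A \<in> Hom \<A> A A" and h: "zer \<A> A A' \<in> Hom \<A> A A'"
    "zer \<A> A A' \<cdot> idm \<A> A = zer \<A> A A'"
    using B assms(2) null_zer(2) by (simp_all add: Hom_iff)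
  have "seq_map \<A> (idm \<A> B) \<omega> \<rho> (zer \<A> A A' \<cdot> idm \<A> A)"
    unfolding h by (rule zero_seqs_map[OF w assms(2) B null_zer(1) refl i(1)])
  then have "seq_map \<A> (idm \<A> B) \<omega> \<zeta> (idm \<A> A)"
    by (rule seq_pullback_map[OF null_zer(1,5) h(1) assms(2) i(2) W(1) i(1)])
  then have "(\<omega>, \<zeta>) \<in> seq_equiv \<A> C"
    by (rule seq_equivI[OF W(1) seq_pullbackD(1)[OF null_zer(1,5) h(1) assms(2)]])
  with w show ?case by blast
next
  case (null_fwd \<rho> s \<rho>' s')
  note g = ext_repD[OF null_fwd.hyps(2)]
  have len: "length \<rho>' = length \<rho>" by (rule ext_map_length) fact
  then have ne: "\<rho> \<noteq> []" using null_fwd.prems by auto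
  obtain \<zeta>0 where z: "seq_pullback \<A> s \<rho> \<zeta>0"
    by (rule ex_seq_pullback[OF g(4) ne, of s A]) (use g assms(2) in \<open>auto simp: Hom_iff\<close>)
  have "(\<zeta>0, \<zeta>) \<in> seq_equiv \<A> C"
    by (rule pullbacks_ext_map_equiv[OF null_fwd.hyps(2-4) assms(2) z null_fwd.prems(2)])
  then show ?case using null_fwd.IH[OF ne z] seq_equiv_trans len by metis
next
  case (null_bwd \<rho>' s' \<rho> s)
  note g' = ext_repD[OF null_bwd.hyps(3)]
  have len: "length \<rho>' = length \<rho>" by (rule ext_map_length) fact
  then have ne: "\<rho>' \<noteq> []" using null_bwd.prems by auto
  obtain \<zeta>0 where z: "seq_pullback \<A> s' \<rho>' \<zeta>0"
    by (rule ex_seq_pullback[OF g'(4) ne, of s' A]) (use g' assms(2) in \<open>auto simp: Hom_iff\<close>)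
  have "(\<zeta>0, \<zeta>) \<in> seq_equiv \<A> C"
    by (rule seq_equiv_sym[OF pullbacks_ext_map_equiv[OF null_bwd.hyps(2-4) assms(2) null_bwd.prems(2) z]])
  then show ?case using null_bwd.IH[OF ne z] seq_equiv_trans len by metis
qed

lemma null_seq_iff:
  assumes "spliced \<A> C B \<xi> A" "\<xi> \<noteq> []"
  shows "null_seq B \<xi> A \<longleftrightarrow> (\<exists>\<omega> \<in> zero_seqs \<A> C (length \<xi>) A B. (\<omega>, \<xi>) \<in> seq_equiv \<A> C)"
proof
  have C: "B \<in> C" "A \<in> C" using spliced_C[OF assms(1)] assms(2) by blast+
  have i: "idm \<A> A \<in> Hom \<A> A A" "idm \<A> B \<in> Hom \<A> B B" using C by (simp_all add: Hom_iff)
  {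
    assume n: "null_seq B \<xi> A"
    obtain \<zeta> where z: "seq_pullback \<A> (idm \<A> A) \<xi> \<zeta>" using ex_seq_pullback[OF assms i(1) C(2)] .
    note Z = seq_pullbackD[OF assms(1) z i(1) C(2)]
    have "(\<zeta>, \<xi>) \<in> seq_equiv \<A> C" by (rule seq_equivI[OF Z(1) assms(1) Z(2)])
    then show "\<exists>\<omega> \<in> zero_seqs \<A> C (length \<xi>) A B. (\<omega>, \<xi>) \<in> seq_equiv \<A> C"
      using null_pullback_zero[OF n C(2) assms(2) z] seq_equiv_trans by blast
  next
    assume "\<exists>\<omega> \<in> zero_seqs \<A> C (length \<xi>) A B. (\<omega>, \<xi>) \<in> seq_equiv \<A> C"
    then obtain \<omega> where w: "\<omega> \<in> zero_seqs \<A> C (length \<xi>) A B" "(\<omega>, \<xi>) \<in> seq_equiv \<A> C" by blast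
    note W = zero_seqs_spliced[OF w(1) C(2,1)]
    have "\<omega> \<noteq> []" using W by auto
    then show "null_seq B \<xi> A" by (rule null_seq_equiv[OF w(2) W(1) _ zero_seqs_null[OF w(1) C(2,1)]])
  }
qed

text \<open>\<open>null\<close> varies only the right end and is not visibly self-dual. The detour
  through \<open>zero_seqs\<close>, which flip to zero sequences, supplies the symmetry.\<close>

lemma null_seq_flip:
  assumes "null_seq B \<xi> A" "\<xi> \<noteq> []"
  shows "extension_closed_subcategory.null (opc \<A>) C B A (flip \<xi>) (idm \<A> B)"
proof -
  interpret op: extension_closed_subcategory "opc \<A>" C by (rule extension_closed_opc)
  note g = ext_repD[OF null_ext_rep[OF assms(1)]]
  have sp: "spliced \<A> C B \<xi> A" using g(4,6) by simp
  have C: "B \<in> C" "A \<in> C" using spliced_C[OF sp] assms(2) by blast+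
  obtain \<omega> where w: "\<omega> \<in> zero_seqs \<A> C (length \<xi>) A B" "(\<omega>, \<xi>) \<in> seq_equiv \<A> C"
    using assms null_seq_iff[OF sp assms(2)] by blast
  note W = zero_seqs_spliced[OF w(1) C(2,1)]
  have "(flip \<omega>, flip \<xi>) \<in> seq_equiv (opc \<A>) C"
    by (rule seq_equiv_flip[OF w(2) W(1)]) (use W in auto)
  moreover have "flip \<omega> \<in> zero_seqs (opc \<A>) C (length (flip \<xi>)) B A"
    using zero_seqs_flip[OF w(1)] by simp
  ultimately show ?thesis
    using op.null_seq_iff[of A "flip \<xi>" B] sp assms(2) by auto
qed

text \<open>\<open>connecting_exact\<close> returns a lift with some right-hand map
  \<open>u\<close>; pulling back along \<open>u\<close> restores the right end
  \<open>A\<close>.\<close>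

lemma connecting_exact_seq:
  assumes "null_seq B ((i, p) # \<rho>) A" "\<rho> \<noteq> []"
  obtains y where "spliced \<A> C (src \<A> p) y A" "length y = length \<rho>" "seq_map \<A> p y \<rho> (idm \<A> A)"
proof -
  note g = ext_repD[OF null_ext_rep[OF assms(1)]]
  have sp: "conflation \<A> C i p" "spliced \<A> C (tgt \<A> p) \<rho> A" "A \<in> C" using g(3,4,6) by auto
  note D = conflationD[OF sp(1)]
  obtain y u where y: "ext_rep A (src \<A> p) y u" "ext_map p y u \<rho> (idm \<A> A)"
    using connecting_exact[OF assms(1)] by blast
  note G = ext_repD[OF y(1)]
  obtain d where d: "seq_map \<A> p y \<rho> d" "d \<cdot> u = idm \<A> A" using y(2) by (auto simp: ext_map_def)
  have u: "u \<in> Hom \<A> A (tgt \<A> u)" and i: "idm \<A> (src \<A> p) \<in> Hom \<A> (src \<A> p) (src \<A> p)"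
    and p: "p \<in> Hom \<A> (src \<A> p) (tgt \<A> p)" "p \<cdot> idm \<A> (src \<A> p) = p"
    using G D by (simp_all add: Hom_iff)
  have "y \<noteq> []" using ext_map_length[OF y(2)] assms(2) by auto
  then obtain z where z: "seq_pullback \<A> u y z" using ex_seq_pullback[OF G(4) _ u sp(3)] by metis
  note Z = seq_pullbackD[OF G(4) z u sp(3)]
  show ?thesis
  proof (rule that[OF Z(1)])
    show "length z = length \<rho>" using Z(5) ext_map_length[OF y(2)] by simp
    show "seq_map \<A> p z \<rho> (idm \<A> A)"
      using seq_map_trans[OF Z(2) d(1) Z(1) G(4) sp(2) i p(1)] p(2) d(2) by simp
  qed
qed

lemma connecting_exact_seq':
  assumes "null_seq B (\<rho> @ [(i, p)]) A" "\<rho> \<noteq> []"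
  obtains y where "spliced \<A> C B y (tgt \<A> i)" "length y = length \<rho>" "seq_map \<A> (idm \<A> B) \<rho> y i"
proof -
  interpret op: extension_closed_subcategory "opc \<A>" C by (rule extension_closed_opc)
  note g = ext_repD[OF null_ext_rep[OF assms(1)]]
  have sp: "conflation \<A> C i p" "spliced \<A> C B \<rho> (src \<A> i)" using g(4,6) by (auto simp: spliced_append)
  note D = conflationD[OF sp(1)]
  have "op.null B A ((p, i) # flip \<rho>) (idm (opc \<A>) B)" using null_seq_flip[OF assms(1)] by simp
  then obtain y where y: "spliced (opc \<A>) C (tgt \<A> i) y B" "length y = length \<rho>" "seq_map (opc \<A>) i y (flip \<rho>) (idm \<A> B)"
    by (rule op.connecting_exact_seq) (use assms(2) in auto)
  show ?thesis
  proof (rule that[of "flip y"])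
    show "spliced \<A> C B (flip y) (tgt \<A> i)" using y(1) spliced_flip[of \<A> C "tgt \<A> i" "flip y" B] by simp
    have "seq_map (opc (opc \<A>)) (idm \<A> B) (flip (flip \<rho>)) (flip y) i"
      by (rule op.seq_map_flip[OF y(3,1)]) (use sp D in \<open>simp_all add: Hom_iff\<close>)
    then show "seq_map \<A> (idm \<A> B) \<rho> (flip y) i" by simp
  qed (use y in simp)
qed

lemma Ext_vanishes_iff:
  assumes "A \<in> C" "B \<in> C" "t \<noteq> 0"
  shows "Ext_vanishes \<A> C t A B \<longleftrightarrow> (\<forall>\<xi>. spliced \<A> C B \<xi> A \<longrightarrow> length \<xi> = t \<longrightarrow> null_seq B \<xi> A)"
proof -
  have E: "Ext_vanishes \<A> C t A B \<longleftrightarrow> Ext \<A> C t A B = {ClsE (seq_equiv \<A> C `` zero_seqs \<A> C t A B)}"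
    using assms(3) by (simp add: Ext_vanishes_def Ext_group_def Ext_zero_def)
  \<comment> \<open>Zero sequences depend on the choice of a biproduct or a zero object. All of them
    map, with identities at the ends, to the pull-back of \<open>\<omega>\<close> along the zero
    endomorphism of \<open>A\<close>, so they lie in one class.\<close>
  have z: "(\<omega>, \<omega>') \<in> seq_equiv \<A> C"
    if "\<omega> \<in> zero_seqs \<A> C t A B" "\<omega>' \<in> zero_seqs \<A> C t A B" for \<omega> \<omega>'
  proof -
    note W = zero_seqs_spliced[OF that(1) assms(1,2)]
    have ne: "\<omega> \<noteq> []" using W by auto
    have h: "zer \<A> A A \<in> Hom \<A> A A" "idm \<A> B \<in> Hom \<A> B B" "idm \<A> A \<in> Hom \<A> A A" "zer \<A> A A \<cdot> idm \<A> A = zer \<A> A A"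
      using assms by (simp_all add: Hom_iff)
    obtain \<zeta> where p: "seq_pullback \<A> (zer \<A> A A) \<omega> \<zeta>" using ex_seq_pullback[OF W(1) ne h(1) assms(1)] .
    have "(\<tau>, \<zeta>) \<in> seq_equiv \<A> C" if "\<tau> \<in> zero_seqs \<A> C t A B" for \<tau>
    proof -
      note T = zero_seqs_spliced[OF that assms(1,2)]
      have "seq_map \<A> (idm \<A> B) \<tau> \<omega> (zer \<A> A A \<cdot> idm \<A> A)"
        unfolding h by (rule zero_seqs_map[OF that assms(1,2) W(1,2) h(2)])
      then have "seq_map \<A> (idm \<A> B) \<tau> \<zeta> (idm \<A> A)"
        by (rule seq_pullback_map[OF W(1) p h(1) assms(1) h(3) T(1) h(2)])
      then show ?thesis by (rule seq_equivI[OF T(1) seq_pullbackD(1)[OF W(1) p h(1) assms(1)]])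
    qed
    then show ?thesis using that seq_equiv_trans seq_equiv_sym by blast
  qed
  have nz: "null_seq B \<xi> A \<longleftrightarrow> seq_class \<A> C \<xi> = ClsE (seq_equiv \<A> C `` zero_seqs \<A> C t A B)"
    if "spliced \<A> C B \<xi> A" "length \<xi> = t" for \<xi>
  proof -
    have "null_seq B \<xi> A \<longleftrightarrow> (\<exists>\<omega> \<in> zero_seqs \<A> C t A B. (\<omega>, \<xi>) \<in> seq_equiv \<A> C)"
      using null_seq_iff[OF that(1)] that(2) assms(3) by auto
    also have "\<dots> \<longleftrightarrow> seq_equiv \<A> C `` {\<xi>} = seq_equiv \<A> C `` zero_seqs \<A> C t A B"
    proof
      assume "\<exists>\<omega> \<in> zero_seqs \<A> C t A B. (\<omega>, \<xi>) \<in> seq_equiv \<A> C"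
      then obtain \<omega> where w: "\<omega> \<in> zero_seqs \<A> C t A B" "(\<omega>, \<xi>) \<in> seq_equiv \<A> C" by blast
      show "seq_equiv \<A> C `` {\<xi>} = seq_equiv \<A> C `` zero_seqs \<A> C t A B"
      proof (intro equalityI subsetI)
        fix \<tau> assume "\<tau> \<in> seq_equiv \<A> C `` {\<xi>}"
        then show "\<tau> \<in> seq_equiv \<A> C `` zero_seqs \<A> C t A B" using w seq_equiv_trans by blast
      next
        fix \<tau> assume "\<tau> \<in> seq_equiv \<A> C `` zero_seqs \<A> C t A B"
        then obtain \<omega>' where "\<omega>' \<in> zero_seqs \<A> C t A B" "(\<omega>', \<tau>) \<in> seq_equiv \<A> C" by blast
        then have "(\<omega>, \<tau>) \<in> seq_equiv \<A> C" using z[OF w(1)] seq_equiv_trans by blast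
        then show "\<tau> \<in> seq_equiv \<A> C `` {\<xi>}" using seq_equiv_trans[OF seq_equiv_sym[OF w(2)]] by blast
      qed
    next
      assume "seq_equiv \<A> C `` {\<xi>} = seq_equiv \<A> C `` zero_seqs \<A> C t A B"
      moreover have "\<xi> \<in> seq_equiv \<A> C `` {\<xi>}" by simp
      ultimately show "\<exists>\<omega> \<in> zero_seqs \<A> C t A B. (\<omega>, \<xi>) \<in> seq_equiv \<A> C" by blast
    qed
    finally show ?thesis by (simp add: seq_class_def)
  qed
  \<comment> \<open>Vanishing is equality with a singleton, so an actual element has to be exhibited
    as well.\<close>
  obtain \<omega> where w: "\<omega> \<in> zero_seqs \<A> C t A B" using ex_zero_seq[OF assms] by blast
  note W = zero_seqs_spliced[OF w assms(1,2)]
  have ne: "seq_class \<A> C \<omega> \<in> Ext \<A> C t A B" using W unfolding Ext_iff[OF assms(3)] by blast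
  show ?thesis unfolding E
  proof (intro iffI allI impI)
    fix \<xi>
    assume "Ext \<A> C t A B = {ClsE (seq_equiv \<A> C `` zero_seqs \<A> C t A B)}"
      and x: "spliced \<A> C B \<xi> A" "length \<xi> = t"
    moreover have "seq_class \<A> C \<xi> \<in> Ext \<A> C t A B" using x unfolding Ext_iff[OF assms(3)] by blast
    ultimately show "null_seq B \<xi> A" unfolding nz[OF x] by simp
  next
    assume n: "\<forall>\<xi>. spliced \<A> C B \<xi> A \<longrightarrow> length \<xi> = t \<longrightarrow> null_seq B \<xi> A"
    have "\<gamma> = ClsE (seq_equiv \<A> C `` zero_seqs \<A> C t A B)" if \<gamma>: "\<gamma> \<in> Ext \<A> C t A B" for \<gamma>
    proof -
      obtain \<xi> where x: "length \<xi> = t" "spliced \<A> C B \<xi> A" "\<gamma> = seq_class \<A> C \<xi>"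
        using \<gamma> unfolding Ext_iff[OF assms(3)] by blast
      then show ?thesis using n nz[OF x(2,1)] by simp
    qed
    then have "Ext \<A> C t A B \<subseteq> {ClsE (seq_equiv \<A> C `` zero_seqs \<A> C t A B)}" by (simp add: subset_iff)
    from subset_singletonD[OF this] show "Ext \<A> C t A B = {ClsE (seq_equiv \<A> C `` zero_seqs \<A> C t A B)}"
      using ne by (elim disjE) simp_all
  qed
qed

end

section \<open>n-Frobenius categories\<close>

context n_Frobenius_category
begin

text \<open>As n-projectives and n-injectives coincide, this one predicate stands for both.\<close>

abbreviation proj :: "'a \<Rightarrow> bool" where "proj P \<equiv> n_projective \<A> C n P"

lemma proj_C: "proj P \<Longrightarrow> P \<in> C"
  by (simp add: n_projective_def)

lemma proj_null:
  assumes "proj P" "X \<in> C" "length \<xi> > n" "spliced \<A> C X \<xi> P"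
  shows "null_seq X \<xi> P"
proof -
  have "Ext_vanishes \<A> C (length \<xi>) P X" "length \<xi> \<noteq> 0" using assms(1-3) by (auto simp: n_projective_def)
  then show ?thesis using assms(4) Ext_vanishes_iff[OF proj_C[OF assms(1)] assms(2)] by blast
qed

lemma inj_null:
  assumes "proj P" "X \<in> C" "length \<xi> > n" "spliced \<A> C P \<xi> X"
  shows "null_seq P \<xi> X"
proof -
  have "Ext_vanishes \<A> C (length \<xi>) X P" "length \<xi> \<noteq> 0"
    using assms(1-3) unfolding n_projective_iff_n_injective by (auto simp: n_injective_def)
  then show ?thesis using assms(4) Ext_vanishes_iff[OF assms(2) proj_C[OF assms(1)]] by blast
qed

text \<open>Dimension shift, carried out on the n-injective side: splicing with
  \<open>(j, q)\<close> raises the degree by one and gives a null class, so the original class comes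
  from one with left end \<open>src \<A> q\<close>, where it vanishes too.\<close>

lemma proj_cokernel:
  assumes "conflation \<A> C j q" "proj (src \<A> j)" "proj (tgt \<A> j)"
  shows "proj (tgt \<A> q)"
proof -
  note D = conflationD[OF assms(1)]
  have "Ext_vanishes \<A> C t X (tgt \<A> q)" if t: "t > n" and X: "X \<in> C" for t X
  proof -
    have t0: "t \<noteq> 0" using t by simp
    show ?thesis unfolding Ext_vanishes_iff[OF X D(6) t0]
    proof (intro allI impI)
      fix \<xi> assume x: "spliced \<A> C (tgt \<A> q) \<xi> X" "length \<xi> = t"
      have "null_seq (src \<A> j) ((j, q) # \<xi>) X"
        by (rule inj_null[OF assms(2) X]) (use x t assms(1) in simp_all)
      moreover have "\<xi> \<noteq> []" using x t0 by auto
      ultimately obtain y where y: "spliced \<A> C (src \<A> q) y X" "length y = length \<xi>" "seq_map \<A> q y \<xi> (idm \<A> X)"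
        by (rule connecting_exact_seq)
      have "null_seq (src \<A> q) y X"
        by (rule inj_null[OF _ X]) (use assms(3) D(3) x t y in simp_all)
      then show "null_seq (tgt \<A> q) \<xi> X"
        by (rule null_seq_map_left[OF _ x(1) _ y(3)]) (use D in \<open>simp add: Hom_iff\<close>)
    qed
  qed
  then show ?thesis unfolding n_projective_iff_n_injective n_injective_def using D(6) by blast
qed

text \<open>Yields factorizations through an n-projective on the right. Each conflation is pushed
  out to start at \<open>P\<close>, its middle term is embedded into an n-injective
  \<open>I\<close>, and the cokernel of the composite inflation from \<open>P\<close> to
  \<open>I\<close> is the next splicing object, n-projective by
  \<open>proj_cokernel\<close>.\<close>

lemma map_into_proj:
  assumes "spliced \<A> C B \<xi> A" "g \<in> Hom \<A> B P" "proj P" "B \<in> C"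
  obtains \<zeta> P' b where "proj P'" "spliced \<A> C P \<zeta> P'" "seq_map \<A> g \<xi> \<zeta> b" "b \<in> Hom \<A> A P'"
proof -
  have "\<exists>\<zeta> P' b. proj P' \<and> spliced \<A> C P \<zeta> P' \<and> seq_map \<A> g \<xi> \<zeta> b"
    using assms
  proof (induction \<xi> arbitrary: B g P)
    case Nil
    then show ?case by (intro exI[of _ "[]"] exI[of _ P] exI[of _ g]) simp
  next
    case (Cons ip \<rho>)
    obtain i p where ip: "ip = (i, p)" by force
    have c: "conflation \<A> C i p" "src \<A> i = B" "spliced \<A> C (tgt \<A> p) \<rho> A" using Cons.prems ip by auto
    note D = conflationD[OF c(1)]
    have g: "g \<in> Mor \<A>" "src \<A> g = B" "tgt \<A> g = P" "P \<in> C" using Cons.prems by (auto simp: Hom_iff proj_C)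
    obtain x i' p' where po: "is_pushout \<A> i g x i'" and p': "p' \<in> Hom \<A> (tgt \<A> i') (tgt \<A> p)" "p' \<cdot> x = p"
      "p' \<cdot> i' = zer \<A> (src \<A> i') (tgt \<A> p)" and c': "conflation \<A> C i' p'"
      by (rule ex_pushout_conflation[OF c(1) g(1)]) (use g c(2) in auto)
    note F = conflationD[OF c'] and Q = pushoutD[OF po]
    have tp: "tgt \<A> p' = tgt \<A> p" using p'(1) by (simp add: Hom_iff)
    obtain I e where e: "n_injective \<A> C n I" "e \<in> Hom \<A> (src \<A> p') I" "inflation \<A> C e"
      using enough_n_injectives[OF F(5)] by blast
    obtain r where r: "conflation \<A> C e r" using e(3) by (auto simp: inflation_def)
    note G = conflationD[OF r]
    have eI: "src \<A> e = src \<A> p'" "tgt \<A> e = I" using e(2) by (simp_all add: Hom_iff)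
    \<comment> \<open>This push-out computes the cokernel \<open>y\<close> of
      \<open>e \<cdot> i'\<close>; its other leg \<open>e'\<close> is the map with which the
      recursion continues.\<close>
    obtain y e' r' where po': "is_pushout \<A> e p' y e'" and c'': "conflation \<A> C e' r'"
      by (rule ex_pushout_conflation[OF r F(2) eI(1) F(6)])
    note R = pushoutD[OF po'] and H = conflationD[OF c'']
    have se: "is_short_exact \<A> (e \<cdot> i') y"
      by (rule short_exact_cmp[OF F(7) G(7) _ po']) (use F(3) eI in simp)
    have T: "e \<cdot> i' \<in> Mor \<A>" "src \<A> (e \<cdot> i') = P" "tgt \<A> (e \<cdot> i') = I" "tgt \<A> y = tgt \<A> e'"
      using F(1,3) G(1) eI Q(8) R(7) g by simp_all
    \<comment> \<open>\<open>tgt \<A> y\<close> is the middle term of the pushed-out conflation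
      \<open>(e', r')\<close>, hence an object of \<open>C\<close>.\<close>
    have tyC: "tgt \<A> y \<in> C" using H(3,5) T(4) by simp
    have cy: "conflation \<A> C (e \<cdot> i') y"
      unfolding conflation_def using se T tyC g(4) G(3,5) eI by simp
    have "proj I" using e(1) n_projective_iff_n_injective by blast
    then have pK: "proj (tgt \<A> y)" using proj_cokernel[OF cy] T Cons.prems(3) by simp
    have e'H: "e' \<in> Hom \<A> (tgt \<A> p) (tgt \<A> y)" using R tp by (simp add: Hom_iff)
    obtain \<zeta> P' b where z: "proj P'" "spliced \<A> C (tgt \<A> y) \<zeta> P'" "seq_map \<A> e' \<rho> \<zeta> b"
      using Cons.IH[OF c(3) e'H pK D(6)] by blast
    have t: "x \<in> Mor \<A>" "src \<A> x = src \<A> p" "tgt \<A> x = src \<A> e" using Q(4,5,7) D(3) F(3) eI by simp_all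
    have "e \<cdot> x \<cdot> i = e \<cdot> i' \<cdot> g"
      using t G(1) D(1,3) Q(6,8,9) F(1,3) eI g by simp
    moreover have "e' \<cdot> p = y \<cdot> (e \<cdot> x)"
      using cmp_eq[OF R(9), of x] p'(2) t eI R(1,2,4,5,6,8) by simp
    ultimately have "seq_map \<A> g ((i, p) # \<rho>) ((e \<cdot> i', y) # \<zeta>) b"
      unfolding seq_map.simps using z(3) e'H t T(3) G(1) eI D(3)
      by (intro bexI[of _ "e \<cdot> x"] bexI[of _ e']) (simp_all add: Hom_iff)
    moreover have "spliced \<A> C P ((e \<cdot> i', y) # \<zeta>) P'" using cy T z by simp
    ultimately show ?case using z(1) ip by blast
  qed
  then obtain \<zeta> P' b where z: "proj P'" "spliced \<A> C P \<zeta> P'" "seq_map \<A> g \<xi> \<zeta> b" by blast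
  show ?thesis by (rule that[OF z seq_map_Hom[OF z(3) assms(1) z(2) assms(2)]])
qed

section \<open>Resolutions by n-projectives and their cancellation\<close>

lemma ex_proj_resolution:
  assumes "X \<in> C"
  shows "\<exists>K \<delta>. spliced \<A> C K \<delta> X \<and> length \<delta> = t \<and> (\<forall>(i, p) \<in> set \<delta>. proj (tgt \<A> i)) \<and> K \<in> C"
proof (induction t)
  case 0
  then show ?case using assms by (intro exI[of _ X] exI[of _ "[]"]) simp
next
  case (Suc t)
  then obtain K \<delta> where d: "spliced \<A> C K \<delta> X" "length \<delta> = t" "\<forall>(i, p) \<in> set \<delta>. proj (tgt \<A> i)" "K \<in> C" by blast
  obtain P p i where p: "proj P" "p \<in> Hom \<A> P K" "conflation \<A> C i p"
    using enough_n_projectives[OF d(4)] by (auto simp: deflation_def)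
  note D = conflationD[OF p(3)]
  have "src \<A> p = P" "tgt \<A> p = K" using p(2) by (simp_all add: Hom_iff)
  then show ?case using d p D by (intro exI[of _ "src \<A> i"] exI[of _ "(i, p) # \<delta>"]) simp
qed

lemma ex_inj_resolution:
  assumes "X \<in> C"
  shows "\<exists>K \<theta>. spliced \<A> C X \<theta> K \<and> length \<theta> = t \<and> (\<forall>(i, p) \<in> set \<theta>. proj (tgt \<A> i)) \<and> K \<in> C"
proof (induction t)
  case 0
  then show ?case using assms by (intro exI[of _ X] exI[of _ "[]"]) simp
next
  case (Suc t)
  then obtain K \<theta> where d: "spliced \<A> C X \<theta> K" "length \<theta> = t" "\<forall>(i, p) \<in> set \<theta>. proj (tgt \<A> i)" "K \<in> C" by blast
  obtain I i p where p: "n_injective \<A> C n I" "i \<in> Hom \<A> K I" "conflation \<A> C i p"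
    using enough_n_injectives[OF d(4)] by (auto simp: inflation_def)
  note D = conflationD[OF p(3)]
  have "src \<A> i = K" "tgt \<A> i = I" "proj I" using p(1,2) n_projective_iff_n_injective by (simp_all add: Hom_iff)
  then show ?case using d p(3) D by (intro exI[of _ "tgt \<A> p"] exI[of _ "\<theta> @ [(i, p)]"]) (auto simp: spliced_append)
qed

text \<open>Conflations are peeled off from the left. As long as part of \<open>\<delta>\<close>
  remains, the lift is longer than n and has an n-injective left end, so it vanishes and the
  shortened sequence is null again.\<close>

lemma cancel_proj_resolution:
  assumes "null_seq K (\<delta> @ \<xi>) Y" "spliced \<A> C K \<delta> N" "spliced \<A> C N \<xi> Y" "\<forall>(i, p) \<in> set \<delta>. proj (tgt \<A> i)"
    "\<delta> \<noteq> []" "\<xi> \<noteq> []" "length \<xi> \<ge> n"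
  obtains P p y where "proj P" "p \<in> Hom \<A> P N" "spliced \<A> C P y Y" "seq_map \<A> p y \<xi> (idm \<A> Y)" "length y = length \<xi>"
  using assms
proof (induction \<delta> arbitrary: K thesis)
  case (Cons ip \<delta>)
  obtain i p where ip: "ip = (i, p)" by force
  have c: "conflation \<A> C i p" "spliced \<A> C (tgt \<A> p) \<delta> N" "proj (src \<A> p)"
    using Cons.prems ip conflationD(3)[of i p] by auto
  note D = conflationD[OF c(1)]
  have Y: "Y \<in> C" using spliced_C(2)[OF Cons.prems(4)] Cons.prems(7) by blast
  have p: "p \<in> Hom \<A> (src \<A> p) (tgt \<A> p)" using D by (simp add: Hom_iff)
  have sp: "spliced \<A> C (tgt \<A> p) (\<delta> @ \<xi>) Y" using c(2) Cons.prems(4) by (auto simp: spliced_append)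
  have "null_seq K ((i, p) # (\<delta> @ \<xi>)) Y" using Cons.prems(2) ip by simp
  then obtain y where y: "spliced \<A> C (src \<A> p) y Y" "length y = length (\<delta> @ \<xi>)" "seq_map \<A> p y (\<delta> @ \<xi>) (idm \<A> Y)"
    by (rule connecting_exact_seq) (use Cons.prems(7) in auto)
  show ?case
  proof (cases "\<delta> = []")
    case True
    \<comment> \<open>After the last conflation the lift has the length of \<open>\<xi>\<close>,
      possibly exactly n, where nothing forces it to vanish; the lift itself is the result.\<close>
    then have "tgt \<A> p = N" using c(2) by simp
    then show ?thesis using Cons.prems(1)[OF c(3)] p y True by simp
  next
    case False
    then have "length y > n" using y(2) Cons.prems(8) by (cases \<delta>) simp_all
    then have "null_seq (src \<A> p) y Y" by (rule inj_null[OF c(3) Y _ y(1)])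
    then have "null_seq (tgt \<A> p) (\<delta> @ \<xi>) Y" by (rule null_seq_map_left[OF _ sp p y(3)])
    then show ?thesis
      by (rule Cons.IH[rotated]) (use c Cons.prems False in auto)
  qed
qed simp

text \<open>The mirror image: conflations are removed from the right, and lifts vanish because the
  middle terms of \<open>\<theta>\<close> are n-projective.\<close>

lemma cancel_inj_resolution:
  assumes "null_seq Y (\<xi> @ \<theta>) K" "spliced \<A> C Y \<xi> M" "spliced \<A> C M \<theta> K" "\<forall>(i, p) \<in> set \<theta>. proj (tgt \<A> i)"
    "\<theta> \<noteq> []" "\<xi> \<noteq> []" "length \<xi> \<ge> n"
  obtains Q i y where "proj Q" "i \<in> Hom \<A> M Q" "spliced \<A> C Y y Q" "seq_map \<A> (idm \<A> Y) \<xi> y i" "length y = length \<xi>"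
  using assms
proof (induction \<theta> arbitrary: K thesis rule: rev_induct)
  case (snoc ip \<theta>)
  obtain i p where ip: "ip = (i, p)" by force
  have c: "conflation \<A> C i p" "spliced \<A> C M \<theta> (src \<A> i)" "proj (tgt \<A> i)"
    using snoc.prems ip by (auto simp: spliced_append)
  note D = conflationD[OF c(1)]
  have Y: "Y \<in> C" using spliced_C(1)[OF snoc.prems(3)] snoc.prems(7) by blast
  have sp: "spliced \<A> C Y (\<xi> @ \<theta>) (src \<A> i)" using c(2) snoc.prems(3) by (auto simp: spliced_append)
  have "null_seq Y ((\<xi> @ \<theta>) @ [(i, p)]) K" using snoc.prems(2) ip by simp
  then obtain y where y: "spliced \<A> C Y y (tgt \<A> i)" "length y = length (\<xi> @ \<theta>)" "seq_map \<A> (idm \<A> Y) (\<xi> @ \<theta>) y i"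
    by (rule connecting_exact_seq') (use snoc.prems(7) in auto)
  show ?case
  proof (cases "\<theta> = []")
    case True
    then have "src \<A> i = M" using c(2) by simp
    then have "i \<in> Hom \<A> M (tgt \<A> i)" using D by (simp add: Hom_iff)
    then show ?thesis using snoc.prems(1)[OF c(3)] y True by simp
  next
    case False
    then have "length y > n" using y(2) snoc.prems(8) by (cases \<theta>) simp_all
    then have "null_seq Y y (tgt \<A> i)" by (rule proj_null[OF c(3) Y _ y(1)])
    then have "null_seq Y (\<xi> @ \<theta>) (src \<A> i)" by (rule null_seq_map_right[OF _ sp D(4) y(3)])
    then show ?thesis
      by (rule snoc.IH[rotated]) (use c snoc.prems False in auto)
  qed
qed simp

text \<open>Testing on identity morphisms turns both conditions into one: \<open>f\<close> factors
  through an n-projective.\<close>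

lemma pull_iff_push_degree_0:
  assumes "f \<in> Hom \<A> M N" "M \<in> C" "N \<in> C" "n = 0"
  shows "(\<forall>Y \<in> C. \<forall>\<gamma> \<in> Ext \<A> C n N Y. pull \<A> C \<gamma> f \<in> PExt \<A> C n M Y)
     \<longleftrightarrow> (\<forall>Y \<in> C. \<forall>\<gamma> \<in> Ext \<A> C n Y M. push \<A> C f \<gamma> \<in> PExt \<A> C n Y N)" (is "?L \<longleftrightarrow> ?R")
proof -
  have mem: "HomE h \<in> PExt \<A> C n X Y \<longleftrightarrow> (\<exists>P a e. proj P \<and> a \<in> Hom \<A> X P \<and> e \<in> Hom \<A> P Y \<and> h = e \<cdot> a)" for h X Y
  proof
    assume "HomE h \<in> PExt \<A> C n X Y"
    then obtain \<eta> a P where P: "HomE h = pull \<A> C \<eta> a" "proj P" "a \<in> Hom \<A> X P" "\<eta> \<in> Ext \<A> C n P Y"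
      unfolding PExt_def by blast
    then obtain e where "\<eta> = HomE e" "e \<in> Hom \<A> P Y" using assms(4) by (auto simp: Ext_def)
    with P show "\<exists>P a e. proj P \<and> a \<in> Hom \<A> X P \<and> e \<in> Hom \<A> P Y \<and> h = e \<cdot> a" by auto
  next
    assume "\<exists>P a e. proj P \<and> a \<in> Hom \<A> X P \<and> e \<in> Hom \<A> P Y \<and> h = e \<cdot> a"
    then obtain P a e where P: "proj P" "a \<in> Hom \<A> X P" "e \<in> Hom \<A> P Y" "h = e \<cdot> a" by blast
    then have "HomE h = pull \<A> C (HomE e) a" "HomE e \<in> Ext \<A> C n P Y" using assms(4) by (auto simp: Ext_def)
    with P show "HomE h \<in> PExt \<A> C n X Y" unfolding PExt_def by blast
  qed
  have f: "f \<in> Mor \<A>" "src \<A> f = M" "tgt \<A> f = N" using assms(1) by (auto simp: Hom_iff)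
  have i: "HomE (idm \<A> X) \<in> Ext \<A> C n X X" if "X \<in> C" for X
    using that assms(4) by (simp add: Ext_def Hom_iff)
  have L: "HomE f \<in> PExt \<A> C n M N" if ?L
  proof -
    have "pull \<A> C (HomE (idm \<A> N)) f \<in> PExt \<A> C n M N" using that assms(3) i by blast
    then show ?thesis using f by simp
  qed
  have R: "HomE f \<in> PExt \<A> C n M N" if ?R
  proof -
    have "push \<A> C f (HomE (idm \<A> M)) \<in> PExt \<A> C n M N" using that assms(2) i by blast
    then show ?thesis using f by simp
  qed
  have "?L \<and> ?R" if "HomE f \<in> PExt \<A> C n M N"
  proof -
    obtain P a e where P: "proj P" "a \<in> Hom \<A> M P" "e \<in> Hom \<A> P N" "f = e \<cdot> a" using \<open>HomE f \<in> _\<close> mem by blast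
    show ?thesis
    proof (intro conjI ballI)
      fix Y \<gamma> assume "\<gamma> \<in> Ext \<A> C n Y M"
      then obtain g where g: "\<gamma> = HomE g" "g \<in> Hom \<A> Y M" using assms(4) by (auto simp: Ext_def)
      have "f \<cdot> g = e \<cdot> (a \<cdot> g)" "a \<cdot> g \<in> Hom \<A> Y P"
        unfolding P(4) using P(2,3) g(2) by (auto simp: Hom_iff)
      then show "push \<A> C f \<gamma> \<in> PExt \<A> C n Y N" unfolding g push.simps mem using P by blast
    next
      fix Y \<gamma> assume "\<gamma> \<in> Ext \<A> C n N Y"
      then obtain g where g: "\<gamma> = HomE g" "g \<in> Hom \<A> N Y" using assms(4) by (auto simp: Ext_def)
      have "g \<cdot> f = g \<cdot> e \<cdot> a" "g \<cdot> e \<in> Hom \<A> P Y"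
        unfolding P(4) using P(2,3) g(2) by (auto simp: Hom_iff)
      then show "pull \<A> C \<gamma> f \<in> PExt \<A> C n M Y" unfolding g pull.simps mem using P by blast
    qed
  qed
  then show ?thesis using L R by blast
qed

text \<open>Replaces the operation on classes by one explicit morphism of sequences up to
  equivalence, the form in which both implications use and produce membership.\<close>

lemma seq_class_in_PExt_iff:
  assumes "spliced \<A> C B \<xi> A" "length \<xi> = n" "n \<noteq> 0"
  shows "seq_class \<A> C \<xi> \<in> PExt \<A> C n A B \<longleftrightarrow> (\<exists>P a \<epsilon> \<zeta>. proj P \<and> a \<in> Hom \<A> A P \<and> spliced \<A> C B \<epsilon> P \<and> length \<epsilon> = n
    \<and> spliced \<A> C B \<zeta> A \<and> seq_map \<A> (idm \<A> B) \<zeta> \<epsilon> a \<and> (\<xi>, \<zeta>) \<in> seq_equiv \<A> C)"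
proof
  have ne: "\<xi> \<noteq> []" using assms by auto
  have C: "B \<in> C" "A \<in> C" using spliced_C[OF assms(1)] ne by blast+
  {
    assume "seq_class \<A> C \<xi> \<in> PExt \<A> C n A B"
    then obtain \<eta> a P where P: "proj P" "a \<in> Hom \<A> A P" "\<eta> \<in> Ext \<A> C n P B" "seq_class \<A> C \<xi> = pull \<A> C \<eta> a"
      unfolding PExt_def by blast
    obtain \<epsilon> where e: "length \<epsilon> = n" "spliced \<A> C B \<epsilon> P" "\<eta> = seq_class \<A> C \<epsilon>"
      using P(3) unfolding Ext_iff[OF assms(3)] by blast
    have ne': "\<epsilon> \<noteq> []" using e assms(3) by auto
    obtain \<zeta> where z: "seq_pullback \<A> a \<epsilon> \<zeta>" using ex_seq_pullback[OF e(2) ne' P(2) C(2)] .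
    note Z = seq_pullbackD[OF e(2) z P(2) C(2)]
    have "seq_class \<A> C \<xi> = seq_class \<A> C \<zeta>"
      unfolding P(4) e(3) by (rule pull_seq_class[OF e(2) ne' P(2) Z(1,2)])
    then have "(\<xi>, \<zeta>) \<in> seq_equiv \<A> C" unfolding seq_class_eq_iff .
    then show "\<exists>P a \<epsilon> \<zeta>. proj P \<and> a \<in> Hom \<A> A P \<and> spliced \<A> C B \<epsilon> P \<and> length \<epsilon> = n
      \<and> spliced \<A> C B \<zeta> A \<and> seq_map \<A> (idm \<A> B) \<zeta> \<epsilon> a \<and> (\<xi>, \<zeta>) \<in> seq_equiv \<A> C"
      using P(1,2) e(1,2) Z(1,2) by blast
  next
    assume "\<exists>P a \<epsilon> \<zeta>. proj P \<and> a \<in> Hom \<A> A P \<and> spliced \<A> C B \<epsilon> P \<and> length \<epsilon> = n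
      \<and> spliced \<A> C B \<zeta> A \<and> seq_map \<A> (idm \<A> B) \<zeta> \<epsilon> a \<and> (\<xi>, \<zeta>) \<in> seq_equiv \<A> C"
    then obtain P a \<epsilon> \<zeta> where P: "proj P" "a \<in> Hom \<A> A P" "spliced \<A> C B \<epsilon> P" "length \<epsilon> = n"
      "spliced \<A> C B \<zeta> A" "seq_map \<A> (idm \<A> B) \<zeta> \<epsilon> a" "(\<xi>, \<zeta>) \<in> seq_equiv \<A> C" by blast
    have "\<epsilon> \<noteq> []" using P(4) assms(3) by auto
    then have "pull \<A> C (seq_class \<A> C \<epsilon>) a = seq_class \<A> C \<zeta>" by (rule pull_seq_class[OF P(3) _ P(2,5,6)])
    also have "\<dots> = seq_class \<A> C \<xi>" unfolding seq_class_eq_iff by (rule seq_equiv_sym) (rule P)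
    finally have "seq_class \<A> C \<xi> = pull \<A> C (seq_class \<A> C \<epsilon>) a" ..
    moreover have "seq_class \<A> C \<epsilon> \<in> Ext \<A> C n P B" unfolding Ext_iff[OF assms(3)] using P(3,4) by blast
    ultimately show "seq_class \<A> C \<xi> \<in> PExt \<A> C n A B" unfolding PExt_def using P(1,2) by blast
  }
qed

lemma push_in_PExt:
  assumes n: "n \<noteq> 0" and f: "f \<in> Hom \<A> M N" "M \<in> C" "N \<in> C"
    and L: "\<forall>Y \<in> C. \<forall>\<gamma> \<in> Ext \<A> C n N Y. pull \<A> C \<gamma> f \<in> PExt \<A> C n M Y"
    and Y: "Y \<in> C" and \<gamma>: "\<gamma> \<in> Ext \<A> C n Y M"
  shows "push \<A> C f \<gamma> \<in> PExt \<A> C n Y N"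
proof -
  have idm: "idm \<A> X \<in> Hom \<A> X X" if "X \<in> C" for X
    using that by (simp add: Hom_iff)
  obtain \<xi> where x: "length \<xi> = n" "spliced \<A> C M \<xi> Y" "\<gamma> = seq_class \<A> C \<xi>"
    using \<gamma> unfolding Ext_iff[OF n] by blast
  have ne: "\<xi> \<noteq> []" using x n by auto
  obtain \<xi>' where po: "seq_pushout \<A> f \<xi> \<xi>'" using ex_seq_pushout[OF x(2) ne f(1,3)] .
  note X' = seq_pushoutD[OF x(2) po f(1,3)]
  have pf: "push \<A> C f \<gamma> = seq_class \<A> C \<xi>'"
    unfolding x(3) by (rule push_seq_class[OF x(2) ne f(1) X'(1,2)])
  obtain K \<delta> where d: "spliced \<A> C K \<delta> N" "length \<delta> = n" "\<forall>(i, p) \<in> set \<delta>. proj (tgt \<A> i)" "K \<in> C"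
    using ex_proj_resolution[OF f(3)] by blast
  have dne: "\<delta> \<noteq> []" using d n by auto
  obtain \<delta>' where pb: "seq_pullback \<A> f \<delta> \<delta>'" using ex_seq_pullback[OF d(1) dne f(1,2)] .
  note D' = seq_pullbackD[OF d(1) pb f(1,2)]
  have "seq_class \<A> C \<delta> \<in> Ext \<A> C n N K" unfolding Ext_iff[OF n] using d by blast
  then have "pull \<A> C (seq_class \<A> C \<delta>) f \<in> PExt \<A> C n M K" using L d(4) by blast
  then have "seq_class \<A> C \<delta>' \<in> PExt \<A> C n M K"
    unfolding pull_seq_class[OF d(1) dne f(1) D'(1,2)] .
  moreover have "length \<delta>' = n" using D'(5) d(2) by simp
  ultimately obtain P a \<epsilon> \<zeta> where P: "proj P" "a \<in> Hom \<A> M P" "spliced \<A> C K \<epsilon> P" "length \<epsilon> = n"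
    "spliced \<A> C K \<zeta> M" "seq_map \<A> (idm \<A> K) \<zeta> \<epsilon> a" "(\<delta>', \<zeta>) \<in> seq_equiv \<A> C"
    unfolding seq_class_in_PExt_iff[OF D'(1) \<open>length \<delta>' = n\<close> n] by blast
  note PC = proj_C[OF P(1)]
  \<comment> \<open>\<open>\<xi>a\<close> represents \<open>a\<gamma>\<close>. Its left end
    \<open>P\<close> is n-injective, so it maps to a sequence \<open>\<tau>\<close> whose right end
    \<open>P'\<close> is n-projective.\<close>
  obtain \<xi>a where pa: "seq_pushout \<A> a \<xi> \<xi>a" using ex_seq_pushout[OF x(2) ne P(2) PC] .
  note Xa = seq_pushoutD[OF x(2) pa P(2) PC]
  obtain \<tau> P' b where t: "proj P'" "spliced \<A> C P \<tau> P'" "seq_map \<A> (idm \<A> P) \<xi>a \<tau> b" "b \<in> Hom \<A> Y P'"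
    using map_into_proj[OF Xa(1) idm[OF PC] P(1) PC] .
  have sp: "spliced \<A> C K (\<epsilon> @ \<tau>) P'" "spliced \<A> C K (\<epsilon> @ \<xi>a) Y" "spliced \<A> C K (\<zeta> @ \<xi>) Y"
    "spliced \<A> C K (\<delta>' @ \<xi>) Y" "spliced \<A> C K (\<delta> @ \<xi>') Y"
    using P(3,5) t(2) Xa(1) x(2) D'(1) d(1) X'(1) unfolding spliced_append by blast+
  have "length \<tau> = n" using seq_map_length[OF t(3)] Xa(5) x(1) by simp
  \<comment> \<open>The length is n + n, which exceeds n because n is nonzero.\<close>
  then have "null_seq K (\<epsilon> @ \<tau>) P'"
    using P(4) n by (intro proj_null[OF t(1) d(4) _ sp(1)]) simp
  \<comment> \<open>With \<open>\<eta>\<close> the class of \<open>\<epsilon>\<close>, vanishing is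
    now carried along \<open>\<eta>\<tau>b = \<eta>(a\<gamma>) = (\<eta>a)\<gamma> =
    (\<delta>f)\<gamma> = \<delta>(f\<gamma>)\<close>. The third equality is an equivalence of
    sequences; each of the others is a single morphism.\<close>
  moreover have "seq_map \<A> (idm \<A> K) (\<epsilon> @ \<xi>a) (\<epsilon> @ \<tau>) b"
    by (rule seq_map_append[OF seq_map_refl[OF P(3) d(4)] t(3)])
  ultimately have "null_seq K (\<epsilon> @ \<xi>a) Y"
    by (rule null_seq_map_right[OF _ sp(2) Y])
  then have "null_seq K (\<zeta> @ \<xi>) Y"
    by (rule null_seq_map_right[OF _ sp(3) Y seq_map_append[OF P(6) Xa(2)]])
  then have "null_seq K (\<delta>' @ \<xi>) Y"
    by (intro null_seq_equiv[OF seq_equiv_sym[OF seq_equiv_append[OF P(7) D'(1,4) x(2)]] sp(3)]) (use ne in auto)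
  then have "null_seq K (\<delta> @ \<xi>') Y"
    by (rule null_seq_map_left[OF _ sp(5) idm[OF d(4)] seq_map_append[OF D'(2) X'(2)]])
  then obtain P1 p1 y where y: "proj P1" "p1 \<in> Hom \<A> P1 N" "spliced \<A> C P1 y Y" "seq_map \<A> p1 y \<xi>' (idm \<A> Y)" "length y = length \<xi>'"
    by (rule cancel_proj_resolution[OF _ d(1) X'(1) d(3) dne X'(4)]) (use X'(5) x(1) in auto)
  note P1C = proj_C[OF y(1)]
  have yne: "y \<noteq> []" using y(5) X'(4) by auto
  \<comment> \<open>Membership in \<open>PExt\<close> asks for an n-projective at the right end,
    while \<open>y\<close> has one at the left; \<open>map_into_proj\<close> provides the change of
    side.\<close>
  obtain \<tau>1 P2 b1 where t1: "proj P2" "spliced \<A> C P1 \<tau>1 P2" "seq_map \<A> (idm \<A> P1) y \<tau>1 b1" "b1 \<in> Hom \<A> Y P2"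
    using map_into_proj[OF y(3) idm[OF P1C] y(1) P1C] .
  have l1: "length \<tau>1 = n" using seq_map_length[OF t1(3)] y(5) X'(5) x(1) by simp
  then have t1ne: "\<tau>1 \<noteq> []" using n by auto
  \<comment> \<open>The factorization is
    \<open>f\<gamma> = p1 y = p1(\<tau>1 b1) = (p1 \<tau>1)b1\<close>: \<open>\<tau>2\<close>
    represents \<open>p1 \<tau>1\<close>, and \<open>y1\<close> represents
    \<open>p1 y\<close>.\<close>
  obtain \<tau>2 where p2: "seq_pushout \<A> p1 \<tau>1 \<tau>2" using ex_seq_pushout[OF t1(2) t1ne y(2) f(3)] .
  note T2 = seq_pushoutD[OF t1(2) p2 y(2) f(3)]
  obtain y1 where py: "seq_pushout \<A> p1 y y1" using ex_seq_pushout[OF y(3) yne y(2) f(3)] .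
  note Y1 = seq_pushoutD[OF y(3) py y(2) f(3)]
  have c: "idm \<A> N \<cdot> p1 = p1" "p1 \<cdot> idm \<A> P1 = p1" "idm \<A> P2 \<cdot> b1 = b1"
    using y(2) t1(4) by (auto simp: Hom_iff)
  have "seq_map \<A> (idm \<A> N) y1 \<xi>' (idm \<A> Y)"
    using seq_pushout_map[OF y(3) py y(2) f(3) idm[OF f(3)] X'(1)] y(4) c by simp
  then have e: "(\<xi>', y1) \<in> seq_equiv \<A> C" by (rule seq_equiv_sym[OF seq_equivI[OF Y1(1) X'(1)]])
  have "seq_map \<A> p1 y \<tau>2 b1"
    using seq_map_trans[OF t1(3) T2(2) y(3) t1(2) T2(1) idm[OF P1C] y(2)] c by simp
  then have "seq_map \<A> (idm \<A> N) y1 \<tau>2 b1"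
    using seq_pushout_map[OF y(3) py y(2) f(3) idm[OF f(3)] T2(1)] c by simp
  moreover have "length \<xi>' = n" "length \<tau>2 = n" using X'(5) x(1) T2(5) l1 by simp_all
  ultimately show ?thesis
    unfolding pf seq_class_in_PExt_iff[OF X'(1) \<open>length \<xi>' = n\<close> n] using t1(1,4) T2(1) Y1(1) e by blast
qed

text \<open>Membership in \<open>PExt\<close> is a factorization at the right end. So here
  \<open>\<epsilon>\<close> already ends in an n-projective, which makes
  \<open>\<xi> @ \<epsilon>\<close> null, and the final cancellation directly yields the required
  factorization through \<open>Q\<close>.\<close>

lemma pull_in_PExt:
  assumes n: "n \<noteq> 0" and f: "f \<in> Hom \<A> M N" "M \<in> C" "N \<in> C"
    and R: "\<forall>Y \<in> C. \<forall>\<gamma> \<in> Ext \<A> C n Y M. push \<A> C f \<gamma> \<in> PExt \<A> C n Y N"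
    and Y: "Y \<in> C" and \<gamma>: "\<gamma> \<in> Ext \<A> C n N Y"
  shows "pull \<A> C \<gamma> f \<in> PExt \<A> C n M Y"
proof -
  obtain \<xi> where x: "length \<xi> = n" "spliced \<A> C Y \<xi> N" "\<gamma> = seq_class \<A> C \<xi>"
    using \<gamma> unfolding Ext_iff[OF n] by blast
  have ne: "\<xi> \<noteq> []" using x n by auto
  obtain \<xi>' where pb: "seq_pullback \<A> f \<xi> \<xi>'" using ex_seq_pullback[OF x(2) ne f(1,2)] .
  note X' = seq_pullbackD[OF x(2) pb f(1,2)]
  have pf: "pull \<A> C \<gamma> f = seq_class \<A> C \<xi>'"
    unfolding x(3) by (rule pull_seq_class[OF x(2) ne f(1) X'(1,2)])
  obtain K \<theta> where d: "spliced \<A> C M \<theta> K" "length \<theta> = n" "\<forall>(i, p) \<in> set \<theta>. proj (tgt \<A> i)" "K \<in> C"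
    using ex_inj_resolution[OF f(2)] by blast
  have dne: "\<theta> \<noteq> []" using d n by auto
  obtain \<theta>' where po: "seq_pushout \<A> f \<theta> \<theta>'" using ex_seq_pushout[OF d(1) dne f(1,3)] .
  note D' = seq_pushoutD[OF d(1) po f(1,3)]
  have "seq_class \<A> C \<theta> \<in> Ext \<A> C n K M" unfolding Ext_iff[OF n] using d by blast
  then have "push \<A> C f (seq_class \<A> C \<theta>) \<in> PExt \<A> C n K N" using R d(4) by blast
  then have "seq_class \<A> C \<theta>' \<in> PExt \<A> C n K N"
    unfolding push_seq_class[OF d(1) dne f(1) D'(1,2)] .
  moreover have "length \<theta>' = n" using D'(5) d(2) by simp
  ultimately obtain P a \<epsilon> \<zeta> where P: "proj P" "a \<in> Hom \<A> K P" "spliced \<A> C N \<epsilon> P" "length \<epsilon> = n"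
    "spliced \<A> C N \<zeta> K" "seq_map \<A> (idm \<A> N) \<zeta> \<epsilon> a" "(\<theta>', \<zeta>) \<in> seq_equiv \<A> C"
    unfolding seq_class_in_PExt_iff[OF D'(1) \<open>length \<theta>' = n\<close> n] by blast
  have sp: "spliced \<A> C Y (\<xi> @ \<epsilon>) P" "spliced \<A> C Y (\<xi> @ \<zeta>) K" "spliced \<A> C Y (\<xi> @ \<theta>') K" "spliced \<A> C Y (\<xi>' @ \<theta>) K"
    using P(3,5) x(2) D'(1) d(1) X'(1) unfolding spliced_append by blast+
  have "null_seq Y (\<xi> @ \<epsilon>) P"
    using P(4) x(1) n by (intro proj_null[OF P(1) Y _ sp(1)]) simp
  then have "null_seq Y (\<xi> @ \<zeta>) K"
    by (rule null_seq_map_right[OF _ sp(2) d(4) seq_map_append[OF seq_map_refl[OF x(2) Y] P(6)]])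
  then have "null_seq Y (\<xi> @ \<theta>') K"
    by (intro null_seq_equiv[OF seq_equiv_sym[OF seq_equiv_prepend[OF P(7) D'(1,4) x(2)]] sp(2)]) (use ne in auto)
  \<comment> \<open>This is \<open>(\<gamma>f)\<theta> = \<gamma>(f\<theta>)\<close>: the pull-back
    and push-out morphisms share \<open>f\<close> at the splice and join to one morphism.\<close>
  then have "null_seq Y (\<xi>' @ \<theta>) K"
    by (rule null_seq_map_right[OF _ sp(4) d(4) seq_map_append[OF X'(2) D'(2)]])
  then obtain Q i y where y: "proj Q" "i \<in> Hom \<A> M Q" "spliced \<A> C Y y Q" "seq_map \<A> (idm \<A> Y) \<xi>' y i" "length y = length \<xi>'"
    by (rule cancel_inj_resolution[OF _ X'(1) d(1) d(3) dne X'(4)]) (use X'(5) x(1) in auto)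
  have "length \<xi>' = n" "length y = n" using y(5) X'(5) x(1) by simp_all
  then show ?thesis
    unfolding pf seq_class_in_PExt_iff[OF X'(1) \<open>length \<xi>' = n\<close> n] using y X'(1) seq_equiv_refl by blast
qed

end

theorem theorem6p7:
  fixes \<A> :: "('o, 'm) cat_data" and C :: "'o set" and n :: nat
    and M N :: 'o and f :: 'm
  assumes "n_Frobenius_category \<A> C n"
    and "M \<in> C" and "N \<in> C" and "f \<in> Hom \<A> M N"
  shows "(\<forall>Y \<in> C. \<forall>\<gamma> \<in> Ext \<A> C n N Y. pull \<A> C \<gamma> f \<in> PExt \<A> C n M Y)
     \<longleftrightarrow> (\<forall>Y \<in> C. \<forall>\<gamma> \<in> Ext \<A> C n Y M. push \<A> C f \<gamma> \<in> PExt \<A> C n Y N)"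
proof -
  interpret n_Frobenius_category \<A> C n by fact
  show ?thesis
  proof (cases "n = 0")
    case True
    then show ?thesis using pull_iff_push_degree_0 assms by blast
  next
    case False
    show ?thesis
      using push_in_PExt[OF False assms(4,2,3)] pull_in_PExt[OF False assms(4,2,3)] by blast
  qed
qed

end
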